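(* Let $m,n\ge1$. Let $\lambda,\mu\in\mathbb{C}^m$ be such that all $\nu_a=\lambda_a-\mu_a$ ($a=1,\dots,m$) are non-negative integers not exceeding $n$, and such that $\lambda$ is dominant, i.e. $\lambda_a-\lambda_b\ne-1,-2,\dots$ whenever $a<b$. Then the operator $$I^\lambda_\mu=(-1)^N\,G_{\sigma_0(\nu)}^{-1}\,\sigma_0\,Z^\lambda_\mu\,G_\nu:\ \Phi^\lambda_\mu\to\Phi^{\sigma_0(\lambda)}_{\sigma_0(\mu)}$$ where $N=\sum_{1\le a<b\le m}\nu_a\nu_b$ and $$Z^\lambda_\mu=\prod_{1\le a<b\le m}^{\longrightarrow}\begin{cases}X^\lambda_{ab}&\text{if }\nu_a\ge\nu_b,\\ Y^\mu_{ab}&\text{if }\nu_a<\nu_b,\end{cases}$$ the factors being ordered from left to right according to a normal ordering of the pairs $a<b$: (i) is not zero; (ii) does not depend on the choice of the normal ordering; (iii) commutes with the action of the Yangian $\mathrm{Y}(\mathfrak{gl}_n)$; (iv) has image irreducible under the action of $\mathrm{Y}(\mathfrak{gl}_n)$.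
   Context: **The Yangian.** $\mathrm{Y}(\mathfrak{gl}_n)$ is the complex unital associative algebra with generators $T_{ij}^{(r)}$, $r\ge1$, $1\le i,j\le n$, and relations $$(u-v)[T_{ij}(u),T_{kl}(v)]=T_{kj}(u)T_{il}(v)-T_{kj}(v)T_{il}(u),$$ where $T_{ij}(u)=\delta_{ij}+T^{(1)}_{ij}u^{-1}+T^{(2)}_{ij}u^{-2}+\cdots$. Tensor products of modules are formed with the comultiplication $T_{ij}(u)\mapsto\sum_{k=1}^n T_{ik}(u)\otimes T_{kj}(u)$. **Standard polynomial modules.** For $0\le d\le n$ and $z\in\mathbb{C}$, $\Phi^d_z$ is the $\mathrm{Y}(\mathfrak{gl}_n)$-module with underlying space $\Lambda^d(\mathbb{C}^n)$ on which $T_{ij}(u)$ acts as $\delta_{ij}+\frac{e_{ij}}{u-z}$ (expanded in $u^{-1}$), where $e_{ij}$ is the standard matrix unit of $\mathfrak{gl}_n$ acting on the $\mathfrak{gl}_n$-module $\Lambda^d(\mathbb{C}^n)$. For $\lambda,\mu\in\mathbb{C}^m$ with $\nu=\lambda-\mu\in\{0,1,\dots,n\}^m$ put $\Phi^\lambda_\mu=\Phi^{\nu_1}_{\mu_1}\otimes\cdots\otimes\Phi^{\nu_m}_{\mu_m}$. **Symmetric group.** $\mathfrak S_m$ acts on $\mathbb{C}^m$ by $\sigma(\lambda)_a=\lambda_{\sigma^{-1}(a)}$; $\sigma_0$ is the longest element, $\sigma_0(a)=m+1-a$. **Grassmann algebra and operators.** $\mathcal G_{mn}$ is the Grassmann algebra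 on anticommuting variables $x_{ai}$ ($1\le a\le m$, $1\le i\le n$), and $\partial_{ai}$ is the left derivation with respect to $x_{ai}$. $\mathfrak S_m$ acts on $\mathcal G_{mn}$ by algebra automorphisms $\sigma(x_{ai})=x_{\sigma(a)i}$. Put $D_{ab}=\sum_{k=1}^n x_{ak}\partial_{bk}$. For $\nu\in\mathbb{Z}_{\ge0}^m$, $\mathcal G^\nu_{mn}$ is the subspace of elements of degree $\nu_a$ in the variables $x_{a1},\dots,x_{an}$ for each $a$. For $a<b$ and a weight $\kappa\in\mathbb{C}^m$ with $\kappa_a-\kappa_b\ne-1,-2,\dots$ define operators on $\mathcal G_{mn}$ (the sums are finite) $$X^\kappa_{ab}=1+\sum_{r\ge1}\frac{(-1)^rD_{ba}^rD_{ab}^r}{r!\,(\kappa_a-\kappa_b+1)_r},\qquad Y^\kappa_{ab}=1+\sum_{r\ge1}\frac{(-1)^rD_{ab}^rD_{ba}^r}{r!\,(\kappa_a-\kappa_b+1)_r},$$ with $(u)_r=u(u+1)\cdots(u+r-1)$. They preserve every $\mathcal G^\nu_{mn}$. If $\lambda$ is dominant and $\nu_a<\nu_b$ with $a<b$, then $\mu_a-\mu_b\ne0,-1,-2,\dots$, so $Y^\mu_{ab}$ is defined. **The map $G_\nu$.** $G_\nu:\Phi^\lambda_\mu\to\mathcal G^\nu_{mn}$ is the linear isomorphism $$(e_{i_1}\wedge\cdots\wedge e_{i_{\nu_1}})\otimes\cdots\otimes(e_{j_1}\wedge\cdots\wedge e_{j_{\nu_m}})\mapsto(x_{1i_1}\cdots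 x_{1i_{\nu_1}})\cdots(x_{mj_1}\cdots x_{mj_{\nu_m}}).$$ **Normal ordering.** A total ordering of the pairs $(a,b)$, $1\le a<b\le m$ (i.e. of the positive roots of $\mathfrak{gl}_m$) is normal if for all $a<b<c$ the pair $(a,c)$ lies between $(a,b)$ and $(b,c)$. *)

theory Defs
  imports Complex_Main "HOL-Algebra.QuotRing" "HOL-Library.Poly_Mapping"
begin

section \<open>Complex vector spaces with a basis\<close>

text \<open>
  The vector space with basis \<^typ>\<open>'b\<close> is \<^typ>\<open>'b \<Rightarrow>\<^sub>0 complex\<close>; the basis vector belonging to
  \<open>b\<close> is \<open>Poly_Mapping.single b 1\<close>.
\<close>

definition cscale :: "complex \<Rightarrow> ('b \<Rightarrow>\<^sub>0 complex) \<Rightarrow> ('b \<Rightarrow>\<^sub>0 complex)" where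
  "cscale c v = Poly_Mapping.map ((*) c) v"

lemma lookup_cscale [simp]:
  "Poly_Mapping.lookup (cscale c v) b = c * Poly_Mapping.lookup v b"
  by (simp add: cscale_def Poly_Mapping.map.rep_eq when_def)

interpretation cvec: vector_space cscale
  by unfold_locales (auto intro!: poly_mapping_eqI simp: lookup_add algebra_simps)

definition lin_ext :: "('a \<Rightarrow> ('b \<Rightarrow>\<^sub>0 complex)) \<Rightarrow> ('a \<Rightarrow>\<^sub>0 complex) \<Rightarrow> ('b \<Rightarrow>\<^sub>0 complex)" where
  "lin_ext g v = (\<Sum>a\<in>Poly_Mapping.keys v. cscale (Poly_Mapping.lookup v a) (g a))"

definition linear_between ::
  "('a \<Rightarrow>\<^sub>0 complex) set \<Rightarrow> ('b \<Rightarrow>\<^sub>0 complex) set \<Rightarrow> (('a \<Rightarrow>\<^sub>0 complex) \<Rightarrow> ('b \<Rightarrow>\<^sub>0 complex)) \<Rightarrow> bool" where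
  "linear_between V W f \<longleftrightarrow> f ` V \<subseteq> W \<and>
     (\<forall>x\<in>V. \<forall>y\<in>V. f (x + y) = f x + f y) \<and> (\<forall>c. \<forall>x\<in>V. f (cscale c x) = cscale c (f x))"

section \<open>The Yangian\<close>

text \<open>
  Words form a monoid. The finitely supported complex functions on words, with their convolution
  product, form the free complex associative algebra.
\<close>

datatype 'g fword = FWord (letters: "'g list")

instantiation fword :: (type) monoid_add
begin
definition "0 = FWord []"
definition "v + w = FWord (letters v @ letters w)"
instance by standard (auto simp: zero_fword_def plus_fword_def)
end

text \<open>The triple \<open>(i, j, r)\<close> stands for the generator $T_{ij}^{(r)}$.\<close>

type_synonym ygen = "nat \<times> nat \<times> nat"

definition ygens :: "nat \<Rightarrow> ygen set" where
  "ygens n = {(i, j, r). i \<in> {1..n} \<and> j \<in> {1..n} \<and> r \<ge> 1}"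

definition yfree :: "nat \<Rightarrow> (ygen fword \<Rightarrow>\<^sub>0 complex) ring" where
  "yfree n = \<lparr>carrier = {f. \<forall>w\<in>Poly_Mapping.keys f. set (letters w) \<subseteq> ygens n},
              mult = (*), one = 1, zero = 0, add = (+)\<rparr>"

text \<open>The coefficient of $u^{-r}$ in $T_{ij}(u)$; in particular $T_{ij}^{(0)} = \delta_{ij}$.\<close>

definition ycoeff :: "nat \<Rightarrow> nat \<Rightarrow> nat \<Rightarrow> (ygen fword \<Rightarrow>\<^sub>0 complex)" where
  "ycoeff i j r = (if r = 0 then (if i = j then 1 else 0)
                   else Poly_Mapping.single (FWord [(i, j, r)]) 1)"

text \<open>
  Comparing the coefficients of $u^{-r} v^{-s}$ on the two sides of
  $(u-v)[T_{ij}(u),T_{kl}(v)] = T_{kj}(u)T_{il}(v) - T_{kj}(v)T_{il}(u)$ gives the elements below.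
  The terms with $u^1$ or $v^1$ vanish on both sides, since $T_{ij}^{(0)}$ is a scalar.
\<close>

definition yrels :: "nat \<Rightarrow> (ygen fword \<Rightarrow>\<^sub>0 complex) set" where
  "yrels n =
     {(ycoeff i j (r+1) * ycoeff k l s - ycoeff k l s * ycoeff i j (r+1))
      - (ycoeff i j r * ycoeff k l (s+1) - ycoeff k l (s+1) * ycoeff i j r)
      - (ycoeff k j r * ycoeff i l s - ycoeff k j s * ycoeff i l r) | i j k l r s.
      i \<in> {1..n} \<and> j \<in> {1..n} \<and> k \<in> {1..n} \<and> l \<in> {1..n}}"

text \<open>
  The free algebra contains the scalars, so that its ideals in the sense of rings (which are
  two-sided) are ideals in the sense of complex algebras. The elements of the Yangian are cosets.
\<close>

definition yangian :: "nat \<Rightarrow> (ygen fword \<Rightarrow>\<^sub>0 complex) set ring" where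
  "yangian n = yfree n Quot (Idl\<^bsub>yfree n\<^esub> (yrels n))"

text \<open>
  A module over the Yangian is given by the operators \<open>T i j r\<close> by which the $T_{ij}^{(r)}$ act;
  the generators in a word act by composition, the rightmost one first.
\<close>

type_synonym 'b yops = "nat \<Rightarrow> nat \<Rightarrow> nat \<Rightarrow> ('b \<Rightarrow>\<^sub>0 complex) \<Rightarrow> ('b \<Rightarrow>\<^sub>0 complex)"

definition free_act :: "'b yops \<Rightarrow> (ygen fword \<Rightarrow>\<^sub>0 complex) \<Rightarrow> ('b \<Rightarrow>\<^sub>0 complex) \<Rightarrow> ('b \<Rightarrow>\<^sub>0 complex)" where
  "free_act T f v =
     lin_ext (\<lambda>w. foldr (\<lambda>(i, j, r). T i j r) (letters w) v) f"

text \<open>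
  The action of a coset \<open>y\<close>: as the operators satisfy the relations \<^const>\<open>yrels\<close>, all
  representatives of \<open>y\<close> act in the same way.
\<close>

definition yangian_act ::
  "'b yops \<Rightarrow> (ygen fword \<Rightarrow>\<^sub>0 complex) set \<Rightarrow> ('b \<Rightarrow>\<^sub>0 complex) \<Rightarrow> ('b \<Rightarrow>\<^sub>0 complex)" where
  "yangian_act T y v = the_elem ((\<lambda>f. free_act T f v) ` y)"

definition yangian_stable :: "nat \<Rightarrow> 'b yops \<Rightarrow> ('b \<Rightarrow>\<^sub>0 complex) set \<Rightarrow> bool" where
  "yangian_stable n T W \<longleftrightarrow> (\<forall>y\<in>carrier (yangian n). \<forall>w\<in>W. yangian_act T y w \<in> W)"

definition yangian_irreducible :: "nat \<Rightarrow> 'b yops \<Rightarrow> ('b \<Rightarrow>\<^sub>0 complex) set \<Rightarrow> bool" where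
  "yangian_irreducible n T U \<longleftrightarrow>
     cvec.subspace U \<and> yangian_stable n T U \<and> U \<noteq> {0} \<and>
     (\<forall>W. cvec.subspace W \<and> W \<subseteq> U \<and> yangian_stable n T W \<longrightarrow> W = {0} \<or> W = U)"

text \<open>
  The operator $A \otimes B$, where the basis vector of a tensor product $V \otimes W$ belonging
  to basis elements \<open>s\<close> of $V$ and \<open>t\<close> of $W = W_1 \otimes W_2 \otimes \cdots$ is labelled by the
  list \<open>s # t\<close>.
\<close>

definition tensor ::
  "('a \<Rightarrow>\<^sub>0 complex) \<Rightarrow> ('a list \<Rightarrow>\<^sub>0 complex) \<Rightarrow> ('a list \<Rightarrow>\<^sub>0 complex)" where
  "tensor v w = lin_ext (\<lambda>s. lin_ext (\<lambda>t. Poly_Mapping.single (s # t) 1) w) v"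

definition tensor_op ::
  "(('a \<Rightarrow>\<^sub>0 complex) \<Rightarrow> ('a \<Rightarrow>\<^sub>0 complex)) \<Rightarrow> (('a list \<Rightarrow>\<^sub>0 complex) \<Rightarrow> ('a list \<Rightarrow>\<^sub>0 complex))
     \<Rightarrow> ('a list \<Rightarrow>\<^sub>0 complex) \<Rightarrow> ('a list \<Rightarrow>\<^sub>0 complex)" where
  "tensor_op A B =
     lin_ext (\<lambda>u. case u of [] \<Rightarrow> 0
                | s # t \<Rightarrow> tensor (A (Poly_Mapping.single s 1)) (B (Poly_Mapping.single t 1)))"

text \<open>
  The tensor product of several modules, given by the comultiplication
  $T_{ij}(u) \mapsto \sum_k T_{ik}(u) \otimes T_{kj}(u)$. The empty tensor product is the trivial
  module $\mathbb{C}$ with $T_{ij}(u) \mapsto \delta_{ij}$, and $V \otimes \mathbb{C}$ is $V$.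
\<close>

fun tensor_yops :: "nat \<Rightarrow> 'a yops list \<Rightarrow> 'a list yops" where
  "tensor_yops n [] i j r = (if r = 0 \<and> i = j then id else (\<lambda>_. 0))"
| "tensor_yops n (T # Ts) i j r =
     (\<lambda>v. \<Sum>k\<in>{1..n}. \<Sum>s\<le>r. tensor_op (T i k s) (tensor_yops n Ts k j (r - s)) v)"

section \<open>Grassmann algebras\<close>

text \<open>
  The Grassmann algebra on anticommuting generators labelled by \<^typ>\<open>'p\<close>: the basis element
  belonging to a finite set \<open>A\<close> is the product of the generators in \<open>A\<close> in increasing order.
  Infinite sets do not occur in the subspaces considered below.
\<close>

definition gsign :: "'p::linorder set \<Rightarrow> 'p set \<Rightarrow> complex" where
  "gsign A B = (-1) ^ card {(p, q). p \<in> A \<and> q \<in> B \<and> q < p}"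

definition gmult :: "('p::linorder set \<Rightarrow>\<^sub>0 complex) \<Rightarrow> ('p set \<Rightarrow>\<^sub>0 complex) \<Rightarrow> ('p set \<Rightarrow>\<^sub>0 complex)" where
  "gmult v w =
     lin_ext (\<lambda>A. lin_ext (\<lambda>B. if A \<inter> B = {} then Poly_Mapping.single (A \<union> B) (gsign A B) else 0) w) v"

definition gvar :: "'p \<Rightarrow> ('p set \<Rightarrow>\<^sub>0 complex)" where
  "gvar p = Poly_Mapping.single {p} 1"

definition gprod :: "'p::linorder list \<Rightarrow> ('p set \<Rightarrow>\<^sub>0 complex)" where
  "gprod ps = foldr (\<lambda>p. gmult (gvar p)) ps (Poly_Mapping.single {} 1)"

text \<open>
  The left derivation with respect to \<open>p\<close>: moving \<open>p\<close> to the front of the monomial \<open>A\<close>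
  passes the generators in \<open>A\<close> that are smaller than \<open>p\<close>.
\<close>

definition gderiv :: "'p::linorder \<Rightarrow> ('p set \<Rightarrow>\<^sub>0 complex) \<Rightarrow> ('p set \<Rightarrow>\<^sub>0 complex)" where
  "gderiv p = lin_ext (\<lambda>A. if p \<in> A then Poly_Mapping.single (A - {p}) ((-1) ^ card {q \<in> A. q < p}) else 0)"

text \<open>The algebra homomorphism that sends each generator \<open>p\<close> to the generator \<open>\<phi> p\<close>.\<close>

definition gsubst :: "('p::linorder \<Rightarrow> 'q::linorder) \<Rightarrow> ('p set \<Rightarrow>\<^sub>0 complex) \<Rightarrow> ('q set \<Rightarrow>\<^sub>0 complex)" where
  "gsubst \<phi> = lin_ext (\<lambda>A. gprod (map \<phi> (sorted_list_of_set A)))"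

section \<open>Standard polynomial modules\<close>

text \<open>
  The exterior algebra of $\mathbb{C}^n$ is the Grassmann algebra on $e_1,\dots,e_n$. The matrix
  unit acts by
  $e_{ij}(e_{s_1}\wedge\cdots\wedge e_{s_d}) =
    \sum_k e_{s_1}\wedge\cdots\wedge e_{ij}e_{s_k}\wedge\cdots\wedge e_{s_d}$.
\<close>

definition gl_act :: "nat \<Rightarrow> nat \<Rightarrow> (nat set \<Rightarrow>\<^sub>0 complex) \<Rightarrow> (nat set \<Rightarrow>\<^sub>0 complex)" where
  "gl_act i j = lin_ext (\<lambda>S. let ss = sorted_list_of_set S in
     \<Sum>k<length ss. if ss ! k = j then gprod (ss[k := i]) else 0)"

text \<open>The coefficients of $\delta_{ij} + e_{ij}/(u-z) = \delta_{ij} + \sum_{r\ge1} z^{r-1} e_{ij} u^{-r}$.\<close>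

definition std_yops :: "complex \<Rightarrow> nat set yops" where
  "std_yops z i j r = (if r = 0 then (if i = j then id else (\<lambda>_. 0))
                       else (\<lambda>v. cscale (z ^ (r - 1)) (gl_act i j v)))"

text \<open>
  The underlying space of $\Phi^\lambda_\mu$ depends on $\nu = \lambda - \mu$ only, and the action
  is given by the same formulas for all $\nu$, with $\mu$ as parameter. Here and below,
  $\lambda,\mu,\nu$ are functions of which only the values at $1,\dots,m$ matter.
\<close>

definition Phi_space :: "nat \<Rightarrow> nat \<Rightarrow> (nat \<Rightarrow> nat) \<Rightarrow> (nat set list \<Rightarrow>\<^sub>0 complex) set" where
  "Phi_space m n \<nu> = {v. \<forall>Ss\<in>Poly_Mapping.keys v.
     list_all2 (\<lambda>a S. S \<subseteq> {1..n} \<and> card S = \<nu> a) [1..<Suc m] Ss}"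

definition Phi_yops :: "nat \<Rightarrow> nat \<Rightarrow> (nat \<Rightarrow> complex) \<Rightarrow> nat set list yops" where
  "Phi_yops m n \<mu> = tensor_yops n (map (\<lambda>a. std_yops (\<mu> a)) [1..<Suc m])"

section \<open>The intertwining operator\<close>

text \<open>The variable $x_{ai}$ is \<open>XV a i\<close>; the variables are ordered lexicographically.\<close>

datatype xvar = XV (xrow: nat) (xcol: nat)

instantiation xvar :: linorder
begin
definition "p \<le> q \<longleftrightarrow> xrow p < xrow q \<or> xrow p = xrow q \<and> xcol p \<le> xcol q"
definition "p < q \<longleftrightarrow> xrow p < xrow q \<or> xrow p = xrow q \<and> xcol p < xcol q"
instance by standard (auto simp: less_eq_xvar_def less_xvar_def xvar.expand)
end

type_synonym grass = "xvar set \<Rightarrow>\<^sub>0 complex"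

definition D_op :: "nat \<Rightarrow> nat \<Rightarrow> nat \<Rightarrow> grass \<Rightarrow> grass" where
  "D_op n a b v = (\<Sum>k\<in>{1..n}. gmult (gvar (XV a k)) (gderiv (XV b k) v))"

text \<open>
  \<^const>\<open>Sum_any\<close> is the sum of a family with finitely many nonzero terms; here
  $D_{ab}^r = 0$ for $r > n$ and $a \ne b$.
\<close>

definition X_op :: "nat \<Rightarrow> (nat \<Rightarrow> complex) \<Rightarrow> nat \<Rightarrow> nat \<Rightarrow> grass \<Rightarrow> grass" where
  "X_op n \<kappa> a b v = v + Sum_any (\<lambda>r. if r \<ge> 1 then
     cscale ((-1) ^ r / (fact r * pochhammer (\<kappa> a - \<kappa> b + 1) r))
       ((D_op n b a ^^ r) ((D_op n a b ^^ r) v)) else 0)"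

definition Y_op :: "nat \<Rightarrow> (nat \<Rightarrow> complex) \<Rightarrow> nat \<Rightarrow> nat \<Rightarrow> grass \<Rightarrow> grass" where
  "Y_op n \<kappa> a b v = v + Sum_any (\<lambda>r. if r \<ge> 1 then
     cscale ((-1) ^ r / (fact r * pochhammer (\<kappa> a - \<kappa> b + 1) r))
       ((D_op n a b ^^ r) ((D_op n b a ^^ r) v)) else 0)"

definition pos_pairs :: "nat \<Rightarrow> (nat \<times> nat) set" where
  "pos_pairs m = {(a, b). 1 \<le> a \<and> a < b \<and> b \<le> m}"

text \<open>A total ordering of the pairs is given by the list of the pairs in that order.\<close>

definition normal_ordering :: "nat \<Rightarrow> (nat \<times> nat) list \<Rightarrow> bool" where
  "normal_ordering m ps \<longleftrightarrow> distinct ps \<and> set ps = pos_pairs m \<and>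
     (\<forall>a b c p q r. a < b \<and> b < c \<and> p < length ps \<and> q < length ps \<and> r < length ps \<and>
        ps ! p = (a, b) \<and> ps ! q = (a, c) \<and> ps ! r = (b, c)
        \<longrightarrow> p < q \<and> q < r \<or> r < q \<and> q < p)"

definition Z_op :: "nat \<Rightarrow> (nat \<Rightarrow> complex) \<Rightarrow> (nat \<Rightarrow> complex) \<Rightarrow> (nat \<Rightarrow> nat) \<Rightarrow>
    (nat \<times> nat) list \<Rightarrow> grass \<Rightarrow> grass" where
  "Z_op n lam \<mu> \<nu> ps =
     foldr (\<lambda>(a, b) F. (if \<nu> a \<ge> \<nu> b then X_op n lam a b else Y_op n \<mu> a b) \<circ> F) ps id"

text \<open>$G_\nu$ is the restriction of the following map to $\Phi^\lambda_\mu$.\<close>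

definition G_map :: "(nat set list \<Rightarrow>\<^sub>0 complex) \<Rightarrow> grass" where
  "G_map = lin_ext (\<lambda>Ss. gprod (concat
     (map2 (\<lambda>a S. map (XV a) (sorted_list_of_set S)) [1..<Suc (length Ss)] Ss)))"

definition sigma0 :: "nat \<Rightarrow> nat \<Rightarrow> nat" where
  "sigma0 m a = (if a \<in> {1..m} then m + 1 - a else a)"

definition perm_act :: "(nat \<Rightarrow> nat) \<Rightarrow> (nat \<Rightarrow> 'a) \<Rightarrow> (nat \<Rightarrow> 'a)" where
  "perm_act \<sigma> w a = w (inv_into UNIV \<sigma> a)"

definition perm_grass :: "(nat \<Rightarrow> nat) \<Rightarrow> grass \<Rightarrow> grass" where
  "perm_grass \<sigma> = gsubst (\<lambda>p. XV (\<sigma> (xrow p)) (xcol p))"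

definition I_op :: "nat \<Rightarrow> nat \<Rightarrow> (nat \<Rightarrow> complex) \<Rightarrow> (nat \<Rightarrow> complex) \<Rightarrow> (nat \<Rightarrow> nat) \<Rightarrow>
    (nat \<times> nat) list \<Rightarrow> (nat set list \<Rightarrow>\<^sub>0 complex) \<Rightarrow> (nat set list \<Rightarrow>\<^sub>0 complex)" where
  "I_op m n lam \<mu> \<nu> ps v =
     cscale ((-1) ^ (\<Sum>(a, b)\<in>pos_pairs m. \<nu> a * \<nu> b))
       (inv_into (Phi_space m n (perm_act (sigma0 m) \<nu>)) G_map
         (perm_grass (sigma0 m) (Z_op n lam \<mu> \<nu> ps (G_map v))))"

end

theory Submission
  imports Defs "HOL-Computational_Algebra.Formal_Power_Series"
begin

text \<open>
  On the Grassmann algebra, $T_{ij}(u)$ acts on $\Phi^\lambda_\mu$ as the product over the rows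
  $a = 1,\dots,m$ of the matrices $1 + E^{(a)}/(u - \mu_a)$ with $E^{(a)}_{ij} = x_{ai}\partial_{aj}$.
  Each factor of $Z^\lambda_\mu$ exchanges two neighbouring factors of such a product, by a telescoping
  computation with $\mathfrak{sl}_2$, and a normal ordering is a way to reverse the product by exchanges
  of neighbours. So $Z^\lambda_\mu$ intertwines the product with the reversed one, and reversing the
  rows by $\sigma_0$ gives $\Phi^{\sigma_0(\lambda)}_{\sigma_0(\mu)}$.

  Let $\xi$ be the product of the $x_{aj}$ with $j \le \nu_a$. In every factor of
  $Z^\lambda_\mu$, the terms with $r \ge 1$ begin with an operator that kills $\xi$, hence $Z^\lambda_\mu \xi = \xi$.
  Dominance implies that every nonzero submodule for the reversed product contains $\xi$: starting
  from $k = n$, one finds in the submodule nonzero vectors whose columns $j \ge k$ are those of $\xi$,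
  by taking for each $k$ a vector of minimal degree in column $k$, on which the $T_{ik}(u)$ with
  $i < k$ vanish. By duality $\xi$ generates the module for the original order of the rows. Hence
  $Z^\lambda_\mu$ is determined by $\xi \mapsto \xi$, and every nonzero submodule of its image
  contains $\xi$ and so is the image.
\<close>

section \<open>Linear operators\<close>

text \<open>Exchanging two rows is an \<open>sl2\<close> computation because D_ab and D_ba commute
  with the diagonal gl_n (skew Howe duality): contracting the inner index in a product of two
  factors leaves E^(a)_ij - x_ai d_bj D_ba, and E^(a)_ij, E^(b)_ij, x_ai d_bj, x_bi d_aj span
  trivial plus adjoint. The two kinds of factors come from the two ways of placing D in this
  expression. In one of them \<open>e\<close> and \<open>f\<close> have to be commuted, the weight
  \<nu>_a - \<nu>_b enters, and the parameter becomes \<mu>_a - \<mu>_b + \<nu>_a - \<nu>_b =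
  \<lambda>_a - \<lambda>_b; this is X. In the other no weight enters and the parameter stays
  \<mu>_a - \<mu>_b; this is Y. The choice according to the sizes of \<nu>_a and \<nu>_b is what
  fixes \<xi>. Dominance is used in two places: the recursion for the coefficients never divides by
  0, and a certain pole differs from the \<mu>_b of the rows that follow. Poles are handled by
  expanding single matrix coefficients in 1/u. Such scalar series form an integral domain, so that
  the factors of rows without influence can be cancelled.\<close>

abbreviation bvec :: "'b \<Rightarrow> ('b \<Rightarrow>\<^sub>0 complex)" where
  "bvec b \<equiv> Poly_Mapping.single b 1"

lemma cscale_simps [simp]:
  "cscale 0 v = 0" "cscale 1 v = v" "cscale c 0 = 0" "cscale c (cscale d v) = cscale (c * d) v"
  by (auto intro!: poly_mapping_eqI)

lemma cscale_add: "cscale c (v + w) = cscale c v + cscale c w"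
  by (rule cvec.scale_right_distrib)

lemma cscale_minus: "cscale c (- v) = - cscale c v" "cscale (- c) v = - cscale c v"
  by (simp_all add: cvec.scale_minus_left)

lemma cscale_single [simp]: "cscale c (Poly_Mapping.single b d) = Poly_Mapping.single b (c * d)"
  by (auto intro!: poly_mapping_eqI simp: lookup_single when_def)

lemma keys_cscale_subset: "Poly_Mapping.keys (cscale c v) \<subseteq> Poly_Mapping.keys v"
  by (auto simp: in_keys_iff)

lemma lookup_sum': "Poly_Mapping.lookup (sum f S) b = (\<Sum>a\<in>S. Poly_Mapping.lookup (f a) b)"
  by (induction S rule: infinite_finite_induct) (auto simp: lookup_add)

lemma lin_ext_superset:
  assumes "finite S" "Poly_Mapping.keys v \<subseteq> S"
  shows "lin_ext g v = (\<Sum>a\<in>S. cscale (Poly_Mapping.lookup v a) (g a))"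
  unfolding lin_ext_def by (rule sum.mono_neutral_left) (use assms in \<open>auto simp: in_keys_iff\<close>)

lemma lin_ext_zero [simp]: "lin_ext g 0 = 0"
  by (simp add: lin_ext_def)

lemma lin_ext_add: "lin_ext g (v + w) = lin_ext g v + lin_ext g w"
proof -
  let ?S = "Poly_Mapping.keys v \<union> Poly_Mapping.keys w"
  have "Poly_Mapping.keys (v + w) \<subseteq> ?S" by (rule keys_add)
  then show ?thesis
    by (simp add: lin_ext_superset[of ?S] lookup_add cvec.scale_left_distrib sum.distrib)
qed

lemma lin_ext_cscale: "lin_ext g (cscale c v) = cscale c (lin_ext g v)"
  using keys_cscale_subset[of c v]
  by (simp add: lin_ext_superset[of "Poly_Mapping.keys v"] cvec.scale_sum_right)

lemma lin_ext_single [simp]: "lin_ext g (Poly_Mapping.single a c) = cscale c (g a)"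
  by (cases "c = 0") (simp_all add: lin_ext_def)

lemma lin_ext_bvec: "lin_ext bvec v = v"
  unfolding lin_ext_def
  by (rule poly_mapping_eqI) (simp add: lookup_sum' lookup_single when_def in_keys_iff
        sum.delta[OF finite_keys])

definition clinear :: "(('a \<Rightarrow>\<^sub>0 complex) \<Rightarrow> ('b \<Rightarrow>\<^sub>0 complex)) \<Rightarrow> bool" where
  "clinear f \<longleftrightarrow> (\<forall>v w. f (v + w) = f v + f w) \<and> (\<forall>c v. f (cscale c v) = cscale c (f v))"

lemma clinearI:
  "(\<And>v w. f (v + w) = f v + f w) \<Longrightarrow> (\<And>c v. f (cscale c v) = cscale c (f v)) \<Longrightarrow> clinear f"
  by (simp add: clinear_def)

lemma clinear_add: "clinear f \<Longrightarrow> f (v + w) = f v + f w"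
  and clinear_cscale: "clinear f \<Longrightarrow> f (cscale c v) = cscale c (f v)"
  by (simp_all add: clinear_def)

lemma clinear_lin_ext [simp, intro]: "clinear (lin_ext g)"
  by (simp add: clinear_def lin_ext_add lin_ext_cscale)

lemma clinear_zero: assumes "clinear f" shows "f 0 = 0"
  using clinear_cscale[OF assms, of 0 0] by simp

lemma clinear_minus: assumes "clinear f" shows "f (- v) = - f v"
  using clinear_cscale[OF assms, of "-1" v] by simp

lemma clinear_diff: "clinear f \<Longrightarrow> f (v - w) = f v - f w"
  using clinear_add[of f v "- w"] by (simp add: clinear_minus)

lemma clinear_sum: "clinear f \<Longrightarrow> f (sum g S) = (\<Sum>a\<in>S. f (g a))"
  by (induction S rule: infinite_finite_induct) (auto simp: clinear_zero clinear_add)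

lemma clinear_eq_lin_ext: assumes "clinear f" shows "f v = lin_ext (\<lambda>a. f (bvec a)) v"
proof -
  have "f v = f (\<Sum>a\<in>Poly_Mapping.keys v. cscale (Poly_Mapping.lookup v a) (bvec a))"
    using lin_ext_bvec[of v] by (simp only: lin_ext_def)
  then show ?thesis
    unfolding clinear_sum[OF assms] clinear_cscale[OF assms] lin_ext_def .
qed

lemma clinear_eqI_keys:
  assumes "clinear f" "clinear g" "\<And>a. a \<in> Poly_Mapping.keys v \<Longrightarrow> f (bvec a) = g (bvec a)"
  shows "f v = g v"
  using assms clinear_eq_lin_ext[of f v] clinear_eq_lin_ext[of g v] by (simp add: lin_ext_def)

lemma clinear_compose: "clinear f \<Longrightarrow> clinear g \<Longrightarrow> clinear (\<lambda>v. f (g v))"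
  by (simp add: clinear_def)

lemma clinear_keys:
  assumes "clinear f" "b \<in> Poly_Mapping.keys (f v)"
  obtains a where "a \<in> Poly_Mapping.keys v" "b \<in> Poly_Mapping.keys (f (bvec a))"
proof -
  have "f v = (\<Sum>a\<in>Poly_Mapping.keys v. cscale (Poly_Mapping.lookup v a) (f (bvec a)))"
    by (subst clinear_eq_lin_ext[OF assms(1)]) (rule lin_ext_def)
  then have "b \<in> (\<Union>a\<in>Poly_Mapping.keys v.
      Poly_Mapping.keys (cscale (Poly_Mapping.lookup v a) (f (bvec a))))"
    using assms(2) keys_sum[of "\<lambda>a. cscale (Poly_Mapping.lookup v a) (f (bvec a))" "Poly_Mapping.keys v"]
    by auto
  then obtain a where "a \<in> Poly_Mapping.keys v"
      "b \<in> Poly_Mapping.keys (cscale (Poly_Mapping.lookup v a) (f (bvec a)))"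
    by (rule UN_E)
  then show ?thesis using that[of a] keys_cscale_subset[of _ "f (bvec a)"] by fast
qed

text \<open>Linear maps get a type of their own so that they form an instance of
  \<open>ring_1\<close>, with composition as product. Powers, finite sums, ring simplification and
  later power series with operator coefficients then become available.\<close>

typedef 'b linop = "{f :: ('b \<Rightarrow>\<^sub>0 complex) \<Rightarrow> ('b \<Rightarrow>\<^sub>0 complex). clinear f}"
  morphisms app Linop
  by (rule exI[of _ "\<lambda>_. 0"]) (simp add: clinear_def)

setup_lifting type_definition_linop

lemma clinear_app [simp, intro]: "clinear (app A)"
  using app[of A] by simp

lemma app_Linop [simp]: "clinear f \<Longrightarrow> app (Linop f) = f"
  by (simp add: Linop_inverse)

instantiation linop :: (type) ring_1
begin
lift_definition zero_linop :: "'a linop" is "\<lambda>_. 0" by (simp add: clinear_def)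
lift_definition one_linop :: "'a linop" is "\<lambda>v. v" by (simp add: clinear_def)
lift_definition plus_linop :: "'a linop \<Rightarrow> 'a linop \<Rightarrow> 'a linop" is "\<lambda>f g v. f v + g v"
  by (simp add: clinear_def cscale_add)
lift_definition minus_linop :: "'a linop \<Rightarrow> 'a linop \<Rightarrow> 'a linop" is "\<lambda>f g v. f v - g v"
  by (simp add: clinear_def cvec.scale_right_diff_distrib)
lift_definition uminus_linop :: "'a linop \<Rightarrow> 'a linop" is "\<lambda>f v. - f v"
  by (simp add: clinear_def cscale_minus)
lift_definition times_linop :: "'a linop \<Rightarrow> 'a linop \<Rightarrow> 'a linop" is "\<lambda>f g v. f (g v)"
  by (simp add: clinear_def)
instance
proof
  show "(0 :: 'a linop) \<noteq> 1"
    by transfer (metis single_zero cscale_single lookup_single_eq zero_neq_one)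
qed (transfer; auto simp: fun_eq_iff clinear_def algebra_simps)+
end

lemma app_simps [simp]:
  "app 0 v = 0" "app 1 v = v" "app (A + B) v = app A v + app B v" "app (A - B) v = app A v - app B v"
  "app (- A) v = - app A v" "app (A * B) v = app A (app B v)"
  by (transfer; simp)+

lemmas app_add = clinear_add[OF clinear_app]
  and app_cscale = clinear_cscale[OF clinear_app]
  and app_zero [simp] = clinear_zero[OF clinear_app]
  and app_minus = clinear_minus[OF clinear_app]
  and app_diff = clinear_diff[OF clinear_app]
  and app_sum = clinear_sum[OF clinear_app]

lemma app_sum_left: "app (sum F S) v = (\<Sum>a\<in>S. app (F a) v)"
  by (induction S rule: infinite_finite_induct) auto

lemma linop_eqI: "(\<And>v. app A v = app B v) \<Longrightarrow> A = B"
  by (metis app_inject ext)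

lemma linop_eqI_bvec: assumes "\<And>b. app A (bvec b) = app B (bvec b)" shows "A = B"
  by (rule linop_eqI) (rule clinear_eqI_keys, auto simp: assms)

text \<open>The class \<open>ring_1\<close> has no scalar multiplication, so scalars enter as
  central elements; \<open>sc_commute\<close> and \<open>sc_left\<close> take the place of
  linearity.\<close>

lift_definition sc :: "complex \<Rightarrow> 'b linop" is cscale
  by (simp add: clinear_def cscale_add mult.commute)

lemma app_sc [simp]: "app (sc c) v = cscale c v"
  by transfer simp

lemma sc_simps: "sc 0 = 0" "sc 1 = 1" "sc (c + d) = sc c + sc d" "sc (c - d) = sc c - sc d"
  "sc (- c) = - sc c" "sc (c * d) = sc c * sc d"
  by (rule linop_eqI, simp add: cvec.scale_left_distrib cvec.scale_left_diff_distrib cscale_minus)+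

lemma sc_of_nat: "sc (of_nat r) = of_nat r"
  by (induction r) (auto simp: sc_simps)

lemma sc_commute: "A * sc c = sc c * A"
  by (rule linop_eqI) (simp add: app_cscale)

lemma sc_left: "A * (sc c * B) = sc c * (A * B)"
  by (metis mult.assoc sc_commute)

lemma sc_numeral: "sc (numeral k) = numeral k"
  by (metis of_nat_numeral sc_of_nat)

lemma app_of_nat: "app (of_nat r) v = cscale (of_nat r) v"
  by (metis app_sc sc_of_nat)

lemma app_numeral: "app (numeral k) v = cscale (numeral k) v"
  by (metis app_sc sc_numeral)

text \<open>The 2 in the weights of \<open>h\<close> produces doubled coefficients; splitting them
  into equal summands lets additive cancellation close the telescoping identities.\<close>

lemma cscale_double: "cscale (c * 2) w = cscale c w + cscale c w" "cscale 2 w = w + w"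
    "cscale (c * (d * 2)) w = cscale (c * d) w + cscale (c * d) w"
  using cvec.scale_left_distrib[of c c w] cvec.scale_left_distrib[of 1 1 w]
    cvec.scale_left_distrib[of "c * d" "c * d" w]
  by (simp_all only: mult_2_right distrib_left cscale_simps one_add_one)

definition lop :: "('b \<Rightarrow> ('b \<Rightarrow>\<^sub>0 complex)) \<Rightarrow> 'b linop" where
  "lop g = Linop (lin_ext g)"

lemma app_lop [simp]: "app (lop g) = lin_ext g"
  by (simp add: lop_def)

lemma app_bvec_eqI:
  "(\<And>a. a \<in> Poly_Mapping.keys v \<Longrightarrow> app A (bvec a) = app B (bvec a)) \<Longrightarrow> app A v = app B v"
  by (rule clinear_eqI_keys) auto

section \<open>Fermionic operators\<close>

definition psign :: "'p::linorder \<Rightarrow> 'p set \<Rightarrow> complex" where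
  "psign p A = (-1) ^ card {q \<in> A. q < p}"

text \<open>
  The operators are cut off at infinite sets, where the signs in the definitions of the
  Grassmann algebra are junk, so that the commutation relations below hold without side conditions.
\<close>

definition cre :: "'p::linorder \<Rightarrow> 'p set linop" where
  "cre p = lop (\<lambda>A. if finite A \<and> p \<notin> A then Poly_Mapping.single (insert p A) (psign p A) else 0)"

definition ann :: "'p::linorder \<Rightarrow> 'p set linop" where
  "ann p = lop (\<lambda>A. if finite A \<and> p \<in> A then Poly_Mapping.single (A - {p}) (psign p A) else 0)"

definition finpart :: "'p::linorder set linop" where
  "finpart = lop (\<lambda>A. if finite A then bvec A else 0)"

lemma cre_single: "app (cre p) (Poly_Mapping.single A c) =
    (if finite A \<and> p \<notin> A then Poly_Mapping.single (insert p A) (c * psign p A) else 0)"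
  by (simp add: cre_def)

lemma ann_single: "app (ann p) (Poly_Mapping.single A c) =
    (if finite A \<and> p \<in> A then Poly_Mapping.single (A - {p}) (c * psign p A) else 0)"
  by (simp add: ann_def)

lemma finpart_single:
  "app finpart (Poly_Mapping.single A c) = (if finite A then Poly_Mapping.single A c else 0)"
  by (simp add: finpart_def)

lemma psign_insert:
  assumes "finite A" "q \<notin> A"
  shows "psign p (insert q A) = (if q < p then - psign p A else psign p A)"
proof -
  have *: "{r \<in> insert q A. r < p} = (if q < p then insert q {r \<in> A. r < p} else {r \<in> A. r < p})"
    by auto
  have "card (insert q {r \<in> A. r < p}) = Suc (card {r \<in> A. r < p})" using assms by simp
  then show ?thesis unfolding psign_def * by simp
qed

lemma psign_remove:
  assumes "finite A" "q \<in> A"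
  shows "psign p (A - {q}) = (if q < p then - psign p A else psign p A)"
  using psign_insert[of "A - {q}" q p] assms by (auto simp: insert_absorb split: if_splits)

lemma psign_square [simp]: "psign p A * psign p A = 1" "psign p A * (psign p A * c) = c"
proof -
  show *: "psign p A * psign p A = 1" by (simp add: psign_def flip: power_mult_distrib)
  show "psign p A * (psign p A * c) = c" using * by (simp flip: mult.assoc)
qed

text \<open>Of two variables only the larger one passes the smaller one, so exactly one of the two
  orders of insertion picks up an extra sign.\<close>

lemma cre_cre: "cre p * cre q = - (cre q * cre p)"
proof (rule linop_eqI_bvec)
  fix A :: "'a set"
  show "app (cre p * cre q) (bvec A) = app (- (cre q * cre p)) (bvec A)"
  proof (cases "finite A \<and> p \<notin> A \<and> q \<notin> A \<and> p \<noteq> q")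
    case True
    then have *: "psign q A * psign p (insert q A) = - (psign p A * psign q (insert p A))"
      using psign_insert[of A q p] psign_insert[of A p q] by (auto simp: mult.commute not_less_iff_gr_or_eq split: if_splits)
    from True have "q \<noteq> p" by auto
    then show ?thesis using True
      by (simp add: cre_single * single_uminus insert_commute[of q p])
  qed (auto simp: cre_single)
qed

lemma ann_ann: "ann p * ann q = - (ann q * ann p)"
proof (rule linop_eqI_bvec)
  fix A :: "'a set"
  show "app (ann p * ann q) (bvec A) = app (- (ann q * ann p)) (bvec A)"
  proof (cases "finite A \<and> p \<in> A \<and> q \<in> A \<and> p \<noteq> q")
    case True
    then have *: "psign q A * psign p (A - {q}) = - (psign p A * psign q (A - {p}))"
      using psign_remove[of A q p] psign_remove[of A p q] by (auto simp: mult.commute not_less_iff_gr_or_eq split: if_splits)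
    have **: "A - {q} - {p} = A - {p} - {q}" by auto
    from True have "q \<noteq> p" by auto
    then show ?thesis using True
      by (simp add: ann_single * single_uminus **)
  qed (auto simp: ann_single)
qed

text \<open>The canonical anticommutation relation, with \<open>finpart\<close> where the identity
  is expected because both operators vanish on infinite sets. By \<open>finpart_mult\<close> this
  projection disappears next to any \<open>cre\<close> or \<open>ann\<close>.\<close>

lemma ann_cre: "ann p * cre q = (if p = q then finpart else 0) - cre q * ann p"
proof (rule linop_eqI_bvec)
  fix A :: "'a set"
  show "app (ann p * cre q) (bvec A) = app ((if p = q then finpart else 0) - cre q * ann p) (bvec A)"
  proof (cases "p = q")
    case True
    then show ?thesis
      by (cases "p \<in> A")
        (simp_all add: ann_single cre_single finpart_single psign_remove psign_insert insert_absorb)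
  next
    case neq: False
    show ?thesis
    proof (cases "finite A \<and> p \<in> A \<and> q \<notin> A")
      case True
      then have *: "psign q A * psign p (insert q A) = - (psign p A * psign q (A - {p}))"
        using neq psign_insert[of A q p] psign_remove[of A p q]
        by (auto simp: mult.commute not_less_iff_gr_or_eq split: if_splits)
      have **: "insert q A - {p} = insert q (A - {p})" using True by auto
      show ?thesis using True neq
        by (simp add: ann_single cre_single * ** single_uminus)
    qed (use neq in \<open>auto simp: ann_single cre_single\<close>)
  qed
qed

lemma finpart_mult [simp]:
  "finpart * cre p = cre p" "cre p * finpart = cre p"
  "finpart * ann p = ann p" "ann p * finpart = ann p"
  by (rule linop_eqI_bvec, simp add: cre_single ann_single finpart_single)+

lemma cre_cre_self [simp]: "cre p * cre p = 0" "ann p * ann p = 0"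
  by (rule linop_eqI_bvec, simp add: cre_single ann_single)+

definition eop :: "'p::linorder \<Rightarrow> 'p \<Rightarrow> 'p set linop" where
  "eop p q = cre p * ann q"

lemma eop_cre: "eop p q * cre r = cre r * eop p q + (if q = r then cre p else 0)"
proof -
  have "eop p q * cre r = cre p * (ann q * cre r)" by (simp add: eop_def mult.assoc)
  also have "\<dots> = (if q = r then cre p else 0) - (cre p * cre r) * ann q"
    unfolding ann_cre by (simp add: algebra_simps)
  also have "cre p * cre r = - (cre r * cre p)" by (rule cre_cre)
  finally show ?thesis by (simp add: eop_def mult.assoc)
qed

lemma ann_eop: "ann r * eop p q = eop p q * ann r + (if r = p then ann q else 0)"
proof -
  have "ann r * eop p q = (ann r * cre p) * ann q" by (simp add: eop_def mult.assoc)
  also have "\<dots> = (if r = p then ann q else 0) - cre p * (ann r * ann q)"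
    unfolding ann_cre by (simp add: algebra_simps)
  also have "ann r * ann q = - (ann q * ann r)" by (rule ann_ann)
  finally show ?thesis by (simp add: eop_def mult.assoc)
qed

text \<open>Moving the even operator \<open>eop p q\<close> past \<open>cre r\<close> and
  \<open>ann s\<close> leaves only the two contractions; these are the relations of matrix
  units.\<close>

lemma eop_eop: "eop p q * eop r s - eop r s * eop p q
   = (if q = r then eop p s else 0) - (if s = p then eop r q else 0)"
proof -
  have "eop p q * eop r s = (eop p q * cre r) * ann s" by (simp add: eop_def mult.assoc)
  also have "\<dots> = cre r * (eop p q * ann s) + (if q = r then eop p s else 0)"
    unfolding eop_cre by (simp add: algebra_simps) (simp add: eop_def)
  also have "eop p q * ann s = ann s * eop p q - (if s = p then ann q else 0)"
    by (simp add: ann_eop)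
  also have "cre r * \<dots> = eop r s * eop p q - (if s = p then eop r q else 0)"
    by (simp add: algebra_simps) (simp add: eop_def mult.assoc)
  finally show ?thesis by simp
qed

lemma eop_single: "app (eop p q) (Poly_Mapping.single A c) =
    (if finite A \<and> q \<in> A \<and> p \<notin> A - {q}
     then Poly_Mapping.single (insert p (A - {q})) (c * psign q A * psign p (A - {q})) else 0)"
  by (simp add: eop_def ann_single cre_single)

lemma keys_eop:
  assumes "B \<in> Poly_Mapping.keys (app (eop p q) v)"
  obtains A where "A \<in> Poly_Mapping.keys v" "finite A" "q \<in> A" "p \<notin> A - {q}" "B = insert p (A - {q})"
proof -
  obtain A where "A \<in> Poly_Mapping.keys v" "B \<in> Poly_Mapping.keys (app (eop p q) (bvec A))"
    using clinear_keys[OF clinear_app assms] .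
  then show ?thesis using that by (auto simp: eop_single split: if_splits)
qed

lemma gvar_gmult:
  assumes "\<And>A. A \<in> Poly_Mapping.keys v \<Longrightarrow> finite A"
  shows "gmult (gvar p) v = app (cre p) v"
proof -
  have "gmult (gvar p) v = lin_ext (\<lambda>B. if {p} \<inter> B = {} then Poly_Mapping.single ({p} \<union> B) (gsign {p} B) else 0) v"
    by (simp add: gmult_def gvar_def)
  also have "\<dots> = app (cre p) v"
  proof (rule clinear_eqI_keys[OF clinear_lin_ext clinear_app])
    fix A assume "A \<in> Poly_Mapping.keys v"
    then have "finite A" using assms by auto
    moreover have "card {(p', q). p' \<in> {p} \<and> q \<in> A \<and> q < p'} = card {q \<in> A. q < p}"
      by (rule bij_betw_same_card[of snd]) (auto simp: bij_betw_def inj_on_def image_iff)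
    ultimately show "lin_ext (\<lambda>B. if {p} \<inter> B = {} then Poly_Mapping.single ({p} \<union> B) (gsign {p} B) else 0) (bvec A)
        = app (cre p) (bvec A)"
      by (simp add: cre_single gsign_def psign_def)
  qed
  finally show ?thesis .
qed

lemma gderiv_eq:
  assumes "\<And>A. A \<in> Poly_Mapping.keys v \<Longrightarrow> finite A"
  shows "gderiv p v = app (ann p) v"
  unfolding gderiv_def
  by (rule clinear_eqI_keys) (auto simp: ann_single psign_def assms)

section \<open>The intertwining operators for two rows\<close>

text \<open>
  \<open>Ea, Eb, p, q\<close> span the sum of the trivial and the adjoint representation of the algebra
  $\mathfrak{sl}_2$ with the basis \<open>e, h, f\<close>.
\<close>

locale sl2_adjoint =
  fixes e f h Ea Eb p q :: "'b linop"
  assumes ef: "e * f = f * e + h"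
    and he: "h * e = e * h + 2 * e" and hf: "h * f = f * h - 2 * f"
    and hp: "h * p = p * h + 2 * p" and hq: "h * q = q * h - 2 * q"
    and eEa: "e * Ea = Ea * e - p" and eEb: "e * Eb = Eb * e + p"
    and ep: "e * p = p * e" and eq: "e * q = q * e + Ea - Eb"
    and fEa: "f * Ea = Ea * f + q" and fEb: "f * Eb = Eb * f - q"
    and fq: "f * q = q * f" and fp: "f * p = p * f + Eb - Ea"
begin

lemma of_nat_left: "A * (of_nat r * B) = of_nat r * (A * B)" "A * of_nat r = of_nat r * A" for A B :: "'b linop"
  by (metis mult.assoc mult_of_nat_commute, metis mult_of_nat_commute)

lemmas of_nat_simps = of_nat_left[of e] of_nat_left[of f] of_nat_left[of h] of_nat_left[of "e ^ r" for r]
  of_nat_left[of "f ^ r" for r] of_nat_left[of p] of_nat_left[of q]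

lemma power_left: "A ^ r * (A * B) = A * (A ^ r * B)" for A B :: "'b linop"
  by (metis mult.assoc power_commutes)

lemma e_power_p: "e ^ r * p = p * e ^ r"
  by (induction r) (simp_all add: mult.assoc, simp add: ep flip: mult.assoc)

lemma f_power_q: "f ^ r * q = q * f ^ r"
  by (induction r) (simp_all add: mult.assoc, simp add: fq flip: mult.assoc)

lemma h_e_power: "h * e ^ r = e ^ r * h + of_nat (2 * r) * e ^ r"
proof (induction r)
  case (Suc r)
  have "h * e ^ Suc r = (h * e) * e ^ r" by (simp add: mult.assoc)
  also have "\<dots> = e * (h * e ^ r) + 2 * (e * e ^ r)"
    unfolding he by (simp add: algebra_simps)
  finally show ?case
    unfolding Suc by (simp add: algebra_simps of_nat_simps mult_2)
qed simp

text \<open>Here \<open>h\<close> is kept to the left of the power of \<open>e\<close>, and in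
  \<open>e_f_power\<close> to the right of the power of \<open>f\<close>: where these identities are
  used, \<open>h\<close> then meets a weight vector.\<close>

lemma e_power_f: "e ^ Suc r * f = f * e ^ Suc r + of_nat (Suc r) * ((h - of_nat r) * e ^ r)"
proof (induction r)
  case (Suc r)
  have eh: "e * h = h * e - 2 * e" using he by simp
  have "e ^ Suc (Suc r) * f = e * (e ^ Suc r * f)" by (simp add: mult.assoc)
  also have "\<dots> = (e * f) * e ^ Suc r + of_nat (Suc r) * ((e * h - of_nat r * e) * e ^ r)"
    unfolding Suc by (simp add: algebra_simps of_nat_simps)
  also have "\<dots> = f * e ^ Suc (Suc r) + h * e ^ Suc r
      + of_nat (Suc r) * ((h - of_nat r - 2) * e ^ Suc r)"
    unfolding ef eh by (simp add: algebra_simps)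
  also have "\<dots> = f * e ^ Suc (Suc r) + of_nat (Suc (Suc r)) * ((h - of_nat (Suc r)) * e ^ Suc r)"
    by (simp add: algebra_simps mult_2 of_nat_simps)
  finally show ?case .
qed (simp add: ef)

lemma e_f_power: "e * f ^ Suc r = f ^ Suc r * e + of_nat (Suc r) * (f ^ r * (h - of_nat r))"
proof (induction r)
  case (Suc r)
  have "e * f ^ Suc (Suc r) = (e * f ^ Suc r) * f"
    by (simp only: mult.assoc power_Suc2)
  also have "\<dots> = f ^ Suc r * (e * f) + of_nat (Suc r) * (f ^ r * (h * f) - f ^ r * of_nat r * f)"
    unfolding Suc by (simp add: algebra_simps)
  also have "\<dots> = f ^ Suc r * (f * e + h) + of_nat (Suc r) * (f ^ r * (f * h - 2 * f) - f ^ r * of_nat r * f)"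
    unfolding ef hf ..
  also have "\<dots> = f ^ Suc (Suc r) * e + of_nat (Suc (Suc r)) * (f ^ Suc r * (h - of_nat (Suc r)))"
    by (simp add: algebra_simps of_nat_simps power_left power_commutes mult_2)
  finally show ?case .
qed (simp add: ef)

text \<open>In the adjoint representation the chain from \<open>q\<close> over
  \<open>Ea - Eb\<close> to \<open>p\<close> ends there, so the power rule has three terms. For r =
  0 the exponent \<open>r - 1\<close> does no harm, since its term has coefficient 0.\<close>

lemma e_power_q: "q * e ^ Suc r =
   e ^ Suc r * q - of_nat (Suc r) * (e ^ r * (Ea - Eb)) - of_nat (Suc r) * (of_nat r * (e ^ (r - 1) * p))"
proof (induction r)
  case (Suc r)
  have qe: "q * e = e * q - (Ea - Eb)" "(Ea - Eb) * e = e * (Ea - Eb) + 2 * p"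
    using eq eEa eEb by (simp_all add: algebra_simps mult_2)
  have pe: "p * e = e * p" using ep by simp
  have l: "of_nat r * (e * (e ^ (r - Suc 0) * p)) = of_nat r * (e ^ r * p)"
    by (cases r) (simp_all add: mult.assoc)
  have "q * e ^ Suc (Suc r) = (q * e ^ Suc r) * e"
    by (simp only: mult.assoc power_Suc2)
  also have "\<dots> = e ^ Suc r * (q * e) - of_nat (Suc r) * (e ^ r * ((Ea - Eb) * e)) - of_nat (Suc r) * (of_nat r * (e ^ (r - 1) * (p * e)))"
    unfolding Suc by (simp add: algebra_simps)
  also have "\<dots> = e ^ Suc (Suc r) * q - of_nat (Suc (Suc r)) * (e ^ Suc r * (Ea - Eb))
      - of_nat (Suc (Suc r)) * (of_nat (Suc r) * (e ^ r * p))"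
    unfolding qe pe by (simp add: algebra_simps of_nat_simps power_left power_commutes mult_2 l)
  finally show ?case by simp
qed (simp add: eq algebra_simps)

lemma f_power_p: "f ^ Suc r * p =
   p * f ^ Suc r + of_nat (Suc r) * ((Eb - Ea) * f ^ r) - of_nat (Suc r) * (of_nat r * (q * f ^ (r - 1)))"
proof (induction r)
  case (Suc r)
  have fE: "f * (Eb - Ea) = (Eb - Ea) * f - 2 * q"
    using fEa fEb by (simp_all add: algebra_simps mult_2)
  have l: "of_nat r * (q * (f * f ^ (r - Suc 0))) = of_nat r * (q * f ^ r)"
    by (cases r) simp_all
  have "f ^ Suc (Suc r) * p = f * (f ^ Suc r * p)" by (simp add: mult.assoc)
  also have "\<dots> = (f * p) * f ^ Suc r + of_nat (Suc r) * ((f * (Eb - Ea)) * f ^ r) - of_nat (Suc r) * (of_nat r * ((f * q) * f ^ (r - 1)))"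
    unfolding Suc by (simp add: algebra_simps of_nat_simps)
  also have "\<dots> = p * f ^ Suc (Suc r) + of_nat (Suc (Suc r)) * ((Eb - Ea) * f ^ Suc r)
      - of_nat (Suc (Suc r)) * (of_nat (Suc r) * (q * f ^ r))"
    unfolding fp fE fq by (simp add: algebra_simps of_nat_simps power_commutes mult_2 l)
  finally show ?case by simp
qed (simp add: fp algebra_simps)

lemma e_power_Ea: "e ^ r * Ea = Ea * e ^ r - of_nat r * (p * e ^ (r - 1))"
  and e_power_Eb: "e ^ r * Eb = Eb * e ^ r + of_nat r * (p * e ^ (r - 1))"
proof (induction r)
  case (Suc r)
  have l: "of_nat r * (p * (e * e ^ (r - Suc 0))) = of_nat r * (p * e ^ r)"
    by (cases r) simp_all
  have "e ^ Suc r * Ea = e * (e ^ r * Ea)" "e ^ Suc r * Eb = e * (e ^ r * Eb)" by (simp_all add: mult.assoc)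
  then have *: "e ^ Suc r * Ea = (e * Ea) * e ^ r - of_nat r * ((e * p) * e ^ (r - 1))"
    "e ^ Suc r * Eb = (e * Eb) * e ^ r + of_nat r * ((e * p) * e ^ (r - 1))"
    unfolding Suc by (simp_all add: algebra_simps of_nat_simps)
  { case 1 show ?case unfolding * ep eEa by (simp add: algebra_simps l) }
  { case 2 show ?case unfolding * ep eEb by (simp add: algebra_simps l) }
qed simp_all

lemma f_power_Ea: "Ea * f ^ r = f ^ r * Ea - of_nat r * (f ^ (r - 1) * q)"
  and f_power_Eb: "Eb * f ^ r = f ^ r * Eb + of_nat r * (f ^ (r - 1) * q)"
proof (induction r)
  case (Suc r)
  have l: "of_nat r * (f * (f ^ (r - Suc 0) * q)) = of_nat r * (f ^ r * q)"
    by (cases r) (simp_all add: mult.assoc)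
  have fE: "Ea * f = f * Ea - q" "Eb * f = f * Eb + q" using fEa fEb by simp_all
  have "Ea * f ^ Suc r = (Ea * f ^ r) * f" "Eb * f ^ Suc r = (Eb * f ^ r) * f"
    by (simp_all only: mult.assoc power_Suc2)
  then have *: "Ea * f ^ Suc r = f ^ r * (Ea * f) - of_nat r * (f ^ (r - 1) * (q * f))"
    "Eb * f ^ Suc r = f ^ r * (Eb * f) + of_nat r * (f ^ (r - 1) * (q * f))"
    unfolding Suc by (simp_all add: algebra_simps of_nat_simps)
  { case 1 show ?case unfolding * fq[symmetric] fE by (simp add: algebra_simps l power_left power_commutes) }
  { case 2 show ?case unfolding * fq[symmetric] fE by (simp add: algebra_simps l power_left power_commutes) }
qed simp_all

text \<open>
  Termwise, the two sides of the identity differ from the sum of the \<open>F r\<close> by telescoping sums; the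
  recursion for \<open>c\<close> is that of $(-1)^r / (r!\,(\kappa+1)_r)$.
\<close>

lemma X_swap:
  assumes hv: "app h v = cscale h0 v"
    and c: "\<And>r. c (Suc r) * (of_nat (Suc r) * (ma - mb + h0 + of_nat (Suc r))) = - c r"
    and R: "app (e ^ R) v = 0"
  defines "B \<equiv> - sc mb * Ea - sc (ma - 1) * Eb"
    and "X \<equiv> (\<Sum>r\<le>R. sc (c r) * (f ^ r * e ^ r))"
  shows "app (X * (B - f * p)) v = app ((B - q * e) * X) v"
proof -
  \<comment> \<open>Commutation with \<open>e\<close> sends \<open>Ea\<close> and \<open>Eb\<close>
    to opposite multiples of \<open>p\<close>, so only the difference of the two coefficients of
    \<open>B\<close> enters.\<close>
  let ?k = "mb - ma + 1"
  have eB: "e ^ r * B = B * e ^ r + sc ?k * (of_nat r * (p * e ^ (r - 1)))" for r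
  proof -
    have "e ^ r * B = - (sc mb * (e ^ r * Ea)) - sc (ma - 1) * (e ^ r * Eb)"
      by (simp add: B_def algebra_simps sc_left[of "e ^ r"])
    then show ?thesis
      unfolding e_power_Ea e_power_Eb by (simp add: B_def algebra_simps sc_simps)
  qed
  have Bf: "B * f ^ r = f ^ r * B + sc ?k * (of_nat r * (f ^ (r - 1) * q))" for r
  proof -
    have "B * f ^ r = - (sc mb * (Ea * f ^ r)) - sc (ma - 1) * (Eb * f ^ r)"
      by (simp add: B_def algebra_simps)
    then show ?thesis
      unfolding f_power_Ea f_power_Eb
      by (simp add: B_def algebra_simps sc_simps sc_left[of "f ^ r"])
  qed
  have hev: "app h (app (e ^ s) v) = cscale (h0 + 2 * of_nat s) (app (e ^ s) v)" for s
    using arg_cong[OF h_e_power[of s], of "\<lambda>A. app A v"]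
    by (simp add: hv app_numeral app_of_nat app_cscale app_add cvec.scale_left_distrib flip: mult_2)
  have hpev: "app h (app p (app (e ^ s) v)) = cscale (h0 + 2 * of_nat s + 2) (app p (app (e ^ s) v))" for s
    using arg_cong[OF hp, of "\<lambda>A. app A (app (e ^ s) v)"]
    by (simp add: hev app_numeral app_of_nat app_cscale app_add cvec.scale_left_distrib)
  define F where "F r = app (f ^ r * B * e ^ r) v" for r
  define t where "t r = app (f ^ Suc r * p * e ^ r) v" for r
  define u where "u r = app (f ^ r * q * e ^ Suc r) v" for r
  have c': "cscale (c (Suc r)) (cscale (of_nat (Suc r) * (ma - mb + h0 + of_nat (Suc r))) w) = - cscale (c r) w" for r w
    unfolding cscale_simps c by (simp add: cscale_minus)
  \<comment> \<open>The factor of \<open>t s\<close> is s + 1 times the difference of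
    \<open>?k\<close> and the value h0 + s + 2 of \<open>h - s\<close> on p e^s v. This is minus the
    factor in the recursion for \<open>c\<close>, so after multiplication by c (s + 1) the term
    cancels the \<open>t s\<close> of the previous index.\<close>
  have L: "app (f ^ Suc s * e ^ Suc s * (B - f * p)) v
    = F (Suc s) - t (Suc s) - cscale (of_nat (Suc s) * (ma - mb + h0 + of_nat (Suc s))) (t s)" for s
  proof -
    have "f ^ Suc s * e ^ Suc s * (B - f * p) = f ^ Suc s * (e ^ Suc s * B) - f ^ Suc s * ((e ^ Suc s * f) * p)"
      by (simp only: mult.assoc right_diff_distrib)
    also have "\<dots> = f ^ Suc s * B * e ^ Suc s + f ^ Suc s * (sc ?k * (of_nat (Suc s) * (p * e ^ s)))
       - f ^ Suc (Suc s) * (e ^ Suc s * p)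
       - f ^ Suc s * (of_nat (Suc s) * ((h - of_nat s) * (e ^ s * p)))"
      unfolding e_power_f eB by (simp add: algebra_simps power_left power_commutes del: of_nat_Suc)
    also have "app \<dots> v = F (Suc s) - t (Suc s) - cscale (of_nat (Suc s) * (ma - mb + h0 + of_nat (Suc s))) (t s)"
      unfolding e_power_p
      by (simp add: F_def t_def mult.assoc hpev app_of_nat app_cscale app_add app_diff cvec.scale_left_distrib
        cvec.scale_left_diff_distrib cscale_add algebra_simps cvec.scale_right_diff_distrib cscale_double)
    finally show ?thesis .
  qed
  have R': "app ((B - q * e) * (f ^ Suc s * e ^ Suc s)) v
    = F (Suc s) - u (Suc s) - cscale (of_nat (Suc s) * (ma - mb + h0 + of_nat (Suc s))) (u s)" for s
  proof -
    have "(B - q * e) * (f ^ Suc s * e ^ Suc s) = (B * f ^ Suc s) * e ^ Suc s - q * (e * f ^ Suc s) * e ^ Suc s"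
      by (simp only: mult.assoc left_diff_distrib)
    also have "\<dots> = f ^ Suc s * B * e ^ Suc s + sc ?k * (of_nat (Suc s) * (f ^ s * q * e ^ Suc s))
       - (q * f ^ Suc s) * e ^ Suc (Suc s)
       - of_nat (Suc s) * ((q * f ^ s) * ((h - of_nat s) * e ^ Suc s))"
      unfolding e_f_power Bf by (simp add: algebra_simps power_left power_commutes of_nat_simps del: of_nat_Suc)
    also have "app \<dots> v = F (Suc s) - u (Suc s) - cscale (of_nat (Suc s) * (ma - mb + h0 + of_nat (Suc s))) (u s)"
      unfolding f_power_q[symmetric]
      by (simp add: F_def u_def mult.assoc hev[of "Suc s", simplified] app_of_nat app_cscale app_add app_diff cvec.scale_left_distrib
        cvec.scale_left_diff_distrib cscale_add algebra_simps cvec.scale_right_diff_distrib cscale_double)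
    finally show ?thesis .
  qed
  have "(\<Sum>r\<le>n. cscale (c r) (app (f ^ r * e ^ r * (B - f * p)) v)) = (\<Sum>r\<le>n. cscale (c r) (F r)) - cscale (c n) (t n)" for n
  proof (induction n)
    case (Suc n)
    show ?case
      by (subst sum.atMost_Suc, subst Suc, subst L)
        (simp only: cvec.scale_right_diff_distrib c' sum.atMost_Suc, simp add: algebra_simps)
  qed (simp add: F_def t_def cvec.scale_right_diff_distrib)
  moreover have "t R = 0" by (simp add: t_def R)
  ultimately have 1: "app (X * (B - f * p)) v = (\<Sum>r\<le>R. cscale (c r) (F r))"
    by (simp add: X_def app_sum_left)
  have "(\<Sum>r\<le>n. cscale (c r) (app ((B - q * e) * (f ^ r * e ^ r)) v)) = (\<Sum>r\<le>n. cscale (c r) (F r)) - cscale (c n) (u n)" for n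
  proof (induction n)
    case (Suc n)
    show ?case
      by (subst sum.atMost_Suc, subst Suc, subst R')
        (simp only: cvec.scale_right_diff_distrib c' sum.atMost_Suc, simp add: algebra_simps)
  qed (simp add: F_def u_def cvec.scale_right_diff_distrib)
  moreover have "u R = 0" by (simp add: u_def R)
  moreover have "app ((B - q * e) * X) v = (\<Sum>r\<le>R. cscale (c r) (app ((B - q * e) * (f ^ r * e ^ r)) v))"
  proof -
    have "(B - q * e) * X = (\<Sum>r\<le>R. sc (c r) * ((B - q * e) * (f ^ r * e ^ r)))"
      by (simp only: X_def sum_distrib_left sc_left[of "B - q * e"])
    then show ?thesis by (simp add: app_sum_left)
  qed
  ultimately have "app ((B - q * e) * X) v = (\<Sum>r\<le>R. cscale (c r) (F r))" by simp
  with 1 show ?thesis by simp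
qed

text \<open>Moving \<open>f ^ r\<close> past \<open>p\<close> and \<open>e ^ r\<close> past
  \<open>q\<close> never commutes \<open>e\<close> with \<open>f\<close>, so \<open>h\<close> does
  not appear and the recursion involves \<open>ma - mb\<close> alone. The terms \<open>t\<close> and
  \<open>u\<close> cross over between the two sides; hence the two sums are compared with each other
  and not with a common middle sum.\<close>

lemma Y_swap:
  assumes c: "\<And>r. c (Suc r) * (of_nat (Suc r) * (ma - mb + of_nat (Suc r))) = - c r"
    and R: "app (f ^ R) v = 0"
  defines "B \<equiv> - sc (mb - 1) * Ea - sc ma * Eb"
    and "Y \<equiv> (\<Sum>r\<le>R. sc (c r) * (e ^ r * f ^ r))"
  shows "app (Y * (B - p * f)) v = app ((B - e * q) * Y) v"
proof -
  let ?k = "ma - mb + 1"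
  have fB: "f ^ r * B = B * f ^ r + sc ?k * (of_nat r * (f ^ (r - 1) * q))" for r
  proof -
    have "f ^ r * B = - (sc (mb - 1) * (f ^ r * Ea)) - sc ma * (f ^ r * Eb)"
      by (simp add: B_def algebra_simps sc_left[of "f ^ r"])
    moreover have "f ^ r * Ea = Ea * f ^ r + of_nat r * (f ^ (r - 1) * q)"
      "f ^ r * Eb = Eb * f ^ r - of_nat r * (f ^ (r - 1) * q)"
      by (simp_all add: f_power_Ea f_power_Eb)
    ultimately show ?thesis
      by (simp only: B_def) (simp add: algebra_simps sc_simps)
  qed
  have Be: "B * e ^ r = e ^ r * B + sc ?k * (of_nat r * (p * e ^ (r - 1)))" for r
  proof -
    have "Ea * e ^ r = e ^ r * Ea + of_nat r * (p * e ^ (r - 1))"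
      "Eb * e ^ r = e ^ r * Eb - of_nat r * (p * e ^ (r - 1))"
      by (simp_all add: e_power_Ea e_power_Eb)
    moreover have "B * e ^ r = - (sc (mb - 1) * (Ea * e ^ r)) - sc ma * (Eb * e ^ r)"
      by (simp add: B_def algebra_simps)
    ultimately show ?thesis
      by (simp only: B_def) (simp add: algebra_simps sc_simps sc_left[of "e ^ r"])
  qed
  define M where "M r = app (e ^ r * (B + of_nat r * (Ea - Eb)) * f ^ r) v" for r
  define t where "t r = app (e ^ r * p * f ^ Suc r) v" for r
  define u where "u r = app (e ^ Suc r * q * f ^ r) v" for r
  have c': "cscale (c (Suc r)) (cscale (of_nat (Suc r) * (ma - mb + of_nat (Suc r))) w) = - cscale (c r) w" for r w
    unfolding cscale_simps c by (simp add: cscale_minus)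
  have L: "app (e ^ Suc s * f ^ Suc s * (B - p * f)) v
    = M (Suc s) - t (Suc s) + cscale (of_nat (Suc s) * (ma - mb + of_nat (Suc s))) (u s)" for s
  proof -
    have l: "of_nat s * (q * (f * f ^ (s - Suc 0))) = of_nat s * (q * f ^ s)"
      by (cases s) simp_all
    have "e ^ Suc s * f ^ Suc s * (B - p * f) = e ^ Suc s * (f ^ Suc s * B) - e ^ Suc s * ((f ^ Suc s * p) * f)"
      by (simp only: mult.assoc right_diff_distrib)
    also have "f ^ Suc s * B = B * f ^ Suc s + sc ?k * (of_nat (Suc s) * (q * f ^ s))"
      unfolding fB by (simp add: f_power_q)
    also have "(f ^ Suc s * p) * f = p * f ^ Suc (Suc s) + of_nat (Suc s) * ((Eb - Ea) * f ^ Suc s) - of_nat (Suc s) * (of_nat s * (q * f ^ s))"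
      unfolding f_power_p by (simp add: algebra_simps power_commutes l del: of_nat_Suc)
    finally show ?thesis
      unfolding M_def t_def u_def
      by (elim ssubst) (simp add: M_def t_def u_def mult.assoc app_of_nat app_cscale app_add app_diff cvec.scale_left_distrib
        cvec.scale_left_diff_distrib cscale_add algebra_simps cvec.scale_right_diff_distrib cscale_double)
  qed
  have R': "app ((B - e * q) * (e ^ Suc s * f ^ Suc s)) v
    = M (Suc s) - u (Suc s) + cscale (of_nat (Suc s) * (ma - mb + of_nat (Suc s))) (t s)" for s
  proof -
    have l: "of_nat s * (e * (e ^ (s - Suc 0) * p)) = of_nat s * (e ^ s * p)"
      by (cases s) (simp_all add: mult.assoc)
    have "(B - e * q) * (e ^ Suc s * f ^ Suc s) = (B * e ^ Suc s) * f ^ Suc s - e * (q * e ^ Suc s) * f ^ Suc s"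
      by (simp only: mult.assoc left_diff_distrib)
    also have "B * e ^ Suc s = e ^ Suc s * B + sc ?k * (of_nat (Suc s) * (e ^ s * p))"
      unfolding Be by (simp add: e_power_p)
    also have "e * (q * e ^ Suc s) = e ^ Suc (Suc s) * q - of_nat (Suc s) * (e ^ Suc s * (Ea - Eb)) - of_nat (Suc s) * (of_nat s * (e ^ s * p))"
      unfolding e_power_q by (simp add: algebra_simps of_nat_simps l del: of_nat_Suc)
    finally show ?thesis
      unfolding M_def t_def u_def
      by (elim ssubst) (simp add: M_def t_def u_def mult.assoc app_of_nat app_cscale app_add app_diff cvec.scale_left_distrib
        cvec.scale_left_diff_distrib cscale_add algebra_simps cvec.scale_right_diff_distrib cscale_double)
  qed
  have tu: "app (f ^ R) v = 0 \<Longrightarrow> t R = 0 \<and> u R = 0"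
    by (simp add: t_def u_def)
  have "(\<Sum>r\<le>n. cscale (c r) (app (e ^ r * f ^ r * (B - p * f)) v)) + cscale (c n) (t n)
     = (\<Sum>r\<le>n. cscale (c r) (app ((B - e * q) * (e ^ r * f ^ r)) v)) + cscale (c n) (u n)" for n
  proof (induction n)
    case (Suc n)
    have 1: "cscale (c (Suc n)) (app (e ^ Suc n * f ^ Suc n * (B - p * f)) v) + cscale (c (Suc n)) (t (Suc n))
       = cscale (c (Suc n)) (M (Suc n)) - cscale (c n) (u n)"
      unfolding L cvec.scale_right_diff_distrib cscale_add c' by simp
    have 2: "cscale (c (Suc n)) (app ((B - e * q) * (e ^ Suc n * f ^ Suc n)) v) + cscale (c (Suc n)) (u (Suc n))
       = cscale (c (Suc n)) (M (Suc n)) - cscale (c n) (t n)"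
      unfolding R' cvec.scale_right_diff_distrib cscale_add c' by simp
    show ?case
      unfolding sum.atMost_Suc add.assoc 1 2 using Suc by (simp add: algebra_simps)
  qed (simp add: t_def u_def cvec.scale_right_diff_distrib)
  from this[of R] tu[OF R]
  have 1: "(\<Sum>r\<le>R. cscale (c r) (app (e ^ r * f ^ r * (B - p * f)) v))
     = (\<Sum>r\<le>R. cscale (c r) (app ((B - e * q) * (e ^ r * f ^ r)) v))" by simp
  have "(B - e * q) * Y = (\<Sum>r\<le>R. sc (c r) * ((B - e * q) * (e ^ r * f ^ r)))"
    by (simp only: Y_def sum_distrib_left sc_left[of "B - e * q"])
  with 1 show ?thesis by (simp add: Y_def app_sum_left)
qed

end

abbreviation Eop :: "nat \<Rightarrow> nat \<Rightarrow> nat \<Rightarrow> xvar set linop" where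
  "Eop a i j \<equiv> eop (XV a i) (XV a j)"

definition Dop :: "nat \<Rightarrow> nat \<Rightarrow> nat \<Rightarrow> xvar set linop" where
  "Dop n a b = (\<Sum>k\<in>{1..n}. eop (XV a k) (XV b k))"

lemma Dop_eop:
  assumes "i \<in> {1..n}" "j \<in> {1..n}"
  shows "Dop n c d * eop (XV a i) (XV b j) = eop (XV a i) (XV b j) * Dop n c d
    + (if d = a then eop (XV c i) (XV b j) else 0) - (if c = b then eop (XV a i) (XV d j) else 0)"
proof -
  have "Dop n c d * eop (XV a i) (XV b j) - eop (XV a i) (XV b j) * Dop n c d =
     (\<Sum>k\<in>{1..n}. (if XV d k = XV a i then eop (XV c k) (XV b j) else 0)
       - (if XV b j = XV c k then eop (XV a i) (XV d k) else 0))"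
    by (simp add: Dop_def sum_distrib_left sum_distrib_right eop_eop flip: sum_subtractf)
  also have "\<dots> = (\<Sum>k\<in>{1..n}. if k = i then if d = a then eop (XV c i) (XV b j) else 0 else 0)
       - (\<Sum>k\<in>{1..n}. if k = j then if c = b then eop (XV a i) (XV d j) else 0 else 0)"
    unfolding sum_subtractf
    by (intro arg_cong2[where f = "(-)"] sum.cong) auto
  also have "\<dots> = (if d = a then eop (XV c i) (XV b j) else 0) - (if c = b then eop (XV a i) (XV d j) else 0)"
    using assms by (simp add: sum.delta)
  finally show ?thesis by (simp add: algebra_simps)
qed

text \<open>This is the gl_m side of skew Howe duality; the gl_n side is the diagonal action by sums
  of \<open>Eop\<close>.\<close>

lemma Dop_Dop: "Dop n c d * Dop n a b = Dop n a b * Dop n c d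
    + (if d = a then Dop n c b else 0) - (if c = b then Dop n a d else 0)"
proof -
  have "Dop n c d * Dop n a b = (\<Sum>k\<in>{1..n}. Dop n c d * eop (XV a k) (XV b k))"
    by (simp add: Dop_def sum_distrib_left)
  also have "\<dots> = (\<Sum>k\<in>{1..n}. eop (XV a k) (XV b k) * Dop n c d
    + (if d = a then eop (XV c k) (XV b k) else 0) - (if c = b then eop (XV a k) (XV d k) else 0))"
    by (rule sum.cong) (simp_all add: Dop_eop)
  finally show ?thesis
    by (auto simp: Dop_def sum.distrib sum_subtractf sum_distrib_right)
qed

text \<open>For fixed columns i and j, the four operators x_ci d_dj with c, d in {a, b} behave like
  the 2 by 2 matrix units under commutation with the \<open>Dop\<close>.\<close>

lemma sl2_adjoint_rows:
  assumes "a \<noteq> b" "i \<in> {1..n}" "j \<in> {1..n}"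
  shows "sl2_adjoint (Dop n a b) (Dop n b a) (Dop n a a - Dop n b b) (Eop a i j) (Eop b i j)
     (eop (XV a i) (XV b j)) (eop (XV b i) (XV a j))"
proof -
  have n2: "sc 2 = 2" by (rule sc_numeral)
  have "Dop n a b * Dop n b a = Dop n b a * Dop n a b + (Dop n a a - Dop n b b)"
    by (simp add: Dop_Dop[of n a b])
  moreover have "(Dop n a a - Dop n b b) * Dop n a b = Dop n a b * (Dop n a a - Dop n b b) + 2 * Dop n a b"
    "(Dop n a a - Dop n b b) * Dop n b a = Dop n b a * (Dop n a a - Dop n b b) - 2 * Dop n b a"
    using assms(1) by (simp_all add: left_diff_distrib right_diff_distrib mult_2 Dop_Dop[of n a a] Dop_Dop[of n b b])
  ultimately show ?thesis
    using assms
    by unfold_locales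
      (simp_all add: left_diff_distrib right_diff_distrib mult_2 Dop_eop[of i n j])
qed

text \<open>Rearranging the four fermions, one contraction yields E^(a)_ij, and in the quartic rest
  the sum over k assembles to D_ba. This brings the product of two factors into the
  \<open>sl2\<close> setting.\<close>

lemma sum_Eop_Eop:
  assumes "a \<noteq> b" "j \<in> {1..n}"
  shows "(\<Sum>k\<in>{1..n}. Eop a i k * Eop b k j) = Eop a i j - eop (XV a i) (XV b j) * Dop n b a"
proof -
  have *: "Eop a i k * Eop b k j = (if j = k then Eop a i j else 0) - eop (XV a i) (XV b j) * eop (XV b k) (XV a k)" for k
  proof -
    have "eop (XV a i) (XV b j) * eop (XV b k) (XV a k)
        = cre (XV a i) * (ann (XV b j) * cre (XV b k)) * ann (XV a k)"
      by (simp add: eop_def mult.assoc)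
    also have "\<dots> = (if j = k then Eop a i j else 0) - cre (XV a i) * cre (XV b k) * (ann (XV b j) * ann (XV a k))"
      unfolding ann_cre by (simp add: algebra_simps eop_def)
    also have "ann (XV b j) * ann (XV a k) = - (ann (XV a k) * ann (XV b j))" by (rule ann_ann)
    also have "cre (XV a i) * cre (XV b k) * - (ann (XV a k) * ann (XV b j))
       = - (cre (XV a i) * (cre (XV b k) * ann (XV a k)) * ann (XV b j))"
      by (simp add: mult.assoc)
    also have "cre (XV b k) * ann (XV a k) = - (ann (XV a k) * cre (XV b k))"
      using assms(1) by (simp add: ann_cre)
    finally show ?thesis by (simp add: eop_def mult.assoc)
  qed
  show ?thesis unfolding * sum_subtractf using assms(2)
    by (simp add: Dop_def sum_distrib_left sum.delta')
qed

section \<open>Tensor products of rows\<close>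

definition Lop :: "(nat \<Rightarrow> complex) \<Rightarrow> nat \<Rightarrow> nat \<Rightarrow> nat \<Rightarrow> nat \<Rightarrow> xvar set linop" where
  "Lop \<mu> a i j r = (if r = 0 then (if i = j then 1 else 0) else sc (\<mu> a ^ (r - 1)) * Eop a i j)"

text \<open>
  The coefficients of the product, in the order given by a list of rows, of the matrices
  $1 + E^{(a)}/(u - \mu_a)$ with $E^{(a)}_{ij} = x_{ai} \partial_{aj}$. The order does not affect
  which rows the operators act on, so all orders give Yangian actions on the same space.
\<close>

fun Top :: "nat \<Rightarrow> (nat \<Rightarrow> complex) \<Rightarrow> nat list \<Rightarrow> nat \<Rightarrow> nat \<Rightarrow> nat \<Rightarrow> xvar set linop" where
  "Top n \<mu> [] i j r = (if r = 0 \<and> i = j then 1 else 0)"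
| "Top n \<mu> (a # c) i j r = (\<Sum>k\<in>{1..n}. \<Sum>s\<le>r. Lop \<mu> a i k s * Top n \<mu> c k j (r - s))"

lemma Top_singleton:
  assumes "j \<in> {1..n}"
  shows "Top n \<mu> [a] i j r = Lop \<mu> a i j r"
proof -
  have "Top n \<mu> [a] i j r = (\<Sum>k\<in>{1..n}. \<Sum>s\<le>r. if s = r then if k = j then Lop \<mu> a i j r else 0 else 0)"
    unfolding Top.simps by (intro sum.cong) auto
  then show ?thesis using assms by simp
qed

text \<open>The change of indices behind the associativity of the convolution product of
  series.\<close>

lemma triangle_sum_swap:
  fixes g :: "nat \<Rightarrow> nat \<Rightarrow> nat \<Rightarrow> 'a :: comm_monoid_add"
  shows "(\<Sum>s\<le>r. \<Sum>t\<le>r - s. g s t (r - s - t)) = (\<Sum>s\<le>r. \<Sum>t\<le>s. g t (s - t) (r - s))"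
proof -
  have "(\<Sum>s\<le>r. \<Sum>t\<le>r - s. g s t (r - s - t)) = (\<Sum>(s, t)\<in>(SIGMA s:{..r}. {..r - s}). g s t (r - s - t))"
    by (rule sum.Sigma) auto
  also have "(SIGMA s:{..r}. {..r - s}) = {(s, t). s + t \<le> r}" by auto
  also have "(\<Sum>(s, t)\<in>\<dots>. g s t (r - s - t)) = (\<Sum>s\<le>r. \<Sum>t\<le>s. g t (s - t) (r - t - (s - t)))"
    by (rule sum.triangle_reindex_eq)
  also have "\<dots> = (\<Sum>s\<le>r. \<Sum>t\<le>s. g t (s - t) (r - s))"
    by (intro sum.cong) auto
  finally show ?thesis .
qed

lemma Top_append:
  assumes "i \<in> {1..n}"
  shows "Top n \<mu> (c @ d) i j r = (\<Sum>k\<in>{1..n}. \<Sum>s\<le>r. Top n \<mu> c i k s * Top n \<mu> d k j (r - s))"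
  using assms
proof (induction c arbitrary: i r)
  case Nil
  have "(\<Sum>k\<in>{1..n}. \<Sum>s\<le>r. Top n \<mu> [] i k s * Top n \<mu> d k j (r - s))
     = (\<Sum>k\<in>{1..n}. \<Sum>s\<le>r. if s = 0 then if k = i then Top n \<mu> d i j r else 0 else 0)"
    unfolding Top.simps by (intro sum.cong) auto
  also have "\<dots> = Top n \<mu> d i j r" using Nil by simp
  finally show ?case by simp
next
  case (Cons a c)
  have "Top n \<mu> ((a # c) @ d) i j r = (\<Sum>k\<in>{1..n}. \<Sum>s\<le>r. Lop \<mu> a i k s *
      (\<Sum>l\<in>{1..n}. \<Sum>t\<le>r - s. Top n \<mu> c k l t * Top n \<mu> d l j (r - s - t)))"
    by (simp add: Cons.IH del: atLeastAtMost_iff)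
  also have "\<dots> = (\<Sum>k\<in>{1..n}. \<Sum>l\<in>{1..n}. \<Sum>s\<le>r. \<Sum>t\<le>r - s.
       Lop \<mu> a i k s * Top n \<mu> c k l t * Top n \<mu> d l j (r - s - t))"
    by (simp only: sum_distrib_left mult.assoc) (rule sum.cong[OF refl], rule sum.swap)
  also have "\<dots> = (\<Sum>l\<in>{1..n}. \<Sum>k\<in>{1..n}. \<Sum>s\<le>r. \<Sum>t\<le>s.
       Lop \<mu> a i k t * Top n \<mu> c k l (s - t) * Top n \<mu> d l j (r - s))"
    unfolding triangle_sum_swap[of "\<lambda>s t x. Lop \<mu> a i k s * Top n \<mu> c k l t * Top n \<mu> d l j x" for k l]
    by (rule sum.swap)
  also have "\<dots> = (\<Sum>l\<in>{1..n}. \<Sum>s\<le>r. Top n \<mu> (a # c) i l s * Top n \<mu> d l j (r - s))"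
    by (simp only: Top.simps sum_distrib_right) (rule sum.cong[OF refl], rule sum.swap)
  finally show ?case .
qed

lemma Top_commute:
  assumes "\<And>a k l. a \<in> set c \<Longrightarrow> A * Eop a k l = Eop a k l * A"
  shows "A * Top n \<mu> c i j r = Top n \<mu> c i j r * A"
  using assms
proof (induction c arbitrary: i r)
  case (Cons a c)
  have L: "A * Lop \<mu> a i k s = Lop \<mu> a i k s * A" for k s
    using Cons.prems[of a i k] by (simp add: Lop_def) (metis mult.assoc sc_commute)
  have *: "A * (Lop \<mu> a i k s * Top n \<mu> c k j t) = Lop \<mu> a i k s * Top n \<mu> c k j t * A" for k s t
    using Cons.IH[of k t] Cons.prems L[of k s] by (metis list.set_intros(2) mult.assoc)
  show ?case by (simp add: sum_distrib_left sum_distrib_right *)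
qed simp

lemma eop_commute: "q \<noteq> r \<Longrightarrow> s \<noteq> p \<Longrightarrow> eop p q * eop r s = eop r s * eop p q"
  using eop_eop[of p q r s] by simp

lemma Eop_commute: "a \<noteq> b \<Longrightarrow> Eop a i j * Eop b k l = Eop b k l * Eop a i j"
  by (rule eop_commute) auto

lemma Dop_Eop_commute: "c \<noteq> a \<Longrightarrow> c \<noteq> b \<Longrightarrow> Dop n a b * Eop c k l = Eop c k l * Dop n a b"
  unfolding Dop_def sum_distrib_left sum_distrib_right
  by (intro sum.cong refl eop_commute) auto

lemma power_commute: "A * B = B * A \<Longrightarrow> A ^ r * B = B * A ^ r" for A B :: "'b linop"
  by (induction r) (simp_all add: mult.assoc, simp flip: mult.assoc)

lemma Top_0: "i \<in> {1..n} \<Longrightarrow> Top n \<mu> c i j 0 = (if i = j then 1 else 0)"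
proof (induction c arbitrary: i)
  case (Cons a c)
  have "Top n \<mu> (a # c) i j 0 = (\<Sum>k\<in>{1..n}. if k = i then if i = j then 1 else 0 else 0)"
    unfolding Top.simps by (intro sum.cong) (use Cons.IH in \<open>auto simp: Lop_def\<close>)
  then show ?case using Cons.prems by simp
qed auto

text \<open>The sum over s is the coefficient of u^(-r-1) in 1/((u - \<mu>_a)(u - \<mu>_b)), a
  complete symmetric polynomial. Its symmetry allows the two orders of the rows to be
  compared.\<close>

lemma Top_pair:
  assumes "i \<in> {1..n}" "j \<in> {1..n}"
  shows "Top n \<mu> [a, b] i j (Suc r) = sc (\<mu> a ^ r) * Eop a i j + sc (\<mu> b ^ r) * Eop b i j
    + sc (\<Sum>s<r. \<mu> a ^ s * \<mu> b ^ (r - Suc s)) * (\<Sum>k\<in>{1..n}. Eop a i k * Eop b k j)"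
proof -
  have sc_sum: "sc (sum g S) = (\<Sum>s\<in>S. sc (g s))" for g :: "nat \<Rightarrow> complex" and S
    by (induction S rule: infinite_finite_induct) (simp_all add: sc_simps)
  have *: "Lop \<mu> a i k (Suc s) * Lop \<mu> b k j (r - s)
     = sc (\<mu> a ^ s * \<mu> b ^ (r - Suc s)) * (Eop a i k * Eop b k j)" if "s < r" for k s
    using that by (simp add: Lop_def sc_simps mult.assoc sc_left[of "Eop a i k"] sc_left[of "sc (\<mu> a ^ s)"])
  have gen: "(\<Sum>s\<le>Suc r. g s) = g 0 + ((\<Sum>s<r. g (Suc s)) + g (Suc r))" for g :: "nat \<Rightarrow> xvar set linop"
    unfolding sum.atMost_Suc_shift unfolding lessThan_Suc_atMost[symmetric] sum.lessThan_Suc ..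
  have "Top n \<mu> [a, b] i j (Suc r) = (\<Sum>k\<in>{1..n}. \<Sum>s\<le>Suc r. Lop \<mu> a i k s * Lop \<mu> b k j (Suc r - s))"
    using assms(2) by (simp only: Top.simps(2)[of n \<mu> a "[b]"] Top_singleton)
  also have "\<dots> = (\<Sum>k\<in>{1..n}. Lop \<mu> a i k 0 * Lop \<mu> b k j (Suc r)
     + ((\<Sum>s<r. Lop \<mu> a i k (Suc s) * Lop \<mu> b k j (r - s)) + Lop \<mu> a i k (Suc r) * Lop \<mu> b k j 0))"
    unfolding gen by simp
  also have "\<dots> = (\<Sum>k\<in>{1..n}. Lop \<mu> a i k 0 * Lop \<mu> b k j (Suc r))
     + ((\<Sum>k\<in>{1..n}. \<Sum>s<r. Lop \<mu> a i k (Suc s) * Lop \<mu> b k j (r - s))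
        + (\<Sum>k\<in>{1..n}. Lop \<mu> a i k (Suc r) * Lop \<mu> b k j 0))"
    by (simp only: sum.distrib)
  also have "(\<Sum>k\<in>{1..n}. Lop \<mu> a i k 0 * Lop \<mu> b k j (Suc r)) = (\<Sum>k\<in>{1..n}. if k = i then sc (\<mu> b ^ r) * Eop b i j else 0)"
    by (intro sum.cong) (auto simp: Lop_def)
  also have "\<dots> = sc (\<mu> b ^ r) * Eop b i j" using assms(1) by simp
  also have "(\<Sum>k\<in>{1..n}. Lop \<mu> a i k (Suc r) * Lop \<mu> b k j 0) = (\<Sum>k\<in>{1..n}. if k = j then sc (\<mu> a ^ r) * Eop a i j else 0)"
    by (intro sum.cong) (auto simp: Lop_def)
  also have "\<dots> = sc (\<mu> a ^ r) * Eop a i j" using assms(2) by simp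
  also have "(\<Sum>k\<in>{1..n}. \<Sum>s<r. Lop \<mu> a i k (Suc s) * Lop \<mu> b k j (r - s))
     = (\<Sum>k\<in>{1..n}. \<Sum>s<r. sc (\<mu> a ^ s * \<mu> b ^ (r - Suc s)) * (Eop a i k * Eop b k j))"
    by (intro sum.cong refl) (simp add: *)
  also have "\<dots> = sc (\<Sum>s<r. \<mu> a ^ s * \<mu> b ^ (r - Suc s)) * (\<Sum>k\<in>{1..n}. Eop a i k * Eop b k j)"
    by (simp only: sum_distrib_left sum_distrib_right sc_sum)
  finally show ?thesis by (simp add: algebra_simps)
qed

text \<open>
  Up to a combination with the operators of the diagonal action of $\mathfrak{gl}_n$, all
  coefficients for two rows are multiples of the single operators below.
\<close>

lemma Top_pair_swap:
  fixes \<mu> :: "nat \<Rightarrow> complex"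
  assumes "a \<noteq> b" "i \<in> {1..n}" "j \<in> {1..n}"
  defines "H \<equiv> \<lambda>r. (\<Sum>s<r. \<mu> a ^ s * \<mu> b ^ (r - Suc s))"
  defines "P \<equiv> sc (- \<mu> b) * Eop a i j + sc (- \<mu> a) * Eop b i j"
  shows "Top n \<mu> [a, b] i j (Suc r) = sc (H r) * (P + (\<Sum>k\<in>{1..n}. Eop a i k * Eop b k j))
      + sc (\<mu> a ^ r + \<mu> b * H r) * (Eop a i j + Eop b i j)"
    "Top n \<mu> [b, a] i j (Suc r) = sc (H r) * (P + (\<Sum>k\<in>{1..n}. Eop b i k * Eop a k j))
      + sc (\<mu> a ^ r + \<mu> b * H r) * (Eop a i j + Eop b i j)"
proof -
  \<comment> \<open>A divided difference written without division, so that \<mu>_a = \<mu>_b is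
    covered.\<close>
  have "\<mu> a ^ r - \<mu> b ^ r = (\<mu> a - \<mu> b) * H r"
    unfolding H_def by (subst power_diff_sumr2) (simp add: mult.commute)
  then have **: "\<mu> a ^ r + \<mu> b * H r = \<mu> b ^ r + \<mu> a * H r" by (simp add: algebra_simps)
  have rev: "(\<Sum>s<r. \<mu> b ^ s * \<mu> a ^ (r - Suc s)) = H r"
    unfolding H_def by (subst sum.nat_diff_reindex[symmetric]) (auto intro!: sum.cong simp: mult.commute)
  have E: "sc (\<mu> a ^ r) * Eop a i j + sc (\<mu> b ^ r) * Eop b i j
     = sc (H r) * P + sc (\<mu> a ^ r + \<mu> b * H r) * (Eop a i j + Eop b i j)"
  proof -
    have 1: "sc (H r) * P = - (sc (H r * \<mu> b) * Eop a i j) - sc (H r * \<mu> a) * Eop b i j"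
      by (simp add: P_def sc_simps algebra_simps)
    have 2: "sc (\<mu> a ^ r + \<mu> b * H r) * (Eop a i j + Eop b i j)
       = sc (\<mu> a ^ r + \<mu> b * H r) * Eop a i j + sc (\<mu> b ^ r + \<mu> a * H r) * Eop b i j"
      using ** by (simp add: distrib_left)
    show ?thesis unfolding 1 2 by (simp add: sc_simps(3) algebra_simps)
  qed
  show "Top n \<mu> [a, b] i j (Suc r) = sc (H r) * (P + (\<Sum>k\<in>{1..n}. Eop a i k * Eop b k j))
      + sc (\<mu> a ^ r + \<mu> b * H r) * (Eop a i j + Eop b i j)"
    unfolding Top_pair[OF assms(2,3)] E by (simp add: H_def algebra_simps)
  show "Top n \<mu> [b, a] i j (Suc r) = sc (H r) * (P + (\<Sum>k\<in>{1..n}. Eop b i k * Eop a k j))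
      + sc (\<mu> a ^ r + \<mu> b * H r) * (Eop a i j + Eop b i j)"
    unfolding Top_pair[OF assms(2,3)] rev using E by (simp add: algebra_simps)
qed

text \<open>Exchanging the rows turns the summands of X into those of Y: X is \<open>Xlin\<close> at
  (a, b) and Y is \<open>Xlin\<close> at (b, a), both with the coefficients belonging to the pair
  (a, b). The cutoff R is chosen so that the powers vanish from there on.\<close>

definition Xlin :: "nat \<Rightarrow> nat \<Rightarrow> (nat \<Rightarrow> complex) \<Rightarrow> nat \<Rightarrow> nat \<Rightarrow> xvar set linop" where
  "Xlin n R c a b = (\<Sum>r\<le>R. sc (c r) * (Dop n b a ^ r * Dop n a b ^ r))"

lemma Xlin_commute:
  assumes "Dop n a b * B = B * Dop n a b" "Dop n b a * B = B * Dop n b a"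
  shows "Xlin n R c a b * B = B * Xlin n R c a b"
proof -
  have "Dop n b a ^ r * Dop n a b ^ r * B = B * (Dop n b a ^ r * Dop n a b ^ r)" for r
    by (metis power_commute[OF assms(1)] power_commute[OF assms(2)] mult.assoc)
  then show ?thesis
    by (simp add: Xlin_def sum_distrib_left sum_distrib_right mult.assoc sc_left[of B])
qed

text \<open>The diagonal gl_n of the two rows commutes with D_ab and D_ba, so the part of
  \<open>Top_pair_swap\<close> outside the \<open>sl2\<close> exchange passes through
  unchanged.\<close>

lemma Xlin_commute_diagonal:
  assumes "a \<noteq> b" "i \<in> {1..n}" "j \<in> {1..n}"
  shows "Xlin n R c a b * (Eop a i j + Eop b i j) = (Eop a i j + Eop b i j) * Xlin n R c a b"
    "Xlin n R c b a * (Eop a i j + Eop b i j) = (Eop a i j + Eop b i j) * Xlin n R c b a"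
  using assms by (rule_tac [!] Xlin_commute) (simp_all add: Dop_eop distrib_left distrib_right)

lemma Xlin_Top_pair:
  assumes ij: "a \<noteq> b" "i \<in> {1..n}" "j \<in> {1..n}"
    and hv: "app (Dop n a a - Dop n b b) v = cscale h0 v"
    and c: "\<And>r. c (Suc r) * (of_nat (Suc r) * (\<mu> a - \<mu> b + h0 + of_nat (Suc r))) = - c r"
    and R: "app (Dop n a b ^ R) v = 0"
  shows "app (Xlin n R c a b * Top n \<mu> [a, b] i j r) v = app (Top n \<mu> [b, a] i j r * Xlin n R c a b) v"
proof (cases r)
  case 0
  then show ?thesis using ij by (simp add: Top_0 del: Top.simps)
next
  case (Suc r')
  interpret S: sl2_adjoint "Dop n a b" "Dop n b a" "Dop n a a - Dop n b b" "Eop a i j" "Eop b i j"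
     "eop (XV a i) (XV b j)" "eop (XV b i) (XV a j)"
    by (rule sl2_adjoint_rows[OF ij])
  let ?B = "- sc (\<mu> b) * Eop a i j - sc (\<mu> a - 1) * Eop b i j"
  let ?P = "sc (- \<mu> b) * Eop a i j + sc (- \<mu> a) * Eop b i j"
  \<comment> \<open>Replacing \<open>p * f\<close> by \<open>f * p\<close> shifts the coefficient of
    \<open>Eb\<close> from -\<mu>_a to -(\<mu>_a - 1). After that both orders of the rows show the
    same \<open>B\<close>, as \<open>X_swap\<close> requires.\<close>
  have 1: "?P + (\<Sum>k\<in>{1..n}. Eop a i k * Eop b k j) = ?B - Dop n b a * eop (XV a i) (XV b j)"
    unfolding sum_Eop_Eop[OF ij(1) ij(3)]
    by (simp add: S.fp sc_simps algebra_simps)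
  have 2: "?P + (\<Sum>k\<in>{1..n}. Eop b i k * Eop a k j) = ?B - eop (XV b i) (XV a j) * Dop n a b"
    unfolding sum_Eop_Eop[OF ij(1)[symmetric] ij(3)]
    by (simp add: sc_simps algebra_simps)
  note swap = S.X_swap[OF hv c R, folded Xlin_def]
  note diag = Xlin_commute_diagonal(1)[OF ij, of R c]
  show ?thesis
    unfolding Suc Top_pair_swap(1)[OF ij] Top_pair_swap(2)[OF ij] 1 2
    using swap arg_cong[OF diag, of "\<lambda>A. app A v"]
    by (simp add: distrib_left distrib_right sc_left[of "Xlin n R c a b"] del: app_simps(6))
       (simp add: mult.assoc flip: cscale_add)
qed

lemma Ylin_Top_pair:
  assumes ij: "a \<noteq> b" "i \<in> {1..n}" "j \<in> {1..n}"
    and c: "\<And>r. c (Suc r) * (of_nat (Suc r) * (\<mu> a - \<mu> b + of_nat (Suc r))) = - c r"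
    and R: "app (Dop n b a ^ R) v = 0"
  shows "app (Xlin n R c b a * Top n \<mu> [a, b] i j r) v = app (Top n \<mu> [b, a] i j r * Xlin n R c b a) v"
proof (cases r)
  case 0
  then show ?thesis using ij by (simp add: Top_0 del: Top.simps)
next
  case (Suc r')
  interpret S: sl2_adjoint "Dop n a b" "Dop n b a" "Dop n a a - Dop n b b" "Eop a i j" "Eop b i j"
     "eop (XV a i) (XV b j)" "eop (XV b i) (XV a j)"
    by (rule sl2_adjoint_rows[OF ij])
  let ?B = "- sc (\<mu> b - 1) * Eop a i j - sc (\<mu> a) * Eop b i j"
  let ?P = "sc (- \<mu> b) * Eop a i j + sc (- \<mu> a) * Eop b i j"
  have 1: "?P + (\<Sum>k\<in>{1..n}. Eop a i k * Eop b k j) = ?B - eop (XV a i) (XV b j) * Dop n b a"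
    unfolding sum_Eop_Eop[OF ij(1) ij(3)]
    by (simp add: sc_simps algebra_simps)
  \<comment> \<open>Now it is the second order in which factors are commuted, \<open>q * e\<close>
    into \<open>e * q\<close>, and the shift by 1 falls on the coefficient of
    \<open>Ea\<close>.\<close>
  have 2: "?P + (\<Sum>k\<in>{1..n}. Eop b i k * Eop a k j) = ?B - Dop n a b * eop (XV b i) (XV a j)"
    unfolding sum_Eop_Eop[OF ij(1)[symmetric] ij(3)]
    by (simp add: S.eq sc_simps algebra_simps)
  note swap = S.Y_swap[OF c R, folded Xlin_def]
  note diag = Xlin_commute_diagonal(2)[OF ij, of R c]
  show ?thesis
    unfolding Suc Top_pair_swap(1)[OF ij] Top_pair_swap(2)[OF ij] 1 2
    using swap arg_cong[OF diag, of "\<lambda>A. app A v"]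
    by (simp add: distrib_left distrib_right sc_left[of "Xlin n R c b a"] del: app_simps(6))
       (simp add: mult.assoc flip: cscale_add)
qed

section \<open>Weight spaces\<close>

text \<open>Degrees are integers so that \<open>Dop\<close> can lower them without case
  distinctions; a negative degree forces the zero vector (\<open>Gw_negative\<close>), and this is
  where the nilpotency of the \<open>Dop\<close> comes from.\<close>

definition Gw :: "nat \<Rightarrow> (nat \<Rightarrow> int) \<Rightarrow> grass set" where
  "Gw n \<omega> = {v. \<forall>A\<in>Poly_Mapping.keys v. finite A \<and> (\<forall>p\<in>A. xcol p \<in> {1..n}) \<and>
     (\<forall>a. int (card {p \<in> A. xrow p = a}) = \<omega> a)}"

lemma zero_Gw [simp]: "0 \<in> Gw n \<omega>"
  by (simp add: Gw_def)

lemma add_Gw: "v \<in> Gw n \<omega> \<Longrightarrow> w \<in> Gw n \<omega> \<Longrightarrow> v + w \<in> Gw n \<omega>"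
  using keys_add[of v w] unfolding Gw_def by blast

lemma cscale_Gw: "v \<in> Gw n \<omega> \<Longrightarrow> cscale c v \<in> Gw n \<omega>"
  using keys_cscale_subset[of c v] unfolding Gw_def by blast

lemma sum_Gw: "(\<And>x. x \<in> S \<Longrightarrow> g x \<in> Gw n \<omega>) \<Longrightarrow> sum g S \<in> Gw n \<omega>"
  by (induction S rule: infinite_finite_induct) (auto simp: add_Gw)

lemma subspace_Gw: "cvec.subspace (Gw n \<omega>)"
  by (rule cvec.subspaceI) (auto simp: add_Gw cscale_Gw)

lemma Gw_finite: "v \<in> Gw n \<omega> \<Longrightarrow> A \<in> Poly_Mapping.keys v \<Longrightarrow> finite A"
  by (simp add: Gw_def)

lemma Gw_negative:
  assumes "v \<in> Gw n \<omega>" "\<omega> a < 0"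
  shows "v = 0"
proof (rule ccontr)
  assume "v \<noteq> 0"
  then obtain A where "A \<in> Poly_Mapping.keys v" by (metis all_not_in_conv keys_eq_empty)
  then have "int (card {p \<in> A. xrow p = a}) = \<omega> a" using assms(1) by (simp add: Gw_def)
  then show False using assms(2) by linarith
qed

text \<open>With \<open>g\<close> the row this gives the change of weight under \<open>eop\<close>,
  with \<open>g\<close> the column the change of a column degree. The case p = q is
  included.\<close>

lemma card_exchange:
  assumes "finite A" "q \<in> A" "p \<notin> A - {q}"
  shows "int (card {r \<in> insert p (A - {q}). g r = c})
    = int (card {r \<in> A. g r = c}) + (if c = g p then 1 else 0) - (if c = g q then 1 else 0)"
proof -
  have 1: "int (card {r \<in> A - {q}. g r = c}) = int (card {r \<in> A. g r = c}) - (if c = g q then 1 else 0)"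
  proof (cases "c = g q")
    case True
    then have "{r \<in> A. g r = c} = insert q {r \<in> A - {q}. g r = c}" using assms by auto
    then show ?thesis using assms True by simp
  next
    case False
    then have "{r \<in> A. g r = c} = {r \<in> A - {q}. g r = c}" by auto
    then show ?thesis using False by simp
  qed
  have 2: "int (card {r \<in> insert p (A - {q}). g r = c}) = int (card {r \<in> A - {q}. g r = c}) + (if c = g p then 1 else 0)"
  proof (cases "c = g p")
    case True
    then have "{r \<in> insert p (A - {q}). g r = c} = insert p {r \<in> A - {q}. g r = c}" by auto
    then show ?thesis using assms True by simp
  next
    case False
    then have "{r \<in> insert p (A - {q}). g r = c} = {r \<in> A - {q}. g r = c}" by auto
    then show ?thesis using False by simp
  qed
  show ?thesis unfolding 2 1 by simp
qed

lemma eop_Gw: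
  assumes "v \<in> Gw n \<omega>" "i \<in> {1..n}"
  shows "app (eop (XV a i) (XV b j)) v
    \<in> Gw n (\<lambda>c. \<omega> c + (if c = a then 1 else 0) - (if c = b then 1 else 0))"
  unfolding Gw_def
proof (intro CollectI ballI conjI allI)
  fix B assume "B \<in> Poly_Mapping.keys (app (eop (XV a i) (XV b j)) v)"
  then obtain A where A: "A \<in> Poly_Mapping.keys v" "finite A" "XV b j \<in> A" "XV a i \<notin> A - {XV b j}"
    "B = insert (XV a i) (A - {XV b j})" by (rule keys_eop)
  then show "finite B" by simp
  show "xcol p \<in> {1..n}" if "p \<in> B" for p
    using that A assms by (auto simp: Gw_def)
  show "int (card {p \<in> B. xrow p = c}) = \<omega> c + (if c = a then 1 else 0) - (if c = b then 1 else 0)" for c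
    using A assms card_exchange[of A "XV b j" "XV a i" xrow c] by (simp add: Gw_def)
qed

lemma Eop_Gw: "v \<in> Gw n \<omega> \<Longrightarrow> i \<in> {1..n} \<Longrightarrow> app (Eop a i j) v \<in> Gw n \<omega>"
  using eop_Gw[of v n \<omega> i a a j] by simp

lemma Dop_Gw:
  "v \<in> Gw n \<omega> \<Longrightarrow> app (Dop n a b) v \<in> Gw n (\<lambda>c. \<omega> c + (if c = a then 1 else 0) - (if c = b then 1 else 0))"
  unfolding Dop_def app_sum_left by (intro sum_Gw eop_Gw)

lemma Dop_power_Gw: "v \<in> Gw n \<omega> \<Longrightarrow>
  app (Dop n a b ^ r) v \<in> Gw n (\<lambda>c. \<omega> c + (if c = a then int r else 0) - (if c = b then int r else 0))"
proof (induction r)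
  case (Suc r)
  show ?case
    by (rule back_subst[of "\<lambda>\<omega>. app (Dop n a b ^ Suc r) v \<in> Gw n \<omega>"])
      (use Dop_Gw[OF Suc.IH[OF Suc.prems], of a b] in simp, auto)
next
  case 0
  have "(\<lambda>c. \<omega> c + (if c = a then int 0 else 0) - (if c = b then int 0 else 0)) = \<omega>" by auto
  then show ?case using 0 by simp
qed

lemma Dop_power_Gw_zero:
  assumes "v \<in> Gw n \<omega>" "a \<noteq> b" "int r > \<omega> b"
  shows "app (Dop n a b ^ r) v = 0"
proof -
  have "app (Dop n a b ^ r) v \<in> Gw n (\<lambda>c. \<omega> c + (if c = a then int r else 0) - (if c = b then int r else 0))"
    by (rule Dop_power_Gw[OF assms(1)])
  from Gw_negative[OF this, of b] show ?thesis using assms by simp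
qed

lemma sum_const_cscale: "(\<Sum>x\<in>S. v) = cscale (of_nat (card S)) v"
  by (induction S rule: infinite_finite_induct) (auto simp: cvec.scale_left_distrib)

text \<open>D_aa is the Euler operator of row a: each summand x_ak d_ak tests whether the variable
  occurs.\<close>

lemma Dop_same_Gw:
  assumes "v \<in> Gw n \<omega>"
  shows "app (Dop n a a) v = cscale (of_int (\<omega> a)) v"
proof -
  have "app (Dop n a a) v = app (sc (of_int (\<omega> a))) v"
  proof (rule app_bvec_eqI)
    fix A assume "A \<in> Poly_Mapping.keys v"
    then have A: "finite A" "\<forall>p\<in>A. xcol p \<in> {1..n}" "int (card {p \<in> A. xrow p = a}) = \<omega> a"
      using assms by (auto simp: Gw_def)
    have "app (Eop a k k) (bvec A) = (if XV a k \<in> A then bvec A else 0)" for k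
      using A(1) by (simp add: eop_single psign_remove insert_absorb)
    then have "app (Dop n a a) (bvec A) = (\<Sum>k\<in>{1..n}. if XV a k \<in> A then bvec A else 0)"
      by (simp add: Dop_def app_sum_left)
    also have "\<dots> = (\<Sum>k\<in>{k\<in>{1..n}. XV a k \<in> A}. bvec A)"
      by (subst sum.inter_filter) auto
    also have "\<dots> = cscale (of_nat (card {k\<in>{1..n}. XV a k \<in> A})) (bvec A)"
      by (rule sum_const_cscale)
    also have "card {k\<in>{1..n}. XV a k \<in> A} = card {p \<in> A. xrow p = a}"
    proof (rule bij_betw_same_card[of "XV a"])
      show "bij_betw (XV a) {k\<in>{1..n}. XV a k \<in> A} {p \<in> A. xrow p = a}"
        using A(2) by (auto simp: bij_betw_def inj_on_def image_iff) (metis xvar.collapse)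
    qed
    finally show "app (Dop n a a) (bvec A) = app (sc (of_int (\<omega> a))) (bvec A)"
      by (simp flip: A(3))
  qed
  then show ?thesis by simp
qed

lemma Top_Gw:
  assumes "v \<in> Gw n \<omega>" "i \<in> {1..n}"
  shows "app (Top n \<mu> c i j r) v \<in> Gw n \<omega>"
  using assms(2)
proof (induction c arbitrary: i r)
  case (Cons a c)
  have L: "app (Lop \<mu> a i k s) w \<in> Gw n \<omega>" if "w \<in> Gw n \<omega>" for k s w
    using that Cons.prems by (auto simp: Lop_def Eop_Gw cscale_Gw)
  show ?case unfolding Top.simps app_sum_left app_simps(6)
    by (intro sum_Gw L Cons.IH)
next
  case Nil
  then show ?case using assms(1) by (cases "r = 0 \<and> i = j") simp_all
qed

section \<open>The operators of the normal ordering\<close>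

lemma D_op_eq:
  assumes "\<And>A. A \<in> Poly_Mapping.keys v \<Longrightarrow> finite A"
  shows "D_op n a b v = app (Dop n a b) v"
proof -
  have *: "finite B" if B: "B \<in> Poly_Mapping.keys (app (ann p) v)" for B and p :: xvar
  proof -
    obtain A where "B \<in> Poly_Mapping.keys (app (ann p) (bvec A))"
      using clinear_keys[OF clinear_app B] .
    then show ?thesis by (auto simp: ann_single split: if_splits)
  qed
  have "gderiv q v = app (ann q) v" for q
    by (rule gderiv_eq) (rule assms)
  then have "gmult (gvar p) (gderiv q v) = app (eop p q) v" for p q
    unfolding eop_def app_simps(6) by (simp add: gvar_gmult *)
  then show ?thesis by (simp only: D_op_def Dop_def app_sum_left)
qed

lemma D_op_power_eq:
  assumes "v \<in> Gw n \<omega>"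
  shows "(D_op n a b ^^ r) v = app (Dop n a b ^ r) v"
proof (induction r)
  case (Suc r)
  have "D_op n a b (app (Dop n a b ^ r) v) = app (Dop n a b) (app (Dop n a b ^ r) v)"
    by (rule D_op_eq) (rule Gw_finite[OF Dop_power_Gw[OF assms]])
  then show ?case using Suc by simp
qed simp

definition xcoeff :: "complex \<Rightarrow> nat \<Rightarrow> complex" where
  "xcoeff z r = (-1) ^ r / (fact r * pochhammer (z + 1) r)"

lemma xcoeff_Suc:
  assumes "\<And>k::nat. k \<ge> 1 \<Longrightarrow> z \<noteq> - of_nat k"
  shows "xcoeff z (Suc r) * (of_nat (Suc r) * (z + of_nat (Suc r))) = - xcoeff z r"
proof -
  have "z + of_nat (Suc r) \<noteq> 0" using assms[of "Suc r"] by (metis add_eq_0_iff2 le_add1 plus_1_eq_Suc)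
  moreover have "xcoeff z (Suc r) = - xcoeff z r / (of_nat (Suc r) * (z + of_nat (Suc r)))"
    by (simp add: xcoeff_def pochhammer_Suc mult_ac add_ac)
  ultimately show ?thesis by (simp del: of_nat_Suc)
qed

text \<open>The summand \<open>v\<close> is the term r = 0, hence the override at 0. A row has
  degree at most n, so the power n + 1 is sure to vanish; the exchange lemmas need this at the
  cutoff itself.\<close>

lemma sum_D_op_eq:
  assumes "v \<in> Gw n \<omega>" "a \<noteq> b" "\<omega> b \<le> int n"
  shows "v + Sum_any (\<lambda>r. if r \<ge> 1 then cscale (c r) ((D_op n b a ^^ r) ((D_op n a b ^^ r) v)) else 0)
     = app (Xlin n (Suc n) (c(0 := 1)) a b) v"
proof -
  have D: "(D_op n b a ^^ r) ((D_op n a b ^^ r) v) = app (Dop n b a ^ r * Dop n a b ^ r) v" for r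
    using D_op_power_eq[OF assms(1)] D_op_power_eq[OF Dop_power_Gw[OF assms(1)]] by simp
  have z: "app (Dop n a b ^ r) v = 0" if "r > Suc n" for r
    using Dop_power_Gw_zero[OF assms(1,2), of r] assms(3) that by simp
  have "Sum_any (\<lambda>r. if r \<ge> 1 then cscale (c r) ((D_op n b a ^^ r) ((D_op n a b ^^ r) v)) else 0)
     = (\<Sum>r\<le>Suc n. if r \<ge> 1 then cscale (c r) (app (Dop n b a ^ r * Dop n a b ^ r) v) else 0)"
    unfolding D
  proof (rule Sum_any.expand_superset)
    have "r \<le> Suc n" if "(if r \<ge> 1 then cscale (c r) (app (Dop n b a ^ r * Dop n a b ^ r) v) else 0) \<noteq> 0" for r
      using z[of r] that by (cases "r \<le> Suc n") (auto split: if_splits)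
    then show "{r. (if r \<ge> 1 then cscale (c r) (app (Dop n b a ^ r * Dop n a b ^ r) v) else 0) \<noteq> 0} \<subseteq> {..Suc n}"
      by blast
  qed simp
  then show ?thesis
    unfolding Xlin_def sum.atMost_Suc_shift by (simp add: app_sum_left)
qed

definition Zfac :: "nat \<Rightarrow> (nat \<Rightarrow> complex) \<Rightarrow> (nat \<Rightarrow> complex) \<Rightarrow> (nat \<Rightarrow> nat) \<Rightarrow> nat \<Rightarrow> nat \<Rightarrow> xvar set linop" where
  "Zfac n lam \<mu> \<nu> a b = (if \<nu> a \<ge> \<nu> b then Xlin n (Suc n) (xcoeff (lam a - lam b)) a b
     else Xlin n (Suc n) (xcoeff (\<mu> a - \<mu> b)) b a)"

definition Zlin :: "nat \<Rightarrow> (nat \<Rightarrow> complex) \<Rightarrow> (nat \<Rightarrow> complex) \<Rightarrow> (nat \<Rightarrow> nat) \<Rightarrow> (nat \<times> nat) list \<Rightarrow> xvar set linop" where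
  "Zlin n lam \<mu> \<nu> ps = foldr (\<lambda>(a, b) F. Zfac n lam \<mu> \<nu> a b * F) ps 1"

lemma Xlin_Gw:
  assumes "v \<in> Gw n \<omega>"
  shows "app (Xlin n R c a b) v \<in> Gw n \<omega>"
proof -
  have "app (Dop n b a ^ r * Dop n a b ^ r) v \<in> Gw n \<omega>" for r
    using Dop_power_Gw[OF Dop_power_Gw[OF assms, of a b r], of b a r] by (simp add: algebra_simps)
  then show ?thesis by (simp add: Xlin_def app_sum_left sum_Gw cscale_Gw del: app_simps(6))
      (simp add: sum_Gw cscale_Gw)
qed

lemma Zlin_Gw: "v \<in> Gw n \<omega> \<Longrightarrow> app (Zlin n lam \<mu> \<nu> ps) v \<in> Gw n \<omega>"
  by (induction ps) (auto simp: Zlin_def Zfac_def Xlin_Gw)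

lemma Z_op_eq:
  assumes "v \<in> Gw n \<omega>" "\<And>a. \<omega> a \<le> int n" "\<And>a b. (a, b) \<in> set ps \<Longrightarrow> a \<noteq> b"
  shows "Z_op n lam \<mu> \<nu> ps v = app (Zlin n lam \<mu> \<nu> ps) v"
  using assms(3)
proof (induction ps)
  case (Cons ab ps)
  obtain a b where ab: "ab = (a, b)" by fastforce
  let ?w = "app (Zlin n lam \<mu> \<nu> ps) v"
  have w: "?w \<in> Gw n \<omega>" by (rule Zlin_Gw[OF assms(1)])
  have "a \<noteq> b" using Cons.prems ab by auto
  have 0: "(xcoeff z)(0 := 1) = xcoeff z" for z by (auto simp: xcoeff_def)
  have X: "X_op n lam a b ?w = app (Xlin n (Suc n) (xcoeff (lam a - lam b)) a b) ?w"
    unfolding X_op_def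
    using sum_D_op_eq[OF w \<open>a \<noteq> b\<close> assms(2), of "xcoeff (lam a - lam b)"] unfolding 0 xcoeff_def .
  have Y: "Y_op n \<mu> a b ?w = app (Xlin n (Suc n) (xcoeff (\<mu> a - \<mu> b)) b a) ?w"
    unfolding Y_op_def
    using sum_D_op_eq[OF w \<open>a \<noteq> b\<close>[symmetric] assms(2), of "xcoeff (\<mu> a - \<mu> b)"] unfolding 0 xcoeff_def .
  have "Z_op n lam \<mu> \<nu> ps v = ?w" using Cons by auto
  then show ?case using X Y by (simp add: Z_op_def Zlin_def Zfac_def ab)
qed (simp add: Z_op_def Zlin_def)

text \<open>\<open>Z\<close> commutes with all rows in \<open>c1\<close> and \<open>c2\<close>. The
  exchange of a and b is known only on a weight space; it applies because the action of
  \<open>c2\<close>, which comes first, stays in that space.\<close>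

lemma Top_swap_adjacent:
  assumes "distinct (c1 @ a # b # c2)" "i \<in> {1..n}" "j \<in> {1..n}" "v \<in> Gw n \<omega>"
    and ZE: "\<And>c k l. c \<noteq> a \<Longrightarrow> c \<noteq> b \<Longrightarrow> Z * Eop c k l = Eop c k l * Z"
    and Z: "\<And>w i j r. w \<in> Gw n \<omega> \<Longrightarrow> i \<in> {1..n} \<Longrightarrow> j \<in> {1..n} \<Longrightarrow>
       app (Z * Top n \<mu> [a, b] i j r) w = app (Top n \<mu> [b, a] i j r * Z) w"
  shows "app (Z * Top n \<mu> (c1 @ a # b # c2) i j r) v = app (Top n \<mu> (c1 @ b # a # c2) i j r * Z) v"
proof -
  have 1: "Z * Top n \<mu> c1 i k s = Top n \<mu> c1 i k s * Z" for k s
    by (rule Top_commute, rule ZE) (use assms(1) in auto)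
  have 2: "Z * Top n \<mu> c2 i k s = Top n \<mu> c2 i k s * Z" for i k s
    by (rule Top_commute, rule ZE) (use assms(1) in auto)
  have split: "Top n \<mu> (c1 @ x # y # c2) i j r = (\<Sum>k\<in>{1..n}. \<Sum>s\<le>r. \<Sum>l\<in>{1..n}. \<Sum>t\<le>r - s.
      Top n \<mu> c1 i k s * (Top n \<mu> [x, y] k l t * Top n \<mu> c2 l j (r - s - t)))" for x y
  proof -
    have "Top n \<mu> (c1 @ x # y # c2) i j r = Top n \<mu> (c1 @ ([x, y] @ c2)) i j r" by simp
    also have "\<dots> = (\<Sum>k\<in>{1..n}. \<Sum>s\<le>r. Top n \<mu> c1 i k s * Top n \<mu> ([x, y] @ c2) k j (r - s))"
      by (rule Top_append[OF assms(2)])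
    also have "\<dots> = (\<Sum>k\<in>{1..n}. \<Sum>s\<le>r. \<Sum>l\<in>{1..n}. \<Sum>t\<le>r - s.
      Top n \<mu> c1 i k s * (Top n \<mu> [x, y] k l t * Top n \<mu> c2 l j (r - s - t)))"
      by (intro sum.cong refl) (simp only: Top_append[of _ n \<mu> "[x, y]" c2] sum_distrib_left)
    finally show ?thesis .
  qed
  have 3: "app (Z * (Top n \<mu> c1 i k s * (Top n \<mu> [a, b] k l t * Top n \<mu> c2 l j x))) v
     = app (Top n \<mu> c1 i k s * (Top n \<mu> [b, a] k l t * Top n \<mu> c2 l j x) * Z) v"
    if "k \<in> {1..n}" "l \<in> {1..n}" for k l s t x
  proof -
    let ?w = "app (Top n \<mu> c2 l j x) v"
    have w: "?w \<in> Gw n \<omega>" by (rule Top_Gw[OF assms(4) that(2)])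
    have "app (Z * (Top n \<mu> c1 i k s * (Top n \<mu> [a, b] k l t * Top n \<mu> c2 l j x))) v
       = app (Z * Top n \<mu> c1 i k s) (app (Top n \<mu> [a, b] k l t) ?w)" by (simp del: Top.simps)
    also have "\<dots> = app (Top n \<mu> c1 i k s) (app (Z * Top n \<mu> [a, b] k l t) ?w)"
      unfolding 1 by (simp del: Top.simps)
    also have "\<dots> = app (Top n \<mu> c1 i k s * Top n \<mu> [b, a] k l t) (app (Z * Top n \<mu> c2 l j x) v)"
      unfolding Z[OF w that] by (simp del: Top.simps)
    finally show ?thesis unfolding 2 by (simp del: Top.simps)
  qed
  show ?thesis
    unfolding split sum_distrib_left sum_distrib_right app_sum_left
    by (intro sum.cong refl) (use 3 in simp)
qed

definition wt :: "nat \<Rightarrow> (nat \<Rightarrow> nat) \<Rightarrow> nat \<Rightarrow> int" where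
  "wt m \<nu> a = (if a \<in> {1..m} then int (\<nu> a) else 0)"

definition xi_set :: "nat \<Rightarrow> (nat \<Rightarrow> nat) \<Rightarrow> xvar set" where
  "xi_set m \<nu> = {p. xrow p \<in> {1..m} \<and> xcol p \<in> {1..\<nu> (xrow p)}}"

section \<open>Orders of the rows and their reversal along a normal ordering\<close>

fun bef :: "'a list \<Rightarrow> ('a \<times> 'a) set" where
  "bef [] = {}"
| "bef (x # xs) = {x} \<times> set xs \<union> bef xs"

lemma bef_append: "bef (xs @ ys) = bef xs \<union> set xs \<times> set ys \<union> bef ys"
  by (induction xs) auto

lemma bef_subset: "bef xs \<subseteq> set xs \<times> set xs"
  by (induction xs) auto

lemma bef_adjacent:
  "(a, b) \<in> bef c \<Longrightarrow> (\<And>k. (a, k) \<in> bef c \<Longrightarrow> (k, b) \<in> bef c \<Longrightarrow> False) \<Longrightarrow> \<exists>c1 c2. c = c1 @ a # b # c2"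
proof (induction c)
  case (Cons x xs)
  show ?case
  proof (cases "(a, b) \<in> bef xs")
    case True
    then obtain c1 c2 where "xs = c1 @ a # b # c2" using Cons by auto
    then show ?thesis by (metis append_Cons)
  next
    case False
    then have ab: "a = x" "b \<in> set xs" using Cons.prems(1) by auto
    then obtain y ys where xs: "xs = y # ys" by (cases xs) auto
    have "b = y" using Cons.prems(2)[of y] ab xs by auto
    then show ?thesis using ab xs by (metis append_Nil)
  qed
qed simp

lemma bef_antisym: "distinct c \<Longrightarrow> (x, y) \<in> bef c \<Longrightarrow> (y, x) \<notin> bef c"
  using bef_subset by (induction c) auto

lemma bef_sorted: "sorted_wrt (<) c \<Longrightarrow> bef c = {(a, b). a \<in> set c \<and> b \<in> set c \<and> a < b}" for c :: "nat list"
  by (induction c) auto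

lemma bef_decreasing:
  fixes c :: "nat list"
  assumes "distinct c" "set c = {1..m}" "\<And>a b. (a, b) \<in> bef c \<Longrightarrow> \<not> a < b"
  shows "c = rev [1..<Suc m]"
proof -
  have "sorted (rev c)"
    using assms(3)
  proof (induction c)
    case (Cons x c)
    then show ?case by (auto simp: sorted_append not_less)
  qed simp
  then have "rev c = [1..<Suc m]"
    by (intro sorted_distinct_set_unique) (use assms in \<open>auto simp del: upt_Suc\<close>)
  then show ?thesis by (metis rev_rev_ident)
qed

text \<open>
  Read from the right, a normal ordering turns the increasing order of the rows into the decreasing
  one by transpositions of neighbours: if \<open>ds\<close> has been carried out, leading to the order \<open>c\<close>, the
  last of the remaining pairs consists of neighbours in \<open>c\<close>.
\<close>

lemma normal_ordering_adjacent:
  assumes "normal_ordering m (rs @ (a, b) # ds)" "distinct c" "set c = {1..m}"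
    and rs: "set (rs @ [(a, b)]) = {(x, y) \<in> bef c. x < y}"
  shows "\<exists>c1 c2. c = c1 @ a # b # c2"
proof (rule bef_adjacent)
  show ab: "(a, b) \<in> bef c" using rs by auto
  have "a < b" using rs by auto
  let ?ps = "rs @ (a, b) # ds"
  have dist: "distinct ?ps" and set: "set ?ps = pos_pairs m"
    and norm: "\<And>a b c p q r. a < b \<Longrightarrow> b < c \<Longrightarrow> p < length ?ps \<Longrightarrow> q < length ?ps \<Longrightarrow> r < length ?ps \<Longrightarrow>
        ?ps ! p = (a, b) \<Longrightarrow> ?ps ! q = (a, c) \<Longrightarrow> ?ps ! r = (b, c)
        \<Longrightarrow> p < q \<and> q < r \<or> r < q \<and> q < p"
    using assms(1) unfolding normal_ordering_def by blast+
  let ?n = "length rs"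
  have n: "?n < length ?ps" "?ps ! ?n = (a, b)" by simp_all
  have early: "\<exists>p<?n. ?ps ! p = (x, y)" if "(x, y) \<in> bef c" "x < y" "(x, y) \<noteq> (a, b)" for x y
  proof -
    have "(x, y) \<in> set rs" using that rs by auto
    then obtain p where "p < length rs" "rs ! p = (x, y)" by (metis in_set_conv_nth)
    then show ?thesis by (auto simp: nth_append)
  qed
  have late: "\<exists>p>?n. p < length ?ps \<and> ?ps ! p = (x, y)" if "(y, x) \<in> bef c" "x < y" for x y
  proof -
    have "(x, y) \<notin> bef c" using that(1) bef_antisym[OF assms(2)] by blast
    then have "(x, y) \<notin> set (rs @ [(a, b)])" using rs by auto
    moreover have "(x, y) \<in> set ?ps"
      using that bef_subset[of c] assms(3) unfolding set pos_pairs_def by auto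
    ultimately have "(x, y) \<in> set ds" by auto
    then obtain p where p: "p < length ds" "ds ! p = (x, y)" by (metis in_set_conv_nth)
    then show ?thesis by (intro exI[of _ "Suc (?n + p)"]) (auto simp: nth_append)
  qed
  fix k assume k: "(a, k) \<in> bef c" "(k, b) \<in> bef c"
  then have "k \<noteq> a" "k \<noteq> b"
    using bef_antisym[OF assms(2)] by blast+
  \<comment> \<open>Pairs still in increasing order stand left of (a, b) in the list, reversed ones
    stand right of it. In each case the pair formed by the smallest and the largest of a, b, k would
    therefore come first or last among the three pairs, against normality.\<close>
  then consider "a < k" "k < b" | "k < a" | "b < k" by linarith
  then show False
  proof cases
    case 1
    obtain p where "p < ?n" "?ps ! p = (a, k)" using early[OF k(1)] 1 by auto
    moreover obtain r where "r < ?n" "?ps ! r = (k, b)" using early[OF k(2)] 1 by auto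
    ultimately show False using norm[of a k b p ?n r] 1 n by auto
  next
    case 2
    obtain p where "p > ?n" "p < length ?ps" "?ps ! p = (k, a)" using late[OF k(1)] 2 by auto
    moreover obtain q where "q < ?n" "?ps ! q = (k, b)" using early[OF k(2)] 2 \<open>a < b\<close> by auto
    ultimately show False using norm[of k a b p q ?n] 2 n \<open>a < b\<close> by auto
  next
    case 3
    obtain q where "q < ?n" "?ps ! q = (a, k)" using early[OF k(1)] 3 \<open>a < b\<close> by auto
    moreover obtain r where "r > ?n" "r < length ?ps" "?ps ! r = (b, k)" using late[OF k(2)] 3 by auto
    ultimately show False using norm[of a b k ?n q r] 3 n \<open>a < b\<close> by auto
  qed
qed

section \<open>The ordered product of the exchange operators\<close>

locale dominant_weights =
  fixes m n :: nat and lam \<mu> :: "nat \<Rightarrow> complex" and \<nu> :: "nat \<Rightarrow> nat"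
  assumes nu: "\<And>a. a \<in> {1..m} \<Longrightarrow> lam a - \<mu> a = of_nat (\<nu> a) \<and> \<nu> a \<le> n"
    and dominant: "\<And>a b k. 1 \<le> a \<Longrightarrow> a < b \<Longrightarrow> b \<le> m \<Longrightarrow> (1::nat) \<le> k \<Longrightarrow> lam a - lam b \<noteq> - of_nat k"
begin

lemma wt_le: "wt m \<nu> a \<le> int n"
  using nu[of a] by (auto simp: wt_def)

text \<open>In the first case \<open>h\<close> has the eigenvalue \<nu>_a - \<nu>_b, and adding it
  to \<mu>_a - \<mu>_b gives the parameter \<lambda>_a - \<lambda>_b of X. In the second case
  \<mu>_a - \<mu>_b is itself the parameter.\<close>

lemma Zfac_Top_pair:
  assumes "v \<in> Gw n (wt m \<nu>)" "i \<in> {1..n}" "j \<in> {1..n}" and ab: "1 \<le> a" "a < b" "b \<le> m"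
  shows "app (Zfac n lam \<mu> \<nu> a b * Top n \<mu> [a, b] i j r) v
    = app (Top n \<mu> [b, a] i j r * Zfac n lam \<mu> \<nu> a b) v"
proof -
  have mem: "a \<in> {1..m}" "b \<in> {1..m}" using ab by auto
  have mu: "\<mu> a = lam a - of_nat (\<nu> a)" "\<mu> b = lam b - of_nat (\<nu> b)"
    using nu[OF mem(1)] nu[OF mem(2)] by (simp_all add: algebra_simps)
  show ?thesis
  proof (cases "\<nu> a \<ge> \<nu> b")
    case True
    have "app (Dop n a a - Dop n b b) v = cscale (of_nat (\<nu> a) - of_nat (\<nu> b)) v"
      using mem by (simp add: Dop_same_Gw[OF assms(1)] wt_def cvec.scale_left_diff_distrib)
    moreover have "xcoeff (lam a - lam b) (Suc r) * (of_nat (Suc r) * (\<mu> a - \<mu> b + (of_nat (\<nu> a) - of_nat (\<nu> b)) + of_nat (Suc r)))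
       = - xcoeff (lam a - lam b) r" for r
      using xcoeff_Suc[of "lam a - lam b" r] dominant[OF ab] mu by simp
    moreover have "app (Dop n a b ^ Suc n) v = 0"
      by (rule Dop_power_Gw_zero[OF assms(1)]) (use ab wt_le[of b] in auto)
    ultimately show ?thesis
      unfolding Zfac_def using True ab by (simp only: if_True, intro Xlin_Top_pair assms) auto
  next
    case False
    \<comment> \<open>Dominance passes to \<mu> because \<nu>_a < \<nu>_b: a negative integer
      \<mu>_a - \<mu>_b would make \<lambda>_a - \<lambda>_b a still smaller one.\<close>
    have "\<mu> a - \<mu> b \<noteq> - of_nat k" if "1 \<le> k" for k :: nat
    proof
      assume "\<mu> a - \<mu> b = - of_nat k"
      then have "lam a - lam b = - of_nat (k + (\<nu> b - \<nu> a))"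
        using mu False by (simp add: of_nat_diff algebra_simps)
      then show False using dominant[OF ab, of "k + (\<nu> b - \<nu> a)"] that by simp
    qed
    then have "xcoeff (\<mu> a - \<mu> b) (Suc r) * (of_nat (Suc r) * (\<mu> a - \<mu> b + of_nat (Suc r))) = - xcoeff (\<mu> a - \<mu> b) r" for r
      using xcoeff_Suc[of "\<mu> a - \<mu> b" r] by simp
    moreover have "app (Dop n b a ^ Suc n) v = 0"
      by (rule Dop_power_Gw_zero[OF assms(1)]) (use ab wt_le[of a] in auto)
    ultimately show ?thesis
      unfolding Zfac_def using False ab by (simp only: if_False, intro Ylin_Top_pair assms) auto
  qed
qed

lemma Zfac_Eop_commute:
  assumes "c \<noteq> a" "c \<noteq> b"
  shows "Zfac n lam \<mu> \<nu> a b * Eop c k l = Eop c k l * Zfac n lam \<mu> \<nu> a b"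
  unfolding Zfac_def using assms by (auto intro!: Xlin_commute Dop_Eop_commute)

text \<open>Here \<open>ds\<close> consists of the pairs already carried out and \<open>c\<close> is
  the order they have produced; the invariant is that \<open>rs\<close> contains exactly the pairs
  still in increasing order in \<open>c\<close>. The rightmost factor acts first, hence the
  induction from the right.\<close>

lemma Zlin_Top_aux:
  assumes "normal_ordering m (rs @ ds)" "distinct c" "set c = {1..m}"
    "set rs = {(x, y) \<in> bef c. x < y}" "v \<in> Gw n (wt m \<nu>)" "i \<in> {1..n}" "j \<in> {1..n}"
  shows "app (Zlin n lam \<mu> \<nu> rs * Top n \<mu> c i j r) v
    = app (Top n \<mu> (rev [1..<Suc m]) i j r * Zlin n lam \<mu> \<nu> rs) v"
  using assms
proof (induction rs arbitrary: ds c v rule: rev_induct)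
  case Nil
  then have "c = rev [1..<Suc m]" by (intro bef_decreasing) auto
  then show ?case by (simp add: Zlin_def del: upt_Suc)
next
  case (snoc ab rs)
  obtain a b where ab: "ab = (a, b)" by fastforce
  obtain c1 c2 where c: "c = c1 @ a # b # c2"
    using normal_ordering_adjacent[of m rs a b ds c] snoc.prems ab by auto
  have a_b: "1 \<le> a" "a < b" "b \<le> m"
    using snoc.prems(1) by (auto simp: normal_ordering_def pos_pairs_def ab)
  have nab: "(a, b) \<notin> set rs" using snoc.prems(1) by (auto simp: normal_ordering_def ab)
  let ?c = "c1 @ b # a # c2"
  \<comment> \<open>Exchanging neighbours changes the relative order of this one pair only, so the
    invariant survives.\<close>
  have bef: "bef c = insert (a, b) (bef ?c - {(b, a)})" "(a, b) \<notin> bef ?c"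
    using snoc.prems(2) bef_subset[of c1] bef_subset[of c2] unfolding c by (auto simp: bef_append)
  have Z: "Zlin n lam \<mu> \<nu> (rs @ [(a, b)]) = Zlin n lam \<mu> \<nu> rs * Zfac n lam \<mu> \<nu> a b"
    by (induction rs) (auto simp: Zlin_def mult.assoc)
  have "set rs = set (rs @ [(a, b)]) - {(a, b)}" using nab by auto
  also have "\<dots> = {(x, y) \<in> bef c. x < y} - {(a, b)}" using snoc.prems(4) ab by simp
  also have "\<dots> = {(x, y) \<in> bef ?c. x < y}" unfolding bef(1) using bef(2) a_b(2) by auto
  finally have rs: "set rs = {(x, y) \<in> bef ?c. x < y}" .
  have "app (Zlin n lam \<mu> \<nu> (rs @ [ab]) * Top n \<mu> c i j r) v
     = app (Zlin n lam \<mu> \<nu> rs) (app (Zfac n lam \<mu> \<nu> a b * Top n \<mu> c i j r) v)"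
    by (simp add: ab Z)
  also have "app (Zfac n lam \<mu> \<nu> a b * Top n \<mu> c i j r) v = app (Top n \<mu> ?c i j r * Zfac n lam \<mu> \<nu> a b) v"
    unfolding c
    by (rule Top_swap_adjacent[OF _ snoc.prems(6,7,5) Zfac_Eop_commute Zfac_Top_pair[OF _ _ _ a_b]])
      (use snoc.prems(2) c in simp_all)
  also have "app (Zlin n lam \<mu> \<nu> rs) (app (Top n \<mu> ?c i j r * Zfac n lam \<mu> \<nu> a b) v)
     = app (Zlin n lam \<mu> \<nu> rs * Top n \<mu> ?c i j r) (app (Zfac n lam \<mu> \<nu> a b) v)" by simp
  also have "\<dots> = app (Top n \<mu> (rev [1..<Suc m]) i j r * Zlin n lam \<mu> \<nu> rs) (app (Zfac n lam \<mu> \<nu> a b) v)"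
  proof (rule snoc.IH)
    show "normal_ordering m (rs @ ab # ds)" using snoc.prems(1) by simp
    show "app (Zfac n lam \<mu> \<nu> a b) v \<in> Gw n (wt m \<nu>)"
      using snoc.prems(5) by (auto simp: Zfac_def intro: Xlin_Gw)
  qed (use snoc.prems c rs in auto)
  finally show ?case by (simp add: ab Z del: upt_Suc)
qed

lemma Zlin_Top:
  assumes "normal_ordering m ps" "v \<in> Gw n (wt m \<nu>)" "i \<in> {1..n}" "j \<in> {1..n}"
  shows "app (Zlin n lam \<mu> \<nu> ps) (app (Top n \<mu> [1..<Suc m] i j r) v)
    = app (Top n \<mu> (rev [1..<Suc m]) i j r) (app (Zlin n lam \<mu> \<nu> ps) v)"
proof -
  have "set ps = {(x, y) \<in> bef [1..<Suc m]. x < y}"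
    using assms(1) by (subst bef_sorted) (auto simp: normal_ordering_def pos_pairs_def simp del: upt_Suc)
  then show ?thesis
    using Zlin_Top_aux[of ps "[]" "[1..<Suc m]" v i j r] assms by (simp del: upt_Suc) force
qed

text \<open>In either case the operator applied first moves a variable into a row at least as long
  as the one it comes from. In \<xi> the longer row already contains all columns of the shorter one,
  so the result is 0.\<close>

lemma Zlin_xi:
  assumes "set ps \<subseteq> pos_pairs m"
  shows "app (Zlin n lam \<mu> \<nu> ps) (bvec (xi_set m \<nu>)) = bvec (xi_set m \<nu>)"
  using assms
proof (induction ps)
  case (Cons ab ps)
  obtain a b where ab: "ab = (a, b)" by fastforce
  then have a_b: "a \<noteq> b" "a \<in> {1..m}" "b \<in> {1..m}" using Cons.prems by (auto simp: pos_pairs_def)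
  have D: "app (Dop n x y) (bvec (xi_set m \<nu>)) = 0"
    if "x \<noteq> y" "x \<in> {1..m}" "\<nu> y \<le> \<nu> x" for x y
    unfolding Dop_def app_sum_left using that
    by (intro sum.neutral) (auto simp: eop_single xi_set_def)
  have X: "app (Xlin n R (xcoeff z) x y) (bvec (xi_set m \<nu>)) = bvec (xi_set m \<nu>)"
    if "x \<noteq> y" "x \<in> {1..m}" "\<nu> y \<le> \<nu> x" for x y R z
  proof -
    have "app (Dop n x y ^ r) (bvec (xi_set m \<nu>)) = 0" if "r > 0" for r
      using that D[OF \<open>x \<noteq> y\<close> \<open>x \<in> {1..m}\<close> \<open>\<nu> y \<le> \<nu> x\<close>]
      by (cases r) (simp_all add: power_Suc2 del: power_Suc)
    then have "app (Xlin n R (xcoeff z) x y) (bvec (xi_set m \<nu>))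
       = (\<Sum>r\<le>R. if r = 0 then bvec (xi_set m \<nu>) else 0)"
      unfolding Xlin_def app_sum_left by (intro sum.cong) (auto simp: xcoeff_def)
    then show ?thesis by simp
  qed
  show ?case using Cons a_b X by (auto simp: Zlin_def Zfac_def ab)
qed (simp add: Zlin_def)

end

section \<open>Singular vectors\<close>

lemma finpart_finite:
  assumes "\<And>A. A \<in> Poly_Mapping.keys v \<Longrightarrow> finite A"
  shows "app finpart v = v"
proof -
  have "app finpart v = app 1 v"
    by (rule app_bvec_eqI) (use assms in \<open>simp add: finpart_single\<close>)
  then show ?thesis by simp
qed

lemma keys_cre:
  assumes "B \<in> Poly_Mapping.keys (app (cre p) v)"
  shows "p \<in> B"
proof -
  obtain A where "B \<in> Poly_Mapping.keys (app (cre p) (bvec A))"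
    using clinear_keys[OF clinear_app assms] .
  then show ?thesis by (auto simp: cre_single split: if_splits)
qed

lemma keys_ann:
  assumes "B \<in> Poly_Mapping.keys (app (ann p) v)"
  obtains A where "A \<in> Poly_Mapping.keys v" "finite A" "p \<in> A" "B = A - {p}"
proof -
  obtain A where "A \<in> Poly_Mapping.keys v" "B \<in> Poly_Mapping.keys (app (ann p) (bvec A))"
    using clinear_keys[OF clinear_app assms] .
  then show ?thesis using that by (auto simp: ann_single split: if_splits)
qed

text \<open>If x_p v = 0, then v is divisible by x_p: the anticommutation relation gives v = x_p d_p
  v, and every monomial of the right side contains p.\<close>

lemma cre_eq_0:
  assumes "app (cre p) v = 0" "A \<in> Poly_Mapping.keys v"
    and "\<And>B. B \<in> Poly_Mapping.keys v \<Longrightarrow> finite B"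
  shows "p \<in> A"
proof -
  have "app finpart v = app (ann p) (app (cre p) v) + app (cre p) (app (ann p) v)"
    using arg_cong[OF ann_cre[of p p], of "\<lambda>B. app B v"] by simp
  then have "v = app (cre p) (app (ann p) v)"
    using assms(1) finpart_finite[OF assms(3)] by simp
  then show ?thesis using keys_cre[of A p "app (ann p) v"] assms(2) by metis
qed

section \<open>Matrix coefficients of the action as rational functions of u\<close>

definition geo :: "complex \<Rightarrow> complex fps" where
  "geo z = Abs_fps (\<lambda>s. if s = 0 then 0 else z ^ (s - 1))"

lemma geo_nth: "fps_nth (geo z) s = (if s = 0 then 0 else z ^ (s - 1))"
  by (simp add: geo_def)

text \<open>With t = 1/u this identifies \<open>geo z\<close> as t/(1 - z t), the expansion of 1/(u
  - z).\<close>

lemma geo_mult: "(1 - fps_const z * fps_X) * geo z = fps_X"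
proof (rule fps_ext)
  fix s show "fps_nth ((1 - fps_const z * fps_X) * geo z) s = fps_nth fps_X s"
    by (cases s; cases "s - 1") (simp_all add: left_diff_distrib mult.assoc geo_nth fps_X_nth)
qed

text \<open>A single matrix coefficient of T_ij(u), as a scalar series in 1/u. Scalar series form an
  integral domain, in which arguments with poles and cancellation are possible.\<close>

definition Gfps :: "nat \<Rightarrow> (nat \<Rightarrow> complex) \<Rightarrow> nat list \<Rightarrow> nat \<Rightarrow> nat \<Rightarrow> grass \<Rightarrow> xvar set \<Rightarrow> complex fps" where
  "Gfps n \<mu> c i j v b = Abs_fps (\<lambda>r. Poly_Mapping.lookup (app (Top n \<mu> c i j r) v) b)"

lemma Gfps_nth: "fps_nth (Gfps n \<mu> c i j v b) r = Poly_Mapping.lookup (app (Top n \<mu> c i j r) v) b"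
  by (simp add: Gfps_def)

lemma Gfps_0 [simp]: "Gfps n \<mu> c i j 0 b = 0"
  by (rule fps_ext) (simp add: Gfps_nth)

lemma Gfps_eq_0_iff: "(\<forall>b. Gfps n \<mu> c i j v b = 0) \<longleftrightarrow> (\<forall>r. app (Top n \<mu> c i j r) v = 0)"
  by (auto simp: fps_eq_iff Gfps_nth poly_mapping_eq_iff fun_eq_iff)

text \<open>Distinct rows commute, so the factor of the first row may be applied first. Recursions
  can then run over the vector that is acted on.\<close>

lemma Top_Cons_right:
  assumes "distinct (a # c)"
  shows "Top n \<mu> (a # c) i j r = (\<Sum>k\<in>{1..n}. \<Sum>s\<le>r. Top n \<mu> c k j (r - s) * Lop \<mu> a i k s)"
proof -
  have E: "Eop a i k * Top n \<mu> c k j t = Top n \<mu> c k j t * Eop a i k" for k t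
    by (rule Top_commute, rule Eop_commute) (use assms in auto)
  have "Lop \<mu> a i k s * Top n \<mu> c k j t = Top n \<mu> c k j t * Lop \<mu> a i k s" for k s t
  proof (cases "s = 0")
    case False
    then show ?thesis
      using E[of k t] by (simp add: Lop_def sc_left[of "Top n \<mu> c k j t"] mult.assoc)
  qed (simp add: Lop_def)
  then show ?thesis by simp
qed

lemma Gfps_Cons:
  assumes "distinct (a # c)" "i \<in> {1..n}"
  shows "Gfps n \<mu> (a # c) i j v b = Gfps n \<mu> c i j v b
    + geo (\<mu> a) * (\<Sum>l\<in>{1..n}. Gfps n \<mu> c l j (app (Eop a i l) v) b)"
proof (rule fps_ext)
  fix r
  let ?T = "\<lambda>l s v. Poly_Mapping.lookup (app (Top n \<mu> c l j (r - s)) v) b"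
  have *: "?T l s (app (Lop \<mu> a i l s) v) = (if s = 0 then if l = i then ?T i 0 v else 0 else 0)
      + fps_nth (geo (\<mu> a)) s * ?T l s (app (Eop a i l) v)" for l s
    by (simp add: Lop_def geo_nth app_cscale)
  have "fps_nth (Gfps n \<mu> (a # c) i j v b) r = (\<Sum>l\<in>{1..n}. \<Sum>s\<le>r. ?T l s (app (Lop \<mu> a i l s) v))"
    unfolding Gfps_nth Top_Cons_right[OF assms(1)] app_sum_left lookup_sum' app_simps(6) ..
  also have "\<dots> = (\<Sum>l\<in>{1..n}. if l = i then ?T i 0 v else 0)
      + (\<Sum>l\<in>{1..n}. \<Sum>s\<le>r. fps_nth (geo (\<mu> a)) s * ?T l s (app (Eop a i l) v))"
    unfolding * sum.distrib by simp
  also have "(\<Sum>l\<in>{1..n}. if l = i then ?T i 0 v else 0) = fps_nth (Gfps n \<mu> c i j v b) r"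
    using assms(2) by (simp add: Gfps_nth)
  also have "(\<Sum>l\<in>{1..n}. \<Sum>s\<le>r. fps_nth (geo (\<mu> a)) s * ?T l s (app (Eop a i l) v))
     = fps_nth (geo (\<mu> a) * (\<Sum>l\<in>{1..n}. Gfps n \<mu> c l j (app (Eop a i l) v) b)) r"
    unfolding sum_distrib_left fps_sum_nth fps_mult_nth Gfps_nth by (simp add: atLeast0AtMost)
  finally show "fps_nth (Gfps n \<mu> (a # c) i j v b) r = fps_nth (Gfps n \<mu> c i j v b
    + geo (\<mu> a) * (\<Sum>l\<in>{1..n}. Gfps n \<mu> c l j (app (Eop a i l) v) b)) r" by simp
qed

definition denom :: "(nat \<Rightarrow> complex) \<Rightarrow> nat list \<Rightarrow> complex fps" where
  "denom \<mu> c = (\<Prod>a\<leftarrow>c. 1 - fps_const (\<mu> a) * fps_X)"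

text \<open>Each row contributes at most a simple pole at its \<mu>, so clearing denominators leaves
  a polynomial in 1/u whose degree is at most the number of rows.\<close>

lemma denom_Gfps:
  assumes "distinct c" "i \<in> {1..n}" "r > length c"
  shows "fps_nth (denom \<mu> c * Gfps n \<mu> c i j v b) r = 0"
  using assms
proof (induction c arbitrary: i r v)
  case (Cons a c)
  let ?S = "\<Sum>l\<in>{1..n}. denom \<mu> c * Gfps n \<mu> c l j (app (Eop a i l) v) b"
  obtain r' where r: "r = Suc r'" "r' > length c" using Cons.prems by (cases r) auto
  have S: "?S = denom \<mu> c * (\<Sum>l\<in>{1..n}. Gfps n \<mu> c l j (app (Eop a i l) v) b)"
    by (simp only: sum_distrib_left)
  have "denom \<mu> (a # c) * Gfps n \<mu> (a # c) i j v b
     = (1 - fps_const (\<mu> a) * fps_X) * (denom \<mu> c * Gfps n \<mu> c i j v b)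
       + ((1 - fps_const (\<mu> a) * fps_X) * geo (\<mu> a)) * ?S"
    unfolding Gfps_Cons[OF Cons.prems(1,2)] S by (simp add: denom_def algebra_simps)
  also have "\<dots> = denom \<mu> c * Gfps n \<mu> c i j v b
       - fps_const (\<mu> a) * (fps_X * (denom \<mu> c * Gfps n \<mu> c i j v b)) + fps_X * ?S"
    unfolding geo_mult by (simp add: algebra_simps)
  also have "fps_nth \<dots> r = 0"
    using Cons.IH Cons.prems r by (simp add: fps_sum_nth)
  finally show ?case .
qed (simp add: denom_def Gfps_nth)

text \<open>For t = 0 the value is the product of the z - \<mu>_a, which is nonzero exactly if z is
  none of the \<mu>_a: this denominator clears no pole at another place.\<close>

lemma denom_geo: "fps_nth (denom \<mu> c * geo z) (Suc (length c + t)) = z ^ t * (\<Prod>a\<leftarrow>c. z - \<mu> a)"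
proof (induction c arbitrary: t)
  case (Cons a c)
  have "denom \<mu> (a # c) * geo z = denom \<mu> c * geo z - fps_const (\<mu> a) * (fps_X * (denom \<mu> c * geo z))"
    by (simp add: denom_def algebra_simps)
  then have "fps_nth (denom \<mu> (a # c) * geo z) (Suc (length (a # c) + t))
     = fps_nth (denom \<mu> c * geo z) (Suc (length c + Suc t)) - \<mu> a * fps_nth (denom \<mu> c * geo z) (Suc (length c + t))"
    by simp
  then show ?case unfolding Cons by (simp add: algebra_simps)
qed (simp add: denom_def geo_nth)

text \<open>In the last factor only the constant term survives, since all others differentiate in
  column k. Induction carries this to the first factor.\<close>

lemma Top_no_column:
  assumes "\<And>b. b \<in> set c \<Longrightarrow> app (ann (XV b k)) w = 0" "l \<in> {1..k}"
  shows "app (Top k \<mu> c l k r) w = (if r = 0 \<and> l = k then w else 0)"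
  using assms
proof (induction c arbitrary: l r)
  case (Cons a c)
  have "app (Top k \<mu> (a # c) l k r) w = (\<Sum>x\<in>{1..k}. \<Sum>s\<le>r. app (Lop \<mu> a l x s) (app (Top k \<mu> c x k (r - s)) w))"
    unfolding Top.simps app_sum_left app_simps(6) ..
  also have "\<dots> = (\<Sum>x\<in>{1..k}. \<Sum>s\<le>r. if s = r then if x = k then app (Lop \<mu> a l k r) w else 0 else 0)"
    by (intro sum.cong refl) (use Cons in auto)
  also have "\<dots> = app (Lop \<mu> a l k r) w" using Cons.prems(2) by simp
  also have "\<dots> = (if r = 0 \<and> l = k then w else 0)"
    using Cons.prems by (simp add: Lop_def eop_def)
  finally show ?case .
qed simp

text \<open>
  Write \<open>w = w0 + x w1\<close> with the variable \<open>x\<close> of the first row \<open>a\<close> in column \<open>k\<close>. Then \<open>w1\<close> is singular for the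
  remaining rows \<open>c\<close>, and the series $T_{ik}(u) w_0$ for these rows has the only pole
  $\rho = \mu_a + \nu_a - k$. As its poles are among the $\mu_b$ with \<open>b\<close> in \<open>c\<close>, it vanishes.
\<close>

lemma no_column_of_singular:
  assumes "distinct c"
    and "\<And>A. A \<in> Poly_Mapping.keys w \<Longrightarrow> finite A"
    and "\<And>A a. A \<in> Poly_Mapping.keys w \<Longrightarrow> a \<in> set c \<Longrightarrow>
           {j. XV a j \<in> A} \<subseteq> {1..k} \<and> card {j. XV a j \<in> A} = \<nu> a"
    and "\<And>a. a \<in> set c \<Longrightarrow> \<nu> a < k"
    and "sorted_wrt (\<lambda>a b. \<mu> a + of_nat (\<nu> a) - of_nat k \<noteq> \<mu> b) c"
    and "\<And>i r. i \<in> {1..<k} \<Longrightarrow> app (Top k \<mu> c i k r) w = 0"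
    and "A \<in> Poly_Mapping.keys w" "a \<in> set c"
  shows "XV a k \<notin> A"
  using assms
proof (induction c arbitrary: w A a)
  case (Cons a c w A' a')
  define p where "p = XV a k"
  define w1 where "w1 = app (ann p) w"
  define w0 where "w0 = app (ann p) (app (cre p) w)"
  have k: "k > 0" "k \<in> {1..k}" using Cons.prems(4)[of a] by auto
  have keys1: "\<exists>A\<in>Poly_Mapping.keys w. p \<in> A \<and> B = A - {p}" if "B \<in> Poly_Mapping.keys w1" for B
    using keys_ann[OF that[unfolded w1_def]] by metis
  have keys0: "B \<in> Poly_Mapping.keys w \<and> p \<notin> B" if B: "B \<in> Poly_Mapping.keys w0" for B
  proof -
    have "B \<in> Poly_Mapping.keys (app (ann p * cre p) w)" using B by (simp add: w0_def)
    then obtain A where "A \<in> Poly_Mapping.keys w" "B \<in> Poly_Mapping.keys (app (ann p * cre p) (bvec A))"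
      by (rule clinear_keys[OF clinear_app])
    then show ?thesis by (auto simp: cre_single ann_single split: if_splits)
  qed
  have fin: "app finpart w = w" by (rule finpart_finite) (rule Cons.prems(2))
  have fin1: "app finpart w1 = w1"
    by (metis app_simps(6) finpart_mult(3) w1_def)
  have w: "w = w0 + app (cre p) w1"
    using arg_cong[OF ann_cre[of p p], of "\<lambda>B. app B w"] fin by (simp add: w0_def w1_def)
  have ann_ann0: "app (ann p) (app (ann p) v) = 0" for v
    by (metis app_simps(1,6) cre_cre_self(2))
  have ann0: "app (ann p) w0 = 0" and ann1: "app (ann p) w1 = 0"
    by (simp_all add: w0_def w1_def ann_ann0)
  have ann_cre1: "app (ann p) (app (cre p) w1) = w1"
    using arg_cong[OF ann_cre[of p p], of "\<lambda>B. app B w1"] fin1 ann1 by simp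
  have cre_T: "cre (XV a i) * Top k \<mu> c l k r = Top k \<mu> c l k r * cre (XV a i)"
    and ann_T: "ann (XV a i) * Top k \<mu> c l k r = Top k \<mu> c l k r * ann (XV a i)" for i l r
    by (rule Top_commute; use Cons.prems(1) in \<open>auto simp: eop_cre ann_eop\<close>)+
  have cre_T': "app (cre (XV a i)) (app (Top k \<mu> c l k r) v) = app (Top k \<mu> c l k r) (app (cre (XV a i)) v)"
    and ann_T': "app (ann (XV a i)) (app (Top k \<mu> c l k r) v) = app (Top k \<mu> c l k r) (app (ann (XV a i)) v)" for i l r v
    using arg_cong[OF cre_T[of i l r], of "\<lambda>B. app B v"] arg_cong[OF ann_T[of i l r], of "\<lambda>B. app B v"]
    by (simp_all del: Top.simps)
  have T: "app (Top k \<mu> (a # c) i k r) v = (\<Sum>l\<in>{1..k}. \<Sum>s\<le>r. app (Lop \<mu> a i l s) (app (Top k \<mu> c l k (r - s)) v))" for i r v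
    unfolding Top.simps app_sum_left app_simps(6) ..
  have Lp: "app (Lop \<mu> a i k s) (app (Top k \<mu> c k k t) v) = 0" if "app (ann p) v = 0" "i \<in> {1..<k}" for i s t v
    using that ann_T'[of k k t v] by (simp add: Lop_def eop_def p_def)

  \<comment> \<open>Since i differs from k, d_p can be moved through the whole sum T_ik(u) w = 0.
    Then the terms with l = k vanish because d_p w1 = 0, and those with s > 0 contain lower
    coefficients, which are 0 by induction on r.\<close>
  have T1: "app (Top k \<mu> c i k r) w1 = 0" if "i \<in> {1..<k}" for i r
    using that
  proof (induction r arbitrary: i rule: less_induct)
    case (less r)
    have "ann p * Lop \<mu> a i l s = Lop \<mu> a i l s * ann p" for l s
      using less.prems by (auto simp: Lop_def ann_eop p_def sc_left[of "ann (XV a k)"] mult.assoc)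
    then have L: "app (ann p) (app (Lop \<mu> a i l s) v) = app (Lop \<mu> a i l s) (app (ann p) v)" for l s v
      by (metis app_simps(6))
    have "0 = app (ann p) (app (Top k \<mu> (a # c) i k r) w)"
      unfolding Cons.prems(6)[OF less.prems] by simp
    also have "\<dots> = (\<Sum>l\<in>{1..k}. \<Sum>s\<le>r. app (Lop \<mu> a i l s) (app (Top k \<mu> c l k (r - s)) w1))"
      unfolding T app_sum L by (simp only: ann_T'[of k, folded p_def] w1_def)
    also have "\<dots> = (\<Sum>l\<in>{1..k}. \<Sum>s\<le>r. if s = 0 then if l = i then app (Top k \<mu> c i k r) w1 else 0 else 0)"
    proof (intro sum.cong refl)
      fix l s assume ls: "l \<in> {1..k}" "s \<in> {..r}"
      show "app (Lop \<mu> a i l s) (app (Top k \<mu> c l k (r - s)) w1)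
         = (if s = 0 then if l = i then app (Top k \<mu> c i k r) w1 else 0 else 0)"
      proof (cases "l = k")
        case True
        then show ?thesis using Lp[OF ann1 less.prems] less.prems by simp
      next
        case False
        then have "l \<in> {1..<k}" using ls by auto
        then show ?thesis using less.IH[of "r - s" l] ls by (auto simp: Lop_def)
      qed
    qed
    also have "\<dots> = app (Top k \<mu> c i k r) w1" using less.prems by simp
    finally show ?case by simp
  qed
  have no1: "XV b k \<notin> B" if B: "B \<in> Poly_Mapping.keys w1" and b: "b \<in> set c" for B b
  proof (rule Cons.IH)
    fix A assume A: "A \<in> Poly_Mapping.keys w1"
    obtain A' where A': "A' \<in> Poly_Mapping.keys w" "A = A' - {p}" using keys1[OF A] by blast
    then show "finite A" using Cons.prems(2) by auto
    fix b assume b: "b \<in> set c"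
    then have "{j. XV b j \<in> A} = {j. XV b j \<in> A'}" using A' Cons.prems(1) by (auto simp: p_def)
    then show "{j. XV b j \<in> A} \<subseteq> {1..k} \<and> card {j. XV b j \<in> A} = \<nu> b"
      using Cons.prems(3)[OF A'(1), of b] b by simp
  qed (use Cons.prems T1 B b in auto)
  have "app (ann (XV b k)) w1 = 0" if "b \<in> set c" for b
  proof (rule ccontr)
    assume "app (ann (XV b k)) w1 \<noteq> 0"
    then obtain B where "B \<in> Poly_Mapping.keys (app (ann (XV b k)) w1)"
      by (metis all_not_in_conv keys_eq_empty)
    then obtain A where "A \<in> Poly_Mapping.keys w1" "XV b k \<in> A" by (rule keys_ann)
    then show False using no1 that by blast
  qed
  then have Tw1: "app (Top k \<mu> c l k r) w1 = (if r = 0 \<and> l = k then w1 else 0)" if "l \<in> {1..k}" for l r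
    using Top_no_column[of c k w1] that by blast

  \<comment> \<open>In \<open>w1\<close> row a has \<nu>_a - 1 variables, all in the first k - 1
    columns, so \<open>z\<close> counts the columns below k that are free. It is the eigenvalue in
    \<open>E1\<close>.\<close>
  define z :: complex where "z = of_nat k - of_nat (\<nu> a)"
  \<comment> \<open>By \<open>Tw1\<close> the other rows act trivially on \<open>w1\<close>, so only
    row a acts, moving its variable from column k to column i.\<close>
  have Tc1: "app (Top k \<mu> (a # c) i k r) (app (cre p) w1) = cscale (fps_nth (geo (\<mu> a)) r) (app (cre (XV a i)) w1)"
    if "i \<in> {1..<k}" for i r
  proof -
    have "app (Top k \<mu> (a # c) i k r) (app (cre p) w1)
       = (\<Sum>l\<in>{1..k}. \<Sum>s\<le>r. app (Lop \<mu> a i l s) (app (cre p) (app (Top k \<mu> c l k (r - s)) w1)))"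
      unfolding T by (simp only: cre_T' p_def)
    also have "\<dots> = (\<Sum>l\<in>{1..k}. \<Sum>s\<le>r. if s = r then if l = k then app (Lop \<mu> a i k r) (app (cre p) w1) else 0 else 0)"
      by (intro sum.cong refl) (auto simp: Tw1)
    also have "\<dots> = app (Lop \<mu> a i k r) (app (cre p) w1)" using k by simp
    also have "\<dots> = cscale (fps_nth (geo (\<mu> a)) r) (app (cre (XV a i)) w1)"
      using that ann_cre1 by (simp add: Lop_def geo_nth eop_def p_def)
    finally show ?thesis .
  qed
  have T0: "app (Top k \<mu> (a # c) i k r) w0 = - cscale (fps_nth (geo (\<mu> a)) r) (app (cre (XV a i)) w1)"
    if "i \<in> {1..<k}" for i r
  proof -
    have "app (Top k \<mu> (a # c) i k r) w0 + app (Top k \<mu> (a # c) i k r) (app (cre p) w1) = 0"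
      using Cons.prems(6)[OF that, of r] w by (metis app_add)
    then show ?thesis unfolding Tc1[OF that] by (simp add: add_eq_0_iff)
  qed
  have card1: "{j. XV a j \<in> B} \<subseteq> {1..<k}" "Suc (card {j. XV a j \<in> B}) = \<nu> a" "finite B"
    if B: "B \<in> Poly_Mapping.keys w1" for B
  proof -
    obtain A where A: "A \<in> Poly_Mapping.keys w" "p \<in> A" "B = A - {p}" using keys1[OF B] by blast
    have sub: "{j. XV a j \<in> A} \<subseteq> {1..k}" "card {j. XV a j \<in> A} = \<nu> a"
      using Cons.prems(3)[OF A(1), of a] by auto
    have *: "{j. XV a j \<in> B} = {j. XV a j \<in> A} - {k}" using A by (auto simp: p_def)
    show "{j. XV a j \<in> B} \<subseteq> {1..<k}" using * sub by force
    have "finite {j. XV a j \<in> A}" using sub(1) by (rule finite_subset) simp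
    then show "Suc (card {j. XV a j \<in> B}) = \<nu> a"
      unfolding * using sub(2) A(2) by (subst card_Suc_Diff1) (auto simp: p_def)
    show "finite B" using A Cons.prems(2) by auto
  qed
  have E1: "(\<Sum>l\<in>{1..<k}. app (Eop a i l) (app (cre (XV a l)) w1)) = cscale z (app (cre (XV a i)) w1)" for i
  proof -
    have "(\<Sum>l\<in>{1..<k}. app (ann (XV a l) * cre (XV a l)) w1) = cscale z w1"
    proof -
      have "app (\<Sum>l\<in>{1..<k}. ann (XV a l) * cre (XV a l)) w1 = app (sc z) w1"
      proof (rule app_bvec_eqI)
        fix B assume B: "B \<in> Poly_Mapping.keys w1"
        have "app (ann (XV a l) * cre (XV a l)) (bvec B) = (if l \<notin> {j. XV a j \<in> B} then bvec B else 0)" for l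
          using card1(3)[OF B] by (simp add: cre_single ann_single psign_insert)
        then have "app (\<Sum>l\<in>{1..<k}. ann (XV a l) * cre (XV a l)) (bvec B) = (\<Sum>l\<in>{1..<k}. if l \<notin> {j. XV a j \<in> B} then bvec B else 0)"
          by (simp only: app_sum_left)
        also have "\<dots> = (\<Sum>l\<in>{1..<k} - {j. XV a j \<in> B}. bvec B)"
          unfolding set_diff_eq by (subst sum.inter_filter) auto
        also have "\<dots> = cscale (of_nat (card ({1..<k} - {j. XV a j \<in> B}))) (bvec B)"
          by (rule sum_const_cscale)
        also have "card ({1..<k} - {j. XV a j \<in> B}) = k - \<nu> a"
          using card1(1,2)[OF B] by (subst card_Diff_subset) (auto intro: finite_subset)
        also have "of_nat (k - \<nu> a) = z" using Cons.prems(4)[of a] by (simp add: z_def of_nat_diff)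
        finally show "app (\<Sum>l\<in>{1..<k}. ann (XV a l) * cre (XV a l)) (bvec B) = app (sc z) (bvec B)" by simp
      qed
      then show ?thesis by (simp add: app_sum_left)
    qed
    then have "app (cre (XV a i)) (\<Sum>l\<in>{1..<k}. app (ann (XV a l) * cre (XV a l)) w1) = cscale z (app (cre (XV a i)) w1)"
      by (simp add: app_cscale)
    then show ?thesis by (simp add: app_sum eop_def)
  qed
  \<comment> \<open>Inserting T_ik(u) w0 = -\<gamma>(u) x_ai w1 for the rows \<open>c\<close> into
    \<open>T0\<close> gives \<gamma>(u) (1 + z/(u - \<mu>_a)) = 1/(u - \<mu>_a), that is \<gamma>(u)
    = 1/(u - \<mu>_a + z).\<close>
  define rho where "rho = \<mu> a - z"
  have g: "app (Top k \<mu> c i k r) w0 = - cscale (fps_nth (geo rho) r) (app (cre (XV a i)) w1)" if "i \<in> {1..<k}" for i r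
    using that
  proof (induction r arbitrary: i rule: less_induct)
    case (less r)
    show ?case
    proof (cases r)
      case 0
      then show ?thesis using less.prems by (simp add: Top_0 geo_nth del: Top.simps)
    next
      case (Suc r')
      let ?x = "app (cre (XV a i)) w1"
      let ?g = "app (Top k \<mu> c i k r) w0"
      have Eg: "(\<Sum>l\<in>{1..<k}. app (Eop a i l) (app (Top k \<mu> c l k (r - Suc s)) w0)) = - cscale (fps_nth (geo rho) (r - Suc s) * z) ?x" for s
      proof -
        have "(\<Sum>l\<in>{1..<k}. app (Eop a i l) (app (Top k \<mu> c l k (r - Suc s)) w0))
           = (\<Sum>l\<in>{1..<k}. cscale (- fps_nth (geo rho) (r - Suc s)) (app (Eop a i l) (app (cre (XV a l)) w1)))"
          by (intro sum.cong refl, subst less.IH) (use Suc in \<open>auto simp: app_minus app_cscale cscale_minus\<close>)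
        also have "\<dots> = cscale (- fps_nth (geo rho) (r - Suc s)) (cscale z ?x)"
          unfolding cvec.scale_sum_right[symmetric] E1 ..
        finally show ?thesis by (simp add: cscale_minus)
      qed
      have "app (Top k \<mu> (a # c) i k r) w0 = (\<Sum>l\<in>{1..<k}. \<Sum>s\<le>r. app (Lop \<mu> a i l s) (app (Top k \<mu> c l k (r - s)) w0))"
        unfolding T using k Lp[OF ann0 less.prems]
        by (simp add: atLeastLessThanSuc_atLeastAtMost[symmetric] sum.atLeastLessThan_Suc[of 1 k] del: Top.simps)
      also have "\<dots> = (\<Sum>s\<le>r. \<Sum>l\<in>{1..<k}. app (Lop \<mu> a i l s) (app (Top k \<mu> c l k (r - s)) w0))"
        by (rule sum.swap)
      also have "\<dots> = (\<Sum>l\<in>{1..<k}. app (Lop \<mu> a i l 0) (app (Top k \<mu> c l k r) w0))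
         + (\<Sum>s\<le>r'. \<Sum>l\<in>{1..<k}. app (Lop \<mu> a i l (Suc s)) (app (Top k \<mu> c l k (r - Suc s)) w0))"
        unfolding Suc sum.atMost_Suc_shift by simp
      also have "(\<Sum>l\<in>{1..<k}. app (Lop \<mu> a i l 0) (app (Top k \<mu> c l k r) w0)) = (\<Sum>l\<in>{1..<k}. if l = i then ?g else 0)"
        by (intro sum.cong) (auto simp: Lop_def)
      also have "\<dots> = ?g" using less.prems by simp
      also have "(\<Sum>s\<le>r'. \<Sum>l\<in>{1..<k}. app (Lop \<mu> a i l (Suc s)) (app (Top k \<mu> c l k (r - Suc s)) w0))
        = (\<Sum>s\<le>r'. cscale (\<mu> a ^ s) (\<Sum>l\<in>{1..<k}. app (Eop a i l) (app (Top k \<mu> c l k (r - Suc s)) w0)))"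
        by (simp add: Lop_def cvec.scale_sum_right del: Top.simps)
      also have "\<dots> = - cscale (\<Sum>s\<le>r'. \<mu> a ^ s * (fps_nth (geo rho) (r - Suc s) * z)) ?x"
        unfolding Eg by (simp add: cvec.scale_sum_left sum_negf)
      also have "(\<Sum>s\<le>r'. \<mu> a ^ s * (fps_nth (geo rho) (r - Suc s) * z)) = z * (\<Sum>s<r'. \<mu> a ^ s * rho ^ (r' - Suc s))"
        unfolding lessThan_Suc_atMost[symmetric] sum.lessThan_Suc Suc
        by (simp add: geo_nth sum_distrib_left mult_ac)
      also have "\<dots> = \<mu> a ^ r' - rho ^ r'"
      proof -
        have "z = \<mu> a - rho" by (simp add: rho_def)
        moreover have "(\<Sum>s<r'. \<mu> a ^ s * rho ^ (r' - Suc s)) = (\<Sum>s<r'. rho ^ (r' - Suc s) * \<mu> a ^ s)"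
          by (simp add: mult.commute)
        ultimately show ?thesis by (simp only: power_diff_sumr2)
      qed
      finally have "?g = cscale (\<mu> a ^ r' - rho ^ r') ?x - cscale (\<mu> a ^ r') ?x"
        unfolding T0[OF less.prems] using Suc by (simp add: geo_nth algebra_simps eq_neg_iff_add_eq_0 del: Top.simps)
      then show ?thesis using Suc by (simp add: geo_nth cvec.scale_left_diff_distrib del: Top.simps)
    qed
  qed
  \<comment> \<open>Clearing the denominators of the rows \<open>c\<close> leaves no coefficient
    beyond \<open>length c\<close>, whereas the pole at \<open>rho\<close> would leave the product
    of the rho - \<mu>_b there. This product is nonzero by the \<open>sorted_wrt\<close>
    hypothesis.\<close>
  have x0: "app (cre (XV a i)) w1 = 0" if i: "i \<in> {1..<k}" for i
  proof (rule poly_mapping_eqI)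
    fix b
    let ?x = "Poly_Mapping.lookup (app (cre (XV a i)) w1) b"
    have "Gfps k \<mu> c i k w0 b = - (fps_const ?x * geo rho)"
      by (rule fps_ext) (simp add: Gfps_nth g[OF i] del: Top.simps)
    then have "fps_nth (- (fps_const ?x * (denom \<mu> c * geo rho))) (Suc (length c + 0)) = 0"
      using denom_Gfps[of c i k "Suc (length c)" \<mu> k w0 b] Cons.prems(1) i by (simp add: mult.left_commute)
    then have "?x * (\<Prod>b\<leftarrow>c. rho - \<mu> b) = 0"
      using denom_geo[of \<mu> c rho 0] by simp
    moreover have "(\<Prod>b\<leftarrow>c. rho - \<mu> b) \<noteq> 0"
      using Cons.prems(5) by (auto simp: prod_list_zero_iff rho_def z_def algebra_simps)
    ultimately show "?x = Poly_Mapping.lookup 0 b" by simp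
  qed
  \<comment> \<open>By \<open>x0\<close> every monomial of \<open>w1\<close> would contain x_ai for
    all i < k, hence have degree at least k - 1 in row a; but this degree is \<nu>_a - 1 and \<nu>_a
    < k.\<close>
  have "w1 = 0"
  proof (rule ccontr)
    assume "w1 \<noteq> 0"
    then obtain B where B: "B \<in> Poly_Mapping.keys w1" by (metis all_not_in_conv keys_eq_empty)
    have "{1..<k} \<subseteq> {j. XV a j \<in> B}"
      using cre_eq_0[OF x0 B card1(3)] by auto
    then have "card {1..<k} \<le> card {j. XV a j \<in> B}"
      using card1(1)[OF B] by (metis card_mono finite_atLeastLessThan finite_subset)
    then show False using card1(2)[OF B] Cons.prems(4)[of a] by simp
  qed
  then have w: "w = w0" and g0: "app (Top k \<mu> c i k r) w = 0" if "i \<in> {1..<k}" for i r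
    using w g that by simp_all
  then have w: "w = w0" using \<open>w = w0 + app (cre p) w1\<close> \<open>w1 = 0\<close> by simp
  show ?case
  proof (cases "a' = a")
    case True
    then show ?thesis using keys0 Cons.prems(7) w by (auto simp: p_def)
  next
    case False
    then have "a' \<in> set c" using Cons.prems(8) by simp
    then show ?thesis using Cons.IH[of w A' a'] Cons.prems g0 by auto
  qed
qed simp

section \<open>Descent through the columns to \<xi>\<close>

lemma nonzero_obtain_key:
  assumes "v \<noteq> 0"
  obtains A where "A \<in> Poly_Mapping.keys v"
  using assms keys_eq_empty[of v] by blast

lemma card_row: "card {p \<in> A. xrow p = a} = card {j. XV a j \<in> A}"
proof (rule sym, rule bij_betw_same_card)
  show "bij_betw (XV a) {j. XV a j \<in> A} {p \<in> A. xrow p = a}"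
    by (auto simp: bij_betw_def inj_on_def image_iff) (metis xvar.collapse)
qed

text \<open>The bound is an integer, so that it can drop below 0, where only the zero vector
  remains.\<close>

definition colbound :: "nat \<Rightarrow> int \<Rightarrow> grass set" where
  "colbound k q = {v. \<forall>A\<in>Poly_Mapping.keys v. int (card {p \<in> A. xcol p = k}) \<le> q}"

lemma zero_colbound [simp]: "0 \<in> colbound k q"
  by (simp add: colbound_def)

lemma colbound_add: "v \<in> colbound k q \<Longrightarrow> w \<in> colbound k q \<Longrightarrow> v + w \<in> colbound k q"
  using keys_add[of v w] unfolding colbound_def by blast

lemma colbound_Eop:
  assumes "v \<in> colbound k q"
  shows "app (Eop a i l) v \<in> colbound k (q + (if i = k then 1 else 0) - (if l = k then 1 else 0))"
  unfolding colbound_def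
proof (intro CollectI ballI)
  fix B assume "B \<in> Poly_Mapping.keys (app (Eop a i l) v)"
  then obtain A where A: "A \<in> Poly_Mapping.keys v" "finite A" "XV a l \<in> A" "XV a i \<notin> A - {XV a l}"
    "B = insert (XV a i) (A - {XV a l})" by (rule keys_eop)
  then show "int (card {p \<in> B. xcol p = k}) \<le> q + (if i = k then 1 else 0) - (if l = k then 1 else 0)"
    using assms card_exchange[of A "XV a l" "XV a i" xcol k] by (auto simp: colbound_def)
qed

context dominant_weights
begin

text \<open>Together with the row degrees this says that the columns beyond k are those of \<xi>.
  The formulation by rows shows directly that a row with k \<le> \<nu>_a contains all of the first k
  columns.\<close>

definition std_rows :: "nat \<Rightarrow> xvar set \<Rightarrow> bool" where
  "std_rows k A \<longleftrightarrow> (\<forall>a\<in>{1..m}.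
     if k \<le> \<nu> a then {j. XV a j \<in> A} = {1..\<nu> a} else {j. XV a j \<in> A} \<subseteq> {1..k})"

definition Uk :: "nat \<Rightarrow> grass set" where
  "Uk k = {v \<in> Gw n (wt m \<nu>). \<forall>A\<in>Poly_Mapping.keys v. std_rows k A}"

lemma std_rowsD:
  assumes "std_rows k A" "a \<in> {1..m}"
  shows "k \<le> \<nu> a \<Longrightarrow> {j. XV a j \<in> A} = {1..\<nu> a}" "\<not> k \<le> \<nu> a \<Longrightarrow> {j. XV a j \<in> A} \<subseteq> {1..k}"
  using bspec[OF assms(1)[unfolded std_rows_def] assms(2)] by (simp_all only: if_True if_False)

lemma UkD: "v \<in> Uk k \<Longrightarrow> A \<in> Poly_Mapping.keys v \<Longrightarrow> std_rows k A" "v \<in> Uk k \<Longrightarrow> v \<in> Gw n (wt m \<nu>)"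
  by (simp_all add: Uk_def)

lemma zero_Uk [simp]: "0 \<in> Uk k"
  by (simp add: Uk_def)

lemma Uk_add: "v \<in> Uk k \<Longrightarrow> w \<in> Uk k \<Longrightarrow> v + w \<in> Uk k"
  using keys_add[of v w] unfolding Uk_def by (auto simp: add_Gw)

lemma Uk_cscale: "v \<in> Uk k \<Longrightarrow> cscale c v \<in> Uk k"
  using keys_cscale_subset[of c v] unfolding Uk_def by (auto simp: cscale_Gw)

lemma colbound_cscale: "v \<in> colbound k q \<Longrightarrow> cscale c v \<in> colbound k q"
  using keys_cscale_subset[of c v] unfolding colbound_def by blast

lemma Gw_row:
  assumes "v \<in> Gw n (wt m \<nu>)" "A \<in> Poly_Mapping.keys v" "XV a l \<in> A"
  shows "a \<in> {1..m}"
proof (rule ccontr)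
  assume "a \<notin> {1..m}"
  then have "int (card {p \<in> A. xrow p = a}) = 0" "finite A"
    using assms by (auto simp: Gw_def wt_def)
  then have "{p \<in> A. xrow p = a} = {}" by simp
  then show False using assms(3) by (metis (mono_tags, lifting) empty_iff mem_Collect_eq xvar.sel(1))
qed

lemma Uk_row:
  assumes "v \<in> Uk k" "A \<in> Poly_Mapping.keys v" "XV a l \<in> A"
  shows "a \<in> {1..m}" "k \<le> \<nu> a \<Longrightarrow> {j. XV a j \<in> A} = {1..\<nu> a}" "\<not> k \<le> \<nu> a \<Longrightarrow> {j. XV a j \<in> A} \<subseteq> {1..k}"
proof -
  show a: "a \<in> {1..m}" by (rule Gw_row[OF UkD(2)[OF assms(1)] assms(2,3)])
  show "k \<le> \<nu> a \<Longrightarrow> {j. XV a j \<in> A} = {1..\<nu> a}" "\<not> k \<le> \<nu> a \<Longrightarrow> {j. XV a j \<in> A} \<subseteq> {1..k}"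
    by (fact std_rowsD[OF UkD(1)[OF assms(1,2)] a])+
qed

lemma Uk_Eop:
  assumes "v \<in> Uk k" "i \<in> {1..k}" "l \<in> {1..k}" "k \<le> n"
  shows "app (Eop a i l) v \<in> Uk k"
  unfolding Uk_def std_rows_def
proof (intro CollectI conjI ballI)
  show "app (Eop a i l) v \<in> Gw n (wt m \<nu>)"
    using assms by (auto simp: Uk_def intro!: Eop_Gw)
  fix B b assume B: "B \<in> Poly_Mapping.keys (app (Eop a i l) v)" and b: "b \<in> {1..m}"
  from B obtain A where A: "A \<in> Poly_Mapping.keys v" "finite A" "XV a l \<in> A" "XV a i \<notin> A - {XV a l}"
    "B = insert (XV a i) (A - {XV a l})" by (rule keys_eop)
  have bA: "if k \<le> \<nu> b then {j. XV b j \<in> A} = {1..\<nu> b} else {j. XV b j \<in> A} \<subseteq> {1..k}"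
    using assms(1) A(1) b unfolding Uk_def std_rows_def by blast
  show "if k \<le> \<nu> b then {j. XV b j \<in> B} = {1..\<nu> b} else {j. XV b j \<in> B} \<subseteq> {1..k}"
  proof (cases "b = a \<and> k \<le> \<nu> a")
    case True
    then have "XV a i \<in> A" using bA assms(2) by auto
    then have "i = l" using A(4) by auto
    then have "B = A" using A by auto
    show ?thesis unfolding \<open>B = A\<close> by (rule bA)
  next
    case False
    show ?thesis
    proof (cases "b = a")
      case True
      then show ?thesis using False bA assms(2) A(5) by (auto split: if_splits)
    next
      case False
      then have "{j. XV b j \<in> B} = {j. XV b j \<in> A}" using A(5) by auto
      then show ?thesis using bA by (simp only:)
    qed
  qed
qed

text \<open>A row with k \<le> \<nu>_a already contains x_ai, and a shorter row does not contain
  x_al.\<close>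

lemma Uk_Eop_zero:
  assumes "v \<in> Uk k" "i \<in> {1..k}" "l > k"
  shows "app (Eop a i l) v = 0"
proof (rule ccontr)
  assume "app (Eop a i l) v \<noteq> 0"
  then obtain B where "B \<in> Poly_Mapping.keys (app (Eop a i l) v)" by (rule nonzero_obtain_key)
  then obtain A where A: "A \<in> Poly_Mapping.keys v" "finite A" "XV a l \<in> A" "XV a i \<notin> A - {XV a l}"
    by (rule keys_eop)
  show False
  proof (cases "k \<le> \<nu> a")
    case True
    then have "XV a i \<in> A" using Uk_row(2)[OF assms(1) A(1,3)] assms(2) by auto
    then show False using A(4) assms by auto
  next
    case False
    then show False using Uk_row(3)[OF assms(1) A(1,3)] A(3) assms(3) by auto
  qed
qed

lemma Uk_Eop_full:
  assumes "v \<in> Uk k" "i \<in> {1..k}" "l \<in> {1..k}" "k \<le> \<nu> a" "a \<in> {1..m}"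
  shows "app (Eop a i l) v = (if i = l then v else 0)"
proof -
  have "app (Eop a i l) v = app (if i = l then 1 else 0) v"
  proof (rule app_bvec_eqI)
    fix A assume A: "A \<in> Poly_Mapping.keys v"
    have fin: "finite A" by (rule Gw_finite[OF UkD(2)[OF assms(1)] A])
    have "{j. XV a j \<in> A} = {1..\<nu> a}"
      by (rule std_rowsD(1)[OF UkD(1)[OF assms(1) A] assms(5,4)])
    then have mem: "XV a x \<in> A" if "x \<in> {1..k}" for x
      using that assms(4) by auto
    show "app (Eop a i l) (bvec A) = app (if i = l then 1 else 0) (bvec A)"
    proof (cases "i = l")
      case True
      have "insert (XV a i) (A - {XV a i}) = A" using mem[OF assms(2)] by blast
      then show ?thesis using True fin mem[OF assms(2)] by (simp add: eop_single psign_remove)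
    next
      case False
      then show ?thesis using mem[OF assms(2)] by (simp add: eop_single)
    qed
  qed
  then show ?thesis by simp
qed

text \<open>Along a path of indices from i to j all intermediate indices stay at most k by
  \<open>Uk_Eop_zero\<close>, and their contributions to the degree in column k telescope, leaving
  those of i and j.\<close>

lemma Top_Uk_colbound:
  assumes "distinct c" "v \<in> Uk k" "v \<in> colbound k q" "k \<le> n" "i \<in> {1..k}" "j \<in> {1..k}"
  shows "app (Top n \<mu> c i j r) v \<in> Uk k \<inter> colbound k (q + (if i = k then 1 else 0) - (if j = k then 1 else 0))"
  using assms
proof (induction c arbitrary: v q i r)
  case Nil
  show ?case
  proof (cases "r = 0 \<and> i = j")
    case True
    then show ?thesis using Nil.prems(2,3) by simp
  next
    case False
    then have "Top n \<mu> [] i j r = 0" by simp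
    then show ?thesis by (simp only: app_simps(1) IntI zero_Uk zero_colbound)
  qed
next
  case (Cons a c)
  let ?S = "Uk k \<inter> colbound k (q + (if i = k then 1 else 0) - (if j = k then 1 else 0))"
  have sum_S: "sum g X \<in> ?S" if "\<And>x. x \<in> X \<Longrightarrow> g x \<in> ?S" for g :: "nat \<Rightarrow> grass" and X
    using that
  proof (induction X rule: infinite_finite_induct)
    case (insert x F)
    then show ?case by (simp add: Uk_add colbound_add)
  qed (simp_all only: sum.infinite sum.empty not_False_eq_True IntI zero_Uk zero_colbound)
  have "app (Top n \<mu> c l j t) (app (Lop \<mu> a i l s) v) \<in> ?S" if "l \<in> {1..n}" for l s t
  proof (cases "l \<le> k")
    case True
    then have lk: "l \<in> {1..k}" using that by simp
    let ?q = "q + (if i = k then 1 else 0) - (if l = k then 1 else 0)"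
    have "app (Lop \<mu> a i l s) v \<in> Uk k \<and> app (Lop \<mu> a i l s) v \<in> colbound k ?q"
    proof (cases "s = 0")
      case True
      show ?thesis
      proof (cases "i = l")
        case True
        then show ?thesis using Cons.prems(2,3) \<open>s = 0\<close> by (simp add: Lop_def)
      next
        case False
        then show ?thesis using \<open>s = 0\<close> by (simp add: Lop_def)
      qed
    next
      case False
      then show ?thesis
        using Uk_Eop[OF Cons.prems(2,5) lk Cons.prems(4), of a] colbound_Eop[OF Cons.prems(3), of a i l]
        by (simp add: Lop_def Uk_cscale colbound_cscale)
    qed
    then have "app (Top n \<mu> c l j t) (app (Lop \<mu> a i l s) v)
      \<in> Uk k \<inter> colbound k (?q + (if l = k then 1 else 0) - (if j = k then 1 else 0))"
      by (intro Cons.IH) (use Cons.prems lk in auto)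
    then show ?thesis by simp
  next
    case False
    then have "app (Lop \<mu> a i l s) v = 0"
      using Uk_Eop_zero[OF Cons.prems(2,5), of l a] Cons.prems(5) by (simp add: Lop_def)
    then show ?thesis by simp
  qed
  then show ?case
    unfolding Top_Cons_right[OF Cons.prems(1)] app_sum_left app_simps(6)
    by (intro sum_S)
qed

text \<open>
  On \<^const>\<open>Uk\<close> a row with at least \<open>k\<close> variables contributes only a scalar series to the
  \<open>k \<times> k\<close> block of the action, and the columns beyond \<open>k\<close> do not contribute.
\<close>

lemma Gfps_strip:
  assumes "distinct c" "set c \<subseteq> {1..m}" "k \<le> n"
  shows "\<exists>\<phi>. \<phi> \<noteq> 0 \<and> (\<forall>v\<in>Uk k. \<forall>i\<in>{1..k}. \<forall>j\<in>{1..k}. \<forall>b.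
    Gfps n \<mu> c i j v b = \<phi> * Gfps k \<mu> (filter (\<lambda>a. \<nu> a < k) c) i j v b)"
  using assms(1,2)
proof (induction c)
  case Nil
  then show ?case by (intro exI[of _ 1]) (auto simp: fps_eq_iff Gfps_nth)
next
  case (Cons a c)
  let ?c = "filter (\<lambda>a. \<nu> a < k) c"
  obtain \<phi> where \<phi>: "\<phi> \<noteq> 0"
    and G: "\<And>v i j b. v \<in> Uk k \<Longrightarrow> i \<in> {1..k} \<Longrightarrow> j \<in> {1..k} \<Longrightarrow>
       Gfps n \<mu> c i j v b = \<phi> * Gfps k \<mu> ?c i j v b"
    using Cons by auto
  have sum: "(\<Sum>l\<in>{1..n}. Gfps n \<mu> c l j (app (Eop a i l) v) b) = (\<Sum>l\<in>{1..k}. Gfps n \<mu> c l j (app (Eop a i l) v) b)"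
    if "v \<in> Uk k" "i \<in> {1..k}" for v i j b
    by (rule sum.mono_neutral_right) (use that assms(3) Uk_Eop_zero in auto)
  show ?case
  proof (cases "\<nu> a < k")
    case True
    have "Gfps n \<mu> (a # c) i j v b = \<phi> * Gfps k \<mu> (a # ?c) i j v b"
      if vij: "v \<in> Uk k" "i \<in> {1..k}" "j \<in> {1..k}" for v i j b
    proof -
      have inn: "i \<in> {1..n}" using vij assms(3) by auto
      have "(\<Sum>l\<in>{1..k}. Gfps n \<mu> c l j (app (Eop a i l) v) b)
         = (\<Sum>l\<in>{1..k}. \<phi> * Gfps k \<mu> ?c l j (app (Eop a i l) v) b)"
        by (intro sum.cong refl G Uk_Eop vij assms)
      then have "Gfps n \<mu> (a # c) i j v b = \<phi> * Gfps k \<mu> ?c i j v b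
        + geo (\<mu> a) * (\<Sum>l\<in>{1..k}. \<phi> * Gfps k \<mu> ?c l j (app (Eop a i l) v) b)"
        unfolding Gfps_Cons[OF Cons.prems(1) inn] sum[OF vij(1,2)] G[OF vij] by simp
      also have "\<dots> = \<phi> * Gfps k \<mu> (a # ?c) i j v b"
        using vij Cons.prems(1) by (subst Gfps_Cons) (simp_all add: algebra_simps sum_distrib_left)
      finally show ?thesis .
    qed
    then show ?thesis using \<phi> True by auto
  next
    case False
    \<comment> \<open>On a row containing the first k columns the block of matrix units acts as the
      identity matrix, which gives the scalar factor 1 + 1/(u - \<mu>_a). Its constant term 1 keeps
      \<phi> nonzero.\<close>
    have "Gfps n \<mu> (a # c) i j v b = (1 + geo (\<mu> a)) * \<phi> * Gfps k \<mu> ?c i j v b"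
      if vij: "v \<in> Uk k" "i \<in> {1..k}" "j \<in> {1..k}" for v i j b
    proof -
      have "(\<Sum>l\<in>{1..k}. Gfps n \<mu> c l j (app (Eop a i l) v) b) = (\<Sum>l\<in>{1..k}. if l = i then Gfps n \<mu> c i j v b else 0)"
        by (intro sum.cong refl) (use vij False Cons.prems(2) in \<open>auto simp: Uk_Eop_full\<close>)
      also have "\<dots> = Gfps n \<mu> c i j v b" using vij by simp
      finally have S: "(\<Sum>l\<in>{1..k}. Gfps n \<mu> c l j (app (Eop a i l) v) b) = Gfps n \<mu> c i j v b" .
      have inn: "i \<in> {1..n}" using vij assms(3) by auto
      have "Gfps n \<mu> (a # c) i j v b = Gfps n \<mu> c i j v b + geo (\<mu> a) * Gfps n \<mu> c i j v b"
        unfolding Gfps_Cons[OF Cons.prems(1) inn] sum[OF vij(1,2)] S ..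
      then show ?thesis using G[OF vij] by (simp add: algebra_simps)
    qed
    moreover have "1 + geo (\<mu> a) \<noteq> 0"
      by (metis fps_add_nth fps_one_nth fps_zero_nth geo_nth add.right_neutral zero_neq_one)
    ultimately show ?thesis using \<phi> False by (intro exI[of _ "(1 + geo (\<mu> a)) * \<phi>"]) auto
  qed
qed

text \<open>An equality would mean \<lambda>_a - k = \<lambda>_b - \<nu>_b, hence \<lambda>_b -
  \<lambda>_a = -(k - \<nu>_b), a negative integer for b < a. This is where the decreasing order of
  the rows meets dominance.\<close>

lemma dominant_sorted:
  "sorted_wrt (\<lambda>a b. \<mu> a + of_nat (\<nu> a) - of_nat k \<noteq> \<mu> b) (filter (\<lambda>a. \<nu> a < k) (rev [1..<Suc m]))"
proof (rule sorted_wrt_mono_rel)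
  show "sorted_wrt (>) (filter (\<lambda>a. \<nu> a < k) (rev [1..<Suc m]))"
    by (intro sorted_wrt_filter) (simp add: sorted_wrt_rev strict_sorted_iff del: upt_Suc)
  fix a b assume a: "a \<in> set (filter (\<lambda>a. \<nu> a < k) (rev [1..<Suc m]))"
    and b: "b \<in> set (filter (\<lambda>a. \<nu> a < k) (rev [1..<Suc m]))" and "a > b"
  then have mem: "a \<in> {1..m}" "b \<in> {1..m}" "\<nu> b < k" by (auto simp del: upt_Suc)
  show "\<mu> a + of_nat (\<nu> a) - of_nat k \<noteq> \<mu> b"
  proof
    assume eq: "\<mu> a + of_nat (\<nu> a) - of_nat k = \<mu> b"
    have "lam b - lam a = \<mu> b + of_nat (\<nu> b) - (\<mu> a + of_nat (\<nu> a))"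
      using nu[OF mem(1)] nu[OF mem(2)] by (simp add: algebra_simps)
    also have "\<dots> = - of_nat (k - \<nu> b)" using mem(3) by (simp add: eq[symmetric] of_nat_diff)
    finally have "lam b - lam a = - of_nat (k - \<nu> b)" .
    moreover have "1 \<le> b" "a \<le> m" "1 \<le> k - \<nu> b" using mem by auto
    ultimately show False using dominant[OF _ \<open>a > b\<close>] by blast
  qed
qed

lemma submodule_descend:
  assumes W: "cvec.subspace W" "W \<subseteq> Gw n (wt m \<nu>)"
    and stable: "\<And>i j r w. i \<in> {1..n} \<Longrightarrow> j \<in> {1..n} \<Longrightarrow> w \<in> W \<Longrightarrow> app (Top n \<mu> (rev [1..<Suc m]) i j r) w \<in> W"
    and k: "1 \<le> k" "k \<le> n" and ex: "\<exists>w\<in>W \<inter> Uk k. w \<noteq> 0"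
  shows "\<exists>w\<in>W \<inter> Uk (k - 1). w \<noteq> 0"
proof -
  let ?c = "rev [1..<Suc m]"
  define P where "P q \<longleftrightarrow> (\<exists>w\<in>W \<inter> Uk k \<inter> colbound k (int q). w \<noteq> 0)" for q :: nat
  obtain w0 where w0: "w0 \<in> W \<inter> Uk k" "w0 \<noteq> 0" using ex by blast
  have "card {p \<in> A. xcol p = k} \<le> (\<Sum>A\<in>Poly_Mapping.keys w0. card {p \<in> A. xcol p = k})"
    if "A \<in> Poly_Mapping.keys w0" for A
    using that by (intro member_le_sum) auto
  then have "w0 \<in> colbound k (int (\<Sum>A\<in>Poly_Mapping.keys w0. card {p \<in> A. xcol p = k}))"
    unfolding colbound_def by (simp del: of_nat_sum)
  then have "\<exists>q. P q" unfolding P_def using w0 by blast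
  then obtain q where q: "P q" "\<And>q'. q' < q \<Longrightarrow> \<not> P q'" by (metis exists_least_iff)
  then obtain w where w: "w \<in> W" "w \<in> Uk k" "w \<in> colbound k (int q)" "w \<noteq> 0" unfolding P_def by blast
  have sing: "app (Top n \<mu> ?c i k r) w = 0" if i: "i \<in> {1..<k}" for i r
  proof (rule ccontr)
    let ?w = "app (Top n \<mu> ?c i k r) w"
    assume nz: "?w \<noteq> 0"
    have "?w \<in> Uk k \<inter> colbound k (int q + (if i = k then 1 else 0) - (if k = k then 1 else 0))"
      by (rule Top_Uk_colbound) (use w i k in auto)
    then have *: "?w \<in> Uk k" "?w \<in> colbound k (int q - 1)" using i by auto
    obtain A where "A \<in> Poly_Mapping.keys ?w" using nz by (rule nonzero_obtain_key)
    then have "int (card {p \<in> A. xcol p = k}) \<le> int q - 1" using *(2) by (auto simp: colbound_def)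
    then have "q > 0" by linarith
    then have "P (q - 1)" unfolding P_def
      using *(1,2) nz stable[of i k w r] w(1) i k by (intro bexI[of _ ?w]) (auto simp: of_nat_diff)
    then show False using q(2)[of "q - 1"] \<open>q > 0\<close> by simp
  qed
  obtain \<phi> where \<phi>: "\<phi> \<noteq> 0"
    and G: "\<And>v i j b. v \<in> Uk k \<Longrightarrow> i \<in> {1..k} \<Longrightarrow> j \<in> {1..k} \<Longrightarrow>
       Gfps n \<mu> ?c i j v b = \<phi> * Gfps k \<mu> (filter (\<lambda>a. \<nu> a < k) ?c) i j v b"
  proof -
    have c: "distinct ?c" "set ?c \<subseteq> {1..m}" by auto
    show thesis using Gfps_strip[OF c k(2)] that by blast
  qed
  \<comment> \<open>Complex power series have no zero divisors, so the scalar factor of the long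
    rows cancels.\<close>
  have sing': "app (Top k \<mu> (filter (\<lambda>a. \<nu> a < k) ?c) i k r) w = 0" if i: "i \<in> {1..<k}" for i r
  proof -
    have ik: "i \<in> {1..k}" "k \<in> {1..k}" using i k by auto
    have "\<forall>b. Gfps n \<mu> ?c i k w b = 0" unfolding Gfps_eq_0_iff by (intro allI sing i)
    then have "\<forall>b. \<phi> * Gfps k \<mu> (filter (\<lambda>a. \<nu> a < k) ?c) i k w b = 0"
      unfolding G[OF w(2) ik] .
    then have "\<forall>b. Gfps k \<mu> (filter (\<lambda>a. \<nu> a < k) ?c) i k w b = 0"
      using \<phi> by (simp only: mult_eq_0_iff simp_thms)
    then show ?thesis unfolding Gfps_eq_0_iff by (rule spec)
  qed
  have rows: "if k \<le> \<nu> a then {j. XV a j \<in> A} = {1..\<nu> a} else {j. XV a j \<in> A} \<subseteq> {1..k}"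
    "card {j. XV a j \<in> A} = \<nu> a"
    if "A \<in> Poly_Mapping.keys w" "a \<in> {1..m}" for A a
  proof -
    show "if k \<le> \<nu> a then {j. XV a j \<in> A} = {1..\<nu> a} else {j. XV a j \<in> A} \<subseteq> {1..k}"
      using UkD(1)[OF w(2) that(1)] that(2) unfolding std_rows_def by (rule bspec)
    have "int (card {p \<in> A. xrow p = a}) = wt m \<nu> a" using UkD(2)[OF w(2)] that(1) unfolding Gw_def by blast
    then show "card {j. XV a j \<in> A} = \<nu> a" using that(2) unfolding card_row by (simp add: wt_def)
  qed
  have col: "XV a k \<notin> A" if A: "A \<in> Poly_Mapping.keys w" and a: "a \<in> {1..m}" "\<nu> a < k" for A a
  proof (rule no_column_of_singular[where c = "filter (\<lambda>a. \<nu> a < k) ?c" and w = w and k = k and \<mu> = \<mu> and \<nu> = \<nu>])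
    show "distinct (filter (\<lambda>a. \<nu> a < k) ?c)" by simp
    show "sorted_wrt (\<lambda>a b. \<mu> a + of_nat (\<nu> a) - of_nat k \<noteq> \<mu> b) (filter (\<lambda>a. \<nu> a < k) ?c)"
      by (rule dominant_sorted)
    show "finite B" if "B \<in> Poly_Mapping.keys w" for B using that w(2) by (auto simp: Uk_def Gw_def)
    show "{j. XV b j \<in> B} \<subseteq> {1..k} \<and> card {j. XV b j \<in> B} = \<nu> b"
      if "B \<in> Poly_Mapping.keys w" "b \<in> set (filter (\<lambda>a. \<nu> a < k) ?c)" for B b
    proof -
      have "b \<in> {1..m}" "\<not> k \<le> \<nu> b" using that(2) by (auto simp del: upt_Suc)
      then show ?thesis using rows[OF that(1), of b] by (simp only: if_False)
    qed
    show "app (Top k \<mu> (filter (\<lambda>a. \<nu> a < k) ?c) i k r) w = 0" if "i \<in> {1..<k}" for i r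
      by (rule sing'[OF that])
  qed (use A a in \<open>auto simp del: upt_Suc\<close>)
  have "w \<in> Uk (k - 1)"
    unfolding Uk_def std_rows_def
  proof (intro CollectI conjI ballI)
    show "w \<in> Gw n (wt m \<nu>)" using w(2) by (simp add: Uk_def)
    fix A a assume A: "A \<in> Poly_Mapping.keys w" and a: "a \<in> {1..m}"
    show "if k - 1 \<le> \<nu> a then {j. XV a j \<in> A} = {1..\<nu> a} else {j. XV a j \<in> A} \<subseteq> {1..k - 1}"
    proof (cases "k \<le> \<nu> a")
      case True
      then show ?thesis using rows(1)[OF A a] by auto
    next
      case False
      then have "{j. XV a j \<in> A} \<subseteq> {1..k}" "k \<notin> {j. XV a j \<in> A}"
        using rows(1)[OF A a] col[OF A a] by auto
      then have "{j. XV a j \<in> A} \<subseteq> {1..k} - {k}" by blast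
      also have "{1..k} - {k} = {1..k - 1}" using k by auto
      finally have sub: "{j. XV a j \<in> A} \<subseteq> {1..k - 1}" .
      show ?thesis
      proof (cases "k - 1 \<le> \<nu> a")
        case True
        \<comment> \<open>Such a row is now confined to k - 1 columns and must fill them all; it
          joins the rows that agree with \<xi>.\<close>
        then have "\<nu> a = k - 1" using False by simp
        then show ?thesis using sub rows(2)[OF A a] card_subset_eq[of "{1..k - 1}" "{j. XV a j \<in> A}"] by simp
      qed (use sub in auto)
    qed
  qed
  then show ?thesis using w by blast
qed

lemma finite_rows:
  assumes "v \<in> Gw n (wt m \<nu>)" "A \<in> Poly_Mapping.keys v"
  shows "A \<subseteq> (\<lambda>(a, j). XV a j) ` ({1..m} \<times> {1..n})"
proof
  fix p assume p: "p \<in> A"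
  then have "xrow p \<in> {1..m}" using Gw_row[OF assms, of "xrow p" "xcol p"] by simp
  moreover have "xcol p \<in> {1..n}" using assms p unfolding Gw_def by blast
  ultimately show "p \<in> (\<lambda>(a, j). XV a j) ` ({1..m} \<times> {1..n})"
    by (intro image_eqI[of _ _ "(xrow p, xcol p)"]) auto
qed

lemma submodule_contains_xi:
  assumes W: "cvec.subspace W" "W \<subseteq> Gw n (wt m \<nu>)" "W \<noteq> {0}"
    and stable: "\<And>i j r w. i \<in> {1..n} \<Longrightarrow> j \<in> {1..n} \<Longrightarrow> w \<in> W \<Longrightarrow> app (Top n \<mu> (rev [1..<Suc m]) i j r) w \<in> W"
  shows "bvec (xi_set m \<nu>) \<in> W"
proof -
  have "0 \<in> W" using W(1) by (rule cvec.subspace_0)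
  then obtain w where w: "w \<in> W" "w \<noteq> 0" using W(3) by blast
  \<comment> \<open>For k = n the condition follows from the degrees alone, since a row of degree n
    contains every column.\<close>
  have "w \<in> Uk n"
    unfolding Uk_def std_rows_def
  proof (intro CollectI conjI ballI)
    show G: "w \<in> Gw n (wt m \<nu>)" using w W(2) by blast
    fix A a assume A: "A \<in> Poly_Mapping.keys w" and a: "a \<in> {1..m}"
    have sub: "{j. XV a j \<in> A} \<subseteq> {1..n}" using G A unfolding Gw_def by force
    have "int (card {p \<in> A. xrow p = a}) = wt m \<nu> a" using G A unfolding Gw_def by blast
    then have "card {j. XV a j \<in> A} = \<nu> a" using a unfolding card_row by (simp add: wt_def)
    then show "if n \<le> \<nu> a then {j. XV a j \<in> A} = {1..\<nu> a} else {j. XV a j \<in> A} \<subseteq> {1..n}"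
      using sub nu[OF a] card_subset_eq[of "{1..n}" "{j. XV a j \<in> A}"] by auto
  qed
  then have "\<exists>w\<in>W \<inter> Uk (n - d). w \<noteq> 0" for d
  proof (induction d)
    case 0
    then show ?case using w by auto
  next
    case (Suc d)
    then show ?case
      using submodule_descend[OF W(1,2) stable, of "n - d"] by (cases "d < n") auto
  qed
  from this[of n] obtain w where w: "w \<in> W" "w \<in> Uk 0" "w \<noteq> 0" by auto
  \<comment> \<open>For k = 0 every row falls under the first case of \<open>std_rows\<close>, so
    \<xi> is the only monomial left.\<close>
  have "A = xi_set m \<nu>" if A: "A \<in> Poly_Mapping.keys w" for A
  proof -
    have "XV a j \<in> A \<longleftrightarrow> XV a j \<in> xi_set m \<nu>" for a j
    proof (cases "a \<in> {1..m}")
      case True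
      then have "{j. XV a j \<in> A} = {1..\<nu> a}" using std_rowsD(1)[OF UkD(1)[OF w(2) A]] by simp
      then have "XV a j \<in> A \<longleftrightarrow> j \<in> {1..\<nu> a}" by blast
      then show ?thesis using True by (simp add: xi_set_def)
    next
      case False
      then have "XV a j \<notin> A" using Gw_row[OF UkD(2)[OF w(2)] A, of a j] by blast
      then show ?thesis using False by (auto simp: xi_set_def)
    qed
    then show ?thesis by (metis subsetI subset_antisym xvar.exhaust)
  qed
  then have "Poly_Mapping.keys w \<subseteq> {xi_set m \<nu>}" by blast
  then have eq: "w = cscale (Poly_Mapping.lookup w (xi_set m \<nu>)) (bvec (xi_set m \<nu>))"
    by (intro poly_mapping_eqI) (auto simp: lookup_single when_def in_keys_iff)
  then have "Poly_Mapping.lookup w (xi_set m \<nu>) \<noteq> 0" using w(3) by (metis cscale_simps(1))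
  moreover have "cscale (inverse (Poly_Mapping.lookup w (xi_set m \<nu>))) w \<in> W"
    using w(1) W(1) by (simp add: cvec.subspace_scale)
  ultimately show ?thesis by (subst (asm) (2) eq) simp
qed

end

section \<open>Duality\<close>

text \<open>The values lie in a one-dimensional space \<^typ>\<open>unit \<Rightarrow>\<^sub>0 complex\<close> so that \<^const>\<open>clinear\<close> applies.\<close>

definition bil :: "('b \<Rightarrow>\<^sub>0 complex) \<Rightarrow> ('b \<Rightarrow>\<^sub>0 complex) \<Rightarrow> (unit \<Rightarrow>\<^sub>0 complex)" where
  "bil v w = lin_ext (\<lambda>a. Poly_Mapping.single () (Poly_Mapping.lookup w a)) v"

lemma bil_superset:
  assumes "finite S" "Poly_Mapping.keys v \<subseteq> S"
  shows "bil v w = (\<Sum>a\<in>S. Poly_Mapping.single () (Poly_Mapping.lookup v a * Poly_Mapping.lookup w a))"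
  unfolding bil_def by (simp add: lin_ext_superset[OF assms])

lemma bil_commute: "bil v w = bil w v"
  by (simp add: bil_superset[of "Poly_Mapping.keys v \<union> Poly_Mapping.keys w"] mult.commute)

lemma clinear_bil: "clinear (\<lambda>v. bil v w)"
  unfolding bil_def by (rule clinear_lin_ext)

lemma clinear_bil_right: "clinear (bil v)"
proof -
  have "bil v = (\<lambda>w. bil w v)" by (rule ext) (rule bil_commute)
  then show ?thesis by (simp add: clinear_bil)
qed

lemma bil_bvec: "bil (bvec a) w = Poly_Mapping.single () (Poly_Mapping.lookup w a)"
  by (simp add: bil_def)

text \<open>A relation and not an operation: on a space of infinite dimension an adjoint need not
  exist, and below both operators are always exhibited.\<close>

definition adj :: "'b linop \<Rightarrow> 'b linop \<Rightarrow> bool" where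
  "adj A B \<longleftrightarrow> (\<forall>v w. bil (app A v) w = bil v (app B w))"

lemma adjI:
  assumes "\<And>a b. Poly_Mapping.lookup (app A (bvec a)) b = Poly_Mapping.lookup (app B (bvec b)) a"
  shows "adj A B"
  unfolding adj_def
proof (intro allI)
  fix v w
  have 1: "bil (app A (bvec a)) (bvec b) = bil (bvec a) (app B (bvec b))" for a b
    by (simp add: bil_commute[of "app A (bvec a)"] bil_bvec assms)
  have 2: "bil (app A (bvec a)) w = bil (bvec a) (app B w)" for a
  proof (rule clinear_eqI_keys[where f = "bil (app A (bvec a))" and g = "\<lambda>w. bil (bvec a) (app B w)"])
    show "clinear (\<lambda>w. bil (bvec a) (app B w))"
      by (rule clinear_compose[OF clinear_bil_right clinear_app])
  qed (rule clinear_bil_right 1)+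
  show "bil (app A v) w = bil v (app B w)"
  proof (rule clinear_eqI_keys[where f = "\<lambda>v. bil (app A v) w" and g = "\<lambda>v. bil v (app B w)"])
    show "clinear (\<lambda>v. bil (app A v) w)"
      by (rule clinear_compose[OF clinear_bil clinear_app])
  qed (rule clinear_bil 2)+
qed

lemma adj_add: "adj A A' \<Longrightarrow> adj B B' \<Longrightarrow> adj (A + B) (A' + B')"
  by (simp add: adj_def clinear_add[OF clinear_bil] clinear_add[OF clinear_bil_right])

lemma adj_zero: "adj 0 0"
  by (simp add: adj_def clinear_zero[OF clinear_bil] clinear_zero[OF clinear_bil_right])

lemma adj_one: "adj 1 1"
  by (simp add: adj_def)

lemma adj_sum: "(\<And>x. x \<in> S \<Longrightarrow> adj (f x) (g x)) \<Longrightarrow> adj (sum f S) (sum g S)"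
  by (induction S rule: infinite_finite_induct) (auto simp: adj_zero adj_add)

lemma adj_mult: "adj A A' \<Longrightarrow> adj B B' \<Longrightarrow> adj (A * B) (B' * A')"
  by (simp add: adj_def)

lemma adj_sc: "adj (sc c) (sc c)"
  by (simp add: adj_def clinear_cscale[OF clinear_bil] clinear_cscale[OF clinear_bil_right])

lemma adj_cre_ann: "adj (cre p) (ann p)"
proof (rule adjI)
  fix A B
  have 1: "Poly_Mapping.lookup (app (cre p) (bvec A)) B = (if finite A \<and> p \<notin> A \<and> B = insert p A then psign p A else 0)"
    by (simp add: cre_single lookup_single when_def)
  have 2: "Poly_Mapping.lookup (app (ann p) (bvec B)) A = (if finite B \<and> p \<in> B \<and> A = B - {p} then psign p B else 0)"
    by (simp add: ann_single lookup_single when_def)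
  have 3: "finite A \<and> p \<notin> A \<and> B = insert p A \<longleftrightarrow> finite B \<and> p \<in> B \<and> A = B - {p}"
    by (metis Diff_insert_absorb finite_insert insertI1 insert_Diff Diff_iff singletonI finite_Diff)
  show "Poly_Mapping.lookup (app (cre p) (bvec A)) B = Poly_Mapping.lookup (app (ann p) (bvec B)) A"
  proof (cases "finite A \<and> p \<notin> A \<and> B = insert p A")
    case True
    then have "psign p B = psign p A" by (metis psign_insert less_irrefl)
    then show ?thesis unfolding 1 2 3[symmetric] using True by metis
  qed (simp only: 1 2 3 if_False)
qed

lemma adj_commute: "adj A B \<Longrightarrow> adj B A"
  unfolding adj_def using bil_commute by metis

lemma adj_Eop: "adj (Eop a i j) (Eop a j i)"
  unfolding eop_def by (rule adj_mult[OF adj_cre_ann adj_commute[OF adj_cre_ann]])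

lemma adj_Lop: "adj (Lop \<mu> a i j s) (Lop \<mu> a j i s)"
proof -
  have "adj (sc c * Eop a i j) (sc c * Eop a j i)" for c
    using adj_mult[OF adj_sc adj_Eop, of c a i j] by (simp add: sc_commute)
  then show ?thesis by (auto simp: Lop_def adj_zero adj_one)
qed

text \<open>Transposition sends E^(a)_ij to E^(a)_ji and reverses products. So it reverses the order
  of the rows and exchanges i and j.\<close>

lemma adj_Top:
  assumes "i \<in> {1..n}" "j \<in> {1..n}"
  shows "adj (Top n \<mu> c i j r) (Top n \<mu> (rev c) j i r)"
  using assms(1)
proof (induction c arbitrary: i r)
  case Nil
  then show ?case by (auto simp: adj_zero adj_one)
next
  case (Cons a c)
  have "adj (Top n \<mu> (a # c) i j r) (\<Sum>k\<in>{1..n}. \<Sum>s\<le>r. Top n \<mu> (rev c) j k (r - s) * Lop \<mu> a k i s)"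
    unfolding Top.simps by (intro adj_sum adj_mult adj_Lop Cons.IH)
  also have "(\<Sum>k\<in>{1..n}. \<Sum>s\<le>r. Top n \<mu> (rev c) j k (r - s) * Lop \<mu> a k i s)
    = (\<Sum>k\<in>{1..n}. \<Sum>s\<le>r. Top n \<mu> (rev c) j k s * Lop \<mu> a k i (r - s))"
    by (rule sum.cong[OF refl], rule sum.reindex_bij_witness[of _ "\<lambda>s. r - s" "\<lambda>s. r - s"]) auto
  also have "\<dots> = Top n \<mu> (rev (a # c)) j i r"
    using Cons.prems by (simp only: rev.simps Top_append[OF assms(2)] Top_singleton)
  finally show ?case .
qed

text \<open>Provides an abstract functional that detects a proper subspace. In \<open>cyclic\<close>
  it is turned into a vector, which is possible because the weight space is
  finite-dimensional.\<close>

lemma subspace_separation: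
  assumes "cvec.subspace S" "v0 \<notin> S"
  obtains \<phi> :: "('b \<Rightarrow>\<^sub>0 complex) \<Rightarrow> complex" where
    "\<And>v w. \<phi> (v + w) = \<phi> v + \<phi> w" "\<And>c v. \<phi> (cscale c v) = c * \<phi> v" "\<And>v. v \<in> S \<Longrightarrow> \<phi> v = 0" "\<phi> v0 = 1"
proof -
  interpret vp: vector_space_pair cscale "(*) :: complex \<Rightarrow> complex \<Rightarrow> complex"
    by unfold_locales (auto simp: algebra_simps)
  obtain B where B: "B \<subseteq> S" "cvec.independent B" "S \<subseteq> cvec.span B"
    using cvec.maximal_independent_subset[of S] by blast
  have span: "cvec.span B = S"
    using B assms(1) cvec.span_minimal by blast
  then have "cvec.independent (insert v0 B)"
    using B(2) assms(2) by (simp add: cvec.independent_insert)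
  from vp.linear_independent_extend[OF this, of "\<lambda>x. if x = v0 then 1 else 0"]
  obtain g where g: "Vector_Spaces.linear cscale (*) g" "\<forall>x\<in>insert v0 B. g x = (if x = v0 then 1 else 0)"
    by blast
  have "g v = 0" if "v \<in> S" for v
  proof (rule vp.linear_eq_0_on_span[OF g(1)])
    show "v \<in> cvec.span B" using that span by simp
    fix x assume "x \<in> B"
    then have "x \<noteq> v0" using B(1) assms(2) by blast
    then show "g x = 0" using g(2) \<open>x \<in> B\<close> by simp
  qed
  moreover have "g v0 = 1" using g(2) by simp
  moreover have "g (v + w) = g v + g w" "g (cscale c v) = c * g v" for v w c
    using g(1) by (simp_all add: vp.linear_add vp.linear_scale)
  ultimately show thesis using that by blast
qed

section \<open>Cyclicity for the original order of the rows and its consequences\<close>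

context dominant_weights
begin

lemma bvec_key_Gw: "v \<in> Gw n \<omega> \<Longrightarrow> A \<in> Poly_Mapping.keys v \<Longrightarrow> bvec A \<in> Gw n \<omega>"
  by (simp add: Gw_def)

lemma finite_basis_Gw: "finite {A. bvec A \<in> Gw n (wt m \<nu>)}"
proof (rule finite_subset)
  show "{A. bvec A \<in> Gw n (wt m \<nu>)} \<subseteq> Pow ((\<lambda>(a, j). XV a j) ` ({1..m} \<times> {1..n}))"
  proof (intro subsetI PowI)
    fix A p assume A: "A \<in> {A. bvec A \<in> Gw n (wt m \<nu>)}" and p: "p \<in> A"
    have "A \<subseteq> (\<lambda>(a, j). XV a j) ` ({1..m} \<times> {1..n})"
      by (rule finite_rows[of "bvec A"]) (use A in auto)
    then show "p \<in> (\<lambda>(a, j). XV a j) ` ({1..m} \<times> {1..n})" using p by (rule subsetD)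
  qed
qed simp

lemma xi_Gw: "bvec (xi_set m \<nu>) \<in> Gw n (wt m \<nu>)"
proof -
  have row: "{j. XV a j \<in> xi_set m \<nu>} = (if a \<in> {1..m} then {1..\<nu> a} else {})" for a
    by (auto simp: xi_set_def)
  have "xi_set m \<nu> \<subseteq> (\<lambda>(a, j). XV a j) ` ({1..m} \<times> {1..n})"
  proof
    fix p assume "p \<in> xi_set m \<nu>"
    then have "xrow p \<in> {1..m}" "xcol p \<in> {1..n}" using nu[of "xrow p"] by (auto simp: xi_set_def)
    then show "p \<in> (\<lambda>(a, j). XV a j) ` ({1..m} \<times> {1..n})"
      by (intro image_eqI[of _ _ "(xrow p, xcol p)"]) auto
  qed
  then have "finite (xi_set m \<nu>)" "\<forall>p\<in>xi_set m \<nu>. xcol p \<in> {1..n}"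
    by (auto intro: finite_subset)
  moreover have "int (card {p \<in> xi_set m \<nu>. xrow p = a}) = wt m \<nu> a" for a
    unfolding card_row row by (simp add: wt_def)
  ultimately show ?thesis by (simp add: Gw_def)
qed

text \<open>
  The orthogonal complement of a submodule is a submodule for the reverse order of the rows, and
  contains \<open>\<xi>\<close> unless it is zero.
\<close>

lemma cyclic:
  assumes S: "cvec.subspace S" "S \<subseteq> Gw n (wt m \<nu>)" "bvec (xi_set m \<nu>) \<in> S"
    and stable: "\<And>i j r w. i \<in> {1..n} \<Longrightarrow> j \<in> {1..n} \<Longrightarrow> w \<in> S \<Longrightarrow> app (Top n \<mu> [1..<Suc m] i j r) w \<in> S"
  shows "S = Gw n (wt m \<nu>)"
proof (rule ccontr)
  assume "S \<noteq> Gw n (wt m \<nu>)"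
  then obtain v0 where v0: "v0 \<in> Gw n (wt m \<nu>)" "v0 \<notin> S" using S(2) by blast
  obtain \<phi> where \<phi>: "\<And>v w. \<phi> (v + w) = \<phi> v + \<phi> w" "\<And>c v. \<phi> (cscale c v) = c * \<phi> v"
    "\<And>v. v \<in> S \<Longrightarrow> \<phi> v = 0" "\<phi> v0 = 1"
    using subspace_separation[OF S(1) v0(2)] by blast
  let ?K = "{A. bvec A \<in> Gw n (wt m \<nu>)}"
  \<comment> \<open>The sum is finite by \<open>finite_basis_Gw\<close> and represents \<phi> on the
    weight space through \<open>bil\<close>.\<close>
  define w where "w = (\<Sum>A\<in>?K. cscale (\<phi> (bvec A)) (bvec A))"
  have w_Gw: "w \<in> Gw n (wt m \<nu>)"
    unfolding w_def by (intro sum_Gw cscale_Gw) simp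
  have bw: "bil v w = Poly_Mapping.single () (\<phi> v)" if v: "v \<in> Gw n (wt m \<nu>)" for v
  proof -
    have lw: "Poly_Mapping.lookup w A = \<phi> (bvec A)" if "A \<in> ?K" for A
      using that finite_basis_Gw
      by (simp add: w_def lookup_sum' lookup_single when_def if_distrib[of "\<lambda>x. _ * x"] cong: if_cong)
    have sub: "Poly_Mapping.keys v \<subseteq> ?K" using bvec_key_Gw[OF v] by blast
    have \<phi>0: "\<phi> 0 = 0" using \<phi>(2)[of 0 0] by simp
    have \<phi>_sum: "\<phi> (sum g X) = (\<Sum>x\<in>X. \<phi> (g x))" for g :: "xvar set \<Rightarrow> grass" and X
      by (induction X rule: infinite_finite_induct) (auto simp: \<phi>0 \<phi>(1))
    have "\<phi> v = \<phi> (\<Sum>A\<in>Poly_Mapping.keys v. cscale (Poly_Mapping.lookup v A) (bvec A))"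
      using lin_ext_bvec[of v] by (simp only: lin_ext_def)
    also have "\<dots> = (\<Sum>A\<in>Poly_Mapping.keys v. Poly_Mapping.lookup v A * \<phi> (bvec A))"
      unfolding \<phi>_sum \<phi>(2) ..
    also have "\<dots> = (\<Sum>A\<in>Poly_Mapping.keys v. Poly_Mapping.lookup v A * Poly_Mapping.lookup w A)"
      by (intro sum.cong refl, subst lw) (use sub in auto)
    also have "Poly_Mapping.single () \<dots> = bil v w"
      unfolding bil_superset[OF finite_keys order_refl]
      by (rule poly_mapping_eqI) (simp add: lookup_sum')
    finally show ?thesis by simp
  qed
  define P where "P = {w \<in> Gw n (wt m \<nu>). \<forall>v\<in>S. bil v w = 0}"
  have "bvec (xi_set m \<nu>) \<in> P"
  proof (rule submodule_contains_xi)
    show "cvec.subspace P"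
      unfolding P_def
      by (rule cvec.subspaceI)
        (auto simp: add_Gw cscale_Gw clinear_add[OF clinear_bil_right] clinear_cscale[OF clinear_bil_right]
          clinear_zero[OF clinear_bil_right])
    show "P \<subseteq> Gw n (wt m \<nu>)" by (auto simp: P_def)
    have "w \<in> P" unfolding P_def using w_Gw bw S(2) \<phi>(3) by auto
    moreover have "w \<noteq> 0"
    proof
      assume "w = 0"
      then have "Poly_Mapping.single () (1::complex) = 0"
        using bw[OF v0(1)] \<phi>(4) clinear_zero[OF clinear_bil_right, of v0] by simp
      then show False by (metis lookup_single_eq lookup_zero zero_neq_one)
    qed
    ultimately show "P \<noteq> {0}" by blast
    fix i j r u assume ij: "i \<in> {1..n}" "j \<in> {1..n}" and u: "u \<in> P"
    have "bil v (app (Top n \<mu> (rev [1..<Suc m]) i j r) u) = 0" if v: "v \<in> S" for v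
    proof -
      have "bil v (app (Top n \<mu> (rev [1..<Suc m]) i j r) u) = bil (app (Top n \<mu> [1..<Suc m] j i r) v) u"
        using adj_Top[OF ij(2,1), of \<mu> "[1..<Suc m]" r] unfolding adj_def by simp
      also have "\<dots> = 0" using u stable[OF ij(2,1) v] by (simp add: P_def)
      finally show ?thesis .
    qed
    then show "app (Top n \<mu> (rev [1..<Suc m]) i j r) u \<in> P"
      using u Top_Gw[OF _ ij(1)] by (simp add: P_def)
  qed
  \<comment> \<open>\<xi> lies both in S and in its complement, so it would be orthogonal to itself,
    but its pairing with itself is 1.\<close>
  then have "bil (bvec (xi_set m \<nu>)) (bvec (xi_set m \<nu>)) = 0"
    using S(3) by (simp add: P_def)
  then have "Poly_Mapping.single () (1::complex) = 0" by (simp add: bil_bvec)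
  then show False by (metis lookup_single_eq lookup_zero zero_neq_one)
qed

text \<open>The vectors on which the two products agree form a submodule for the original order of
  the rows, and it contains \<xi>.\<close>

lemma Zlin_unique:
  assumes "normal_ordering m ps" "normal_ordering m qs" "v \<in> Gw n (wt m \<nu>)"
  shows "app (Zlin n lam \<mu> \<nu> ps) v = app (Zlin n lam \<mu> \<nu> qs) v"
proof -
  let ?S = "{v \<in> Gw n (wt m \<nu>). app (Zlin n lam \<mu> \<nu> ps) v = app (Zlin n lam \<mu> \<nu> qs) v}"
  have "?S = Gw n (wt m \<nu>)"
  proof (rule cyclic)
    show "cvec.subspace ?S"
      by (rule cvec.subspaceI) (auto simp: add_Gw cscale_Gw app_add app_cscale)
    show "bvec (xi_set m \<nu>) \<in> ?S"
      using assms by (simp add: xi_Gw Zlin_xi normal_ordering_def)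
    show "app (Top n \<mu> [1..<Suc m] i j r) w \<in> ?S" if "i \<in> {1..n}" "j \<in> {1..n}" "w \<in> ?S" for i j r w
      using that Top_Gw[of w n "wt m \<nu>" i \<mu> "[1..<Suc m]" j r] Zlin_Top[OF assms(1), of w i j r] Zlin_Top[OF assms(2), of w i j r]
      by (simp del: upt_Suc)
  qed auto
  then show ?thesis using assms(3) by blast
qed

text \<open>W contains \<xi>, so its preimage is a submodule containing \<xi> and hence the whole
  weight space by \<open>cyclic\<close>.\<close>

lemma Zlin_image_irreducible:
  assumes "normal_ordering m ps"
    and W: "cvec.subspace W" "W \<subseteq> app (Zlin n lam \<mu> \<nu> ps) ` Gw n (wt m \<nu>)" "W \<noteq> {0}"
    and stable: "\<And>i j r w. i \<in> {1..n} \<Longrightarrow> j \<in> {1..n} \<Longrightarrow> w \<in> W \<Longrightarrow> app (Top n \<mu> (rev [1..<Suc m]) i j r) w \<in> W"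
  shows "W = app (Zlin n lam \<mu> \<nu> ps) ` Gw n (wt m \<nu>)"
proof -
  let ?Z = "app (Zlin n lam \<mu> \<nu> ps)"
  have WG: "W \<subseteq> Gw n (wt m \<nu>)" using W(2) Zlin_Gw by fastforce
  have xi: "bvec (xi_set m \<nu>) \<in> W"
    by (rule submodule_contains_xi[OF W(1) WG W(3) stable])
  let ?S = "{v \<in> Gw n (wt m \<nu>). ?Z v \<in> W}"
  have "?S = Gw n (wt m \<nu>)"
  proof (rule cyclic)
    show "cvec.subspace ?S"
      using W(1) by (intro cvec.subspaceI)
        (auto simp: add_Gw cscale_Gw app_add app_cscale cvec.subspace_0 cvec.subspace_add cvec.subspace_scale)
    show "bvec (xi_set m \<nu>) \<in> ?S"
      using assms(1) xi by (simp add: xi_Gw Zlin_xi normal_ordering_def)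
    show "app (Top n \<mu> [1..<Suc m] i j r) w \<in> ?S" if "i \<in> {1..n}" "j \<in> {1..n}" "w \<in> ?S" for i j r w
      using that Top_Gw[of w n "wt m \<nu>" i \<mu> "[1..<Suc m]" j r] Zlin_Top[OF assms(1), of w i j r] stable
      by (simp del: upt_Suc)
  qed auto
  then have "?Z ` Gw n (wt m \<nu>) \<subseteq> W" by blast
  then show ?thesis using W(2) by blast
qed

end

section \<open>The relations of the Yangian\<close>

text \<open>
  \<open>tfps\<close> and \<open>sfps\<close> turn a series in $u^{-1}$ into a series in the outer variable $t = u^{-1}$
  and in the inner variable $s = v^{-1}$; the relations are multiplied by $st$.
\<close>

definition tfps :: "'r :: ring_1 fps \<Rightarrow> 'r fps fps" where
  "tfps A = Abs_fps (\<lambda>r. fps_const (fps_nth A r))"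

definition sfps :: "'r :: ring_1 fps \<Rightarrow> 'r fps fps" where
  "sfps A = fps_const A"

lemma fps_const_sum: "fps_const (sum f S) = (\<Sum>x\<in>S. fps_const (f x))" for f :: "'a \<Rightarrow> 'r :: ring_1"
  by (induction S rule: infinite_finite_induct) (auto simp flip: fps_const_add)

lemma tfps_mult: "tfps (A * B) = tfps A * tfps B"
  by (rule fps_ext) (simp add: tfps_def fps_mult_nth fps_const_sum)

lemma sfps_mult: "sfps (A * B) = sfps A * sfps B"
  by (simp add: sfps_def)

lemma tfps_sum: "tfps (sum f S) = (\<Sum>x\<in>S. tfps (f x))"
  by (rule fps_ext) (simp add: tfps_def fps_sum_nth fps_const_sum)

lemma sfps_sum: "sfps (sum f S) = (\<Sum>x\<in>S. sfps (f x))"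
  by (simp add: sfps_def fps_const_sum)

lemma nth_tfps_sfps: "fps_nth (fps_nth (tfps A * sfps B) r) s = fps_nth A r * fps_nth B s"
  by (simp add: tfps_def sfps_def)

lemma nth_sfps_tfps: "fps_nth (fps_nth (sfps B * tfps A) r) s = fps_nth B s * fps_nth A r"
  by (simp add: tfps_def sfps_def)

lemma tfps_sfps_commute:
  assumes "\<And>r s. fps_nth A r * fps_nth B s = fps_nth B s * fps_nth A r"
  shows "tfps A * sfps B = sfps B * tfps A"
  by (intro fps_ext) (simp only: nth_tfps_sfps nth_sfps_tfps assms)

text \<open>With t = 1/u and s = 1/v, the factor u - v is (s - t)/(s t). Terms with the series in u
  first are collected on the left, the others on the right: this is the matrix form R T1(u) T2(v) =
  T2(v) T1(u) R, which is compatible with products.\<close>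

definition RTT :: "nat \<Rightarrow> (nat \<Rightarrow> nat \<Rightarrow> 'r :: ring_1 fps) \<Rightarrow> bool" where
  "RTT n A \<longleftrightarrow> (\<forall>i\<in>{1..n}. \<forall>j\<in>{1..n}. \<forall>k\<in>{1..n}. \<forall>l\<in>{1..n}.
     (sfps fps_X - fps_X) * (tfps (A i j) * sfps (A k l)) - sfps fps_X * fps_X * (tfps (A k j) * sfps (A i l))
   = (sfps fps_X - fps_X) * (sfps (A k l) * tfps (A i j)) - sfps fps_X * fps_X * (sfps (A k j) * tfps (A i l)))"

lemma sfps_X_commute: "X * sfps fps_X = sfps fps_X * X"
  by (rule fps_ext) (simp add: sfps_def fps_mult_fps_X_commute)

lemma fps_central:
  "X * (sfps fps_X - fps_X) = (sfps fps_X - fps_X) * X"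
  "X * (sfps fps_X * fps_X) = sfps fps_X * fps_X * X"
proof -
  show "X * (sfps fps_X - fps_X) = (sfps fps_X - fps_X) * X"
    by (simp add: algebra_simps sfps_X_commute fps_mult_fps_X_commute)
  show "X * (sfps fps_X * fps_X) = sfps fps_X * fps_X * X"
    by (metis mult.assoc sfps_X_commute fps_mult_fps_X_commute)
qed

text \<open>R is moved first past the A-part and then past the B-part. That entries of A commute
  with entries of B serves to regroup the mixed products as (A A)(B B).\<close>

lemma RTT_mult:
  assumes A: "RTT n A" and B: "RTT n B"
    and comm: "\<And>i j k l r s. fps_nth (A i j) r * fps_nth (B k l) s = fps_nth (B k l) s * fps_nth (A i j) r"
  shows "RTT n (\<lambda>i j. \<Sum>k\<in>{1..n}. A i k * B k j)"
  unfolding RTT_def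
proof (intro ballI)
  fix i j k l assume ijkl: "i \<in> {1..n}" "j \<in> {1..n}" "k \<in> {1..n}" "l \<in> {1..n}"
  let ?C = "\<lambda>i j. \<Sum>k\<in>{1..n}. A i k * B k j"
  define z where "z = (sfps fps_X - fps_X :: 'a fps fps)"
  define y where "y = (sfps fps_X * fps_X :: 'a fps fps)"
  have central: "X * z = z * X" "X * y = y * X" for X
    unfolding z_def y_def by (rule fps_central)+
  let ?N = "{1..n}"
  define XA where "XA i k p q = tfps (A i p) * sfps (A k q)" for i k p q
  define YA where "YA i k p q = sfps (A k q) * tfps (A i p)" for i k p q
  define XB where "XB i k p q = tfps (B i p) * sfps (B k q)" for i k p q
  define YB where "YB i k p q = sfps (B k q) * tfps (B i p)" for i k p q
  have hA: "z * XA i k p q - y * XA k i p q = z * YA i k p q - y * YA i k q p"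
    if "i \<in> ?N" "k \<in> ?N" "p \<in> ?N" "q \<in> ?N" for i k p q
    using A that unfolding RTT_def XA_def YA_def z_def y_def by blast
  have hB: "z * XB i k p q - y * XB k i p q = z * YB i k p q - y * YB i k q p"
    if "i \<in> ?N" "k \<in> ?N" "p \<in> ?N" "q \<in> ?N" for i k p q
    using B that unfolding RTT_def XB_def YB_def z_def y_def by blast
  have XC: "tfps (?C i j) * sfps (?C k l) = (\<Sum>p\<in>?N. \<Sum>q\<in>?N. XA i k p q * XB p q j l)" for i j k l
  proof -
    have "tfps (A i p * B p j) * sfps (A k q * B q l) = XA i k p q * XB p q j l" for p q
    proof -
      have c: "tfps (B p j) * sfps (A k q) = sfps (A k q) * tfps (B p j)"
        by (rule tfps_sfps_commute) (rule comm[symmetric])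
      have "tfps (A i p * B p j) * sfps (A k q * B q l)
         = tfps (A i p) * (tfps (B p j) * sfps (A k q)) * sfps (B q l)"
        by (simp only: tfps_mult sfps_mult mult.assoc)
      then show ?thesis by (simp only: c XA_def XB_def mult.assoc)
    qed
    then show ?thesis by (simp only: tfps_sum sfps_sum sum_product)
  qed
  have YC: "sfps (?C k l) * tfps (?C i j) = (\<Sum>p\<in>?N. \<Sum>q\<in>?N. YA i k p q * YB p q j l)" for i j k l
  proof -
    have "sfps (A k q * B q l) * tfps (A i p * B p j) = YA i k p q * YB p q j l" for p q
    proof -
      have c: "sfps (B q l) * tfps (A i p) = tfps (A i p) * sfps (B q l)"
        by (rule tfps_sfps_commute[symmetric]) (rule comm)
      have "sfps (A k q * B q l) * tfps (A i p * B p j)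
         = sfps (A k q) * (sfps (B q l) * tfps (A i p)) * tfps (B p j)"
        by (simp only: tfps_mult sfps_mult mult.assoc)
      then show ?thesis by (simp only: c YA_def YB_def mult.assoc)
    qed
    hence "sfps (?C k l) * tfps (?C i j) = (\<Sum>q\<in>?N. \<Sum>p\<in>?N. YA i k p q * YB p q j l)"
      by (simp only: tfps_sum sfps_sum sum_product)
    also have "\<dots> = (\<Sum>p\<in>?N. \<Sum>q\<in>?N. YA i k p q * YB p q j l)" by (rule sum.swap)
    finally show ?thesis .
  qed
  have "z * (tfps (?C i j) * sfps (?C k l)) - y * (tfps (?C k j) * sfps (?C i l))
     = (\<Sum>p\<in>?N. \<Sum>q\<in>?N. (z * XA i k p q - y * XA k i p q) * XB p q j l)"
    unfolding XC by (simp only: sum_distrib_left sum_subtractf[symmetric] left_diff_distrib mult.assoc)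
  also have "\<dots> = (\<Sum>p\<in>?N. \<Sum>q\<in>?N. (z * YA i k p q - y * YA i k q p) * XB p q j l)"
    by (intro sum.cong refl arg_cong2[where f = "(*)"] hA ijkl)
  also have "\<dots> = (\<Sum>p\<in>?N. \<Sum>q\<in>?N. z * YA i k p q * XB p q j l) - (\<Sum>p\<in>?N. \<Sum>q\<in>?N. y * YA i k q p * XB p q j l)"
    by (simp only: sum_subtractf left_diff_distrib)
  \<comment> \<open>Renaming the summation indices moves the permutation part of R from the right of
    the A-terms to the left of the B-terms.\<close>
  also have "(\<Sum>p\<in>?N. \<Sum>q\<in>?N. y * YA i k q p * XB p q j l) = (\<Sum>p\<in>?N. \<Sum>q\<in>?N. y * YA i k p q * XB q p j l)"
    by (rule sum.swap)
  also have "(\<Sum>p\<in>?N. \<Sum>q\<in>?N. z * YA i k p q * XB p q j l) - \<dots>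
     = (\<Sum>p\<in>?N. \<Sum>q\<in>?N. YA i k p q * (z * XB p q j l - y * XB q p j l))"
    unfolding central[of "YA i k p q" for p q, symmetric] by (simp only: sum_subtractf right_diff_distrib mult.assoc)
  also have "\<dots> = (\<Sum>p\<in>?N. \<Sum>q\<in>?N. YA i k p q * (z * YB p q j l - y * YB p q l j))"
    by (intro sum.cong refl arg_cong2[where f = "(*)"] hB ijkl)
  also have "\<dots> = z * (sfps (?C k l) * tfps (?C i j)) - y * (sfps (?C k j) * tfps (?C i l))"
  proof -
    have "YA i k p q * (z * YB p q j l - y * YB p q l j) = z * (YA i k p q * YB p q j l) - y * (YA i k p q * YB p q l j)" for p q
      unfolding right_diff_distrib mult.assoc[symmetric] central[of "YA i k p q"] ..
    then show ?thesis unfolding YC by (simp only: sum_distrib_left sum_subtractf)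
  qed
  finally have "z * (tfps (?C i j) * sfps (?C k l)) - y * (tfps (?C k j) * sfps (?C i l))
     = z * (sfps (?C k l) * tfps (?C i j)) - y * (sfps (?C k j) * tfps (?C i l))" .
  then show "(sfps fps_X - fps_X) * (tfps (?C i j) * sfps (?C k l)) - sfps fps_X * fps_X * (tfps (?C k j) * sfps (?C i l))
     = (sfps fps_X - fps_X) * (sfps (?C k l) * tfps (?C i j)) - sfps fps_X * fps_X * (sfps (?C k j) * tfps (?C i l))"
    unfolding z_def y_def .
qed

lemma nth_sfps_X: "fps_nth (fps_nth (sfps fps_X * Z) r) s = (if s = 0 then 0 else fps_nth (fps_nth Z r) (s - 1))"
  by (simp add: sfps_def)

lemma nth_fps_X: "fps_nth (fps_nth (fps_X * Z) r) s = (if r = 0 then 0 else fps_nth (fps_nth Z (r - 1)) s)"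
  for Z :: "'r :: ring_1 fps fps"
  by simp

text \<open>Dividing by s t shifts both indices, so the coefficients at index 0 need separate care.
  The hypotheses hold for the commutators in question because the constant terms of the series are
  scalars.\<close>

lemma RTT_iff_aux:
  fixes Z Z' :: "'r :: ring_1 fps fps"
  assumes "\<And>s. fps_nth (fps_nth Z 0) s = 0" "\<And>r. fps_nth (fps_nth Z r) 0 = 0"
  shows "(sfps fps_X - fps_X) * Z = sfps fps_X * fps_X * Z' \<longleftrightarrow>
    (\<forall>r s. fps_nth (fps_nth Z (Suc r)) s - fps_nth (fps_nth Z r) (Suc s) = fps_nth (fps_nth Z' r) s)"
proof -
  have L: "fps_nth (fps_nth ((sfps fps_X - fps_X) * Z) r) s
     = (if s = 0 then 0 else fps_nth (fps_nth Z r) (s - 1)) - (if r = 0 then 0 else fps_nth (fps_nth Z (r - 1)) s)" for r s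
    unfolding left_diff_distrib fps_sub_nth nth_sfps_X nth_fps_X ..
  have R: "fps_nth (fps_nth (sfps fps_X * fps_X * Z') r) s
     = (if r = 0 \<or> s = 0 then 0 else fps_nth (fps_nth Z' (r - 1)) (s - 1))" for r s
    unfolding mult.assoc nth_sfps_X nth_fps_X by simp
  have "(sfps fps_X - fps_X) * Z = sfps fps_X * fps_X * Z' \<longleftrightarrow>
    (\<forall>r s. fps_nth (fps_nth ((sfps fps_X - fps_X) * Z) r) s = fps_nth (fps_nth (sfps fps_X * fps_X * Z') r) s)"
    by (simp only: fps_eq_iff)
  also have "\<dots> \<longleftrightarrow> (\<forall>r s. fps_nth (fps_nth Z (Suc r)) s - fps_nth (fps_nth Z r) (Suc s) = fps_nth (fps_nth Z' r) s)"
    (is "?l \<longleftrightarrow> ?r")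
  proof
    assume ?l
    show ?r
    proof (intro allI)
      fix r s
      show "fps_nth (fps_nth Z (Suc r)) s - fps_nth (fps_nth Z r) (Suc s) = fps_nth (fps_nth Z' r) s"
        using \<open>?l\<close>[rule_format, of "Suc r" "Suc s"] unfolding L R by simp
    qed
  next
    assume r: ?r
    show ?l
    proof (intro allI)
      fix r s
      show "fps_nth (fps_nth ((sfps fps_X - fps_X) * Z) r) s = fps_nth (fps_nth (sfps fps_X * fps_X * Z') r) s"
        unfolding L R using r[rule_format, of "r - 1" "s - 1"] assms by (cases r; cases s) simp_all
    qed
  qed
  finally show ?thesis .
qed

lemma diff_eq_swap: "a - b = c - d \<longleftrightarrow> a - c = b - d" for a b c d :: "'r :: ab_group_add"
proof -
  have *: "a - c = b - d" if "a - b = c - d" for a b c d :: 'r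
  proof -
    have "a = c - d + b" using that by (simp only: diff_eq_eq)
    then show ?thesis by simp
  qed
  show ?thesis using *[of a b c d] *[of a c b d] by blast
qed

lemma RTT_iff:
  assumes 0: "\<And>i j. i \<in> {1..n} \<Longrightarrow> j \<in> {1..n} \<Longrightarrow> fps_nth (A i j) 0 = (if i = j then 1 else 0)"
  shows "RTT n A \<longleftrightarrow> (\<forall>i\<in>{1..n}. \<forall>j\<in>{1..n}. \<forall>k\<in>{1..n}. \<forall>l\<in>{1..n}. \<forall>r s.
     (fps_nth (A i j) (Suc r) * fps_nth (A k l) s - fps_nth (A k l) s * fps_nth (A i j) (Suc r))
     - (fps_nth (A i j) r * fps_nth (A k l) (Suc s) - fps_nth (A k l) (Suc s) * fps_nth (A i j) r)
     = fps_nth (A k j) r * fps_nth (A i l) s - fps_nth (A k j) s * fps_nth (A i l) r)"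
  unfolding RTT_def
proof (intro ball_cong refl)
  fix i j k l assume ijkl: "i \<in> {1..n}" "j \<in> {1..n}" "k \<in> {1..n}" "l \<in> {1..n}"
  let ?Z = "tfps (A i j) * sfps (A k l) - sfps (A k l) * tfps (A i j)"
  let ?Z' = "tfps (A k j) * sfps (A i l) - sfps (A k j) * tfps (A i l)"
  have "(sfps fps_X - fps_X) * (tfps (A i j) * sfps (A k l)) - sfps fps_X * fps_X * (tfps (A k j) * sfps (A i l))
      = (sfps fps_X - fps_X) * (sfps (A k l) * tfps (A i j)) - sfps fps_X * fps_X * (sfps (A k j) * tfps (A i l))
    \<longleftrightarrow> (sfps fps_X - fps_X) * ?Z = sfps fps_X * fps_X * ?Z'"
    unfolding right_diff_distrib[of "sfps fps_X - fps_X"] right_diff_distrib[of "sfps fps_X * fps_X"]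
    by (rule diff_eq_swap)
  also have "\<dots> \<longleftrightarrow> (\<forall>r s. fps_nth (fps_nth ?Z (Suc r)) s - fps_nth (fps_nth ?Z r) (Suc s) = fps_nth (fps_nth ?Z' r) s)"
    by (rule RTT_iff_aux)
      (simp_all only: fps_sub_nth nth_tfps_sfps nth_sfps_tfps 0[OF ijkl(1,2)] 0[OF ijkl(3,4)], simp_all)
  finally show "(sfps fps_X - fps_X) * (tfps (A i j) * sfps (A k l)) - sfps fps_X * fps_X * (tfps (A k j) * sfps (A i l))
      = (sfps fps_X - fps_X) * (sfps (A k l) * tfps (A i j)) - sfps fps_X * fps_X * (sfps (A k j) * tfps (A i l))
    \<longleftrightarrow> (\<forall>r s. (fps_nth (A i j) (Suc r) * fps_nth (A k l) s - fps_nth (A k l) s * fps_nth (A i j) (Suc r))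
     - (fps_nth (A i j) r * fps_nth (A k l) (Suc s) - fps_nth (A k l) (Suc s) * fps_nth (A i j) r)
     = fps_nth (A k j) r * fps_nth (A i l) s - fps_nth (A k j) s * fps_nth (A i l) r)"
    by (simp only: fps_sub_nth nth_tfps_sfps nth_sfps_tfps)
qed

lemma RTT_Lop: "RTT n (\<lambda>i j. Abs_fps (Lop \<mu> a i j))"
proof (subst RTT_iff)
  show "fps_nth (Abs_fps (Lop \<mu> a i j)) 0 = (if i = j then 1 else 0)" for i j
    by (simp add: Lop_def)
  have m: "sc x * (Eop a i j * (sc y * Eop a k l)) = sc (x * y) * (Eop a i j * Eop a k l)" for x y i j k l
    by (simp add: sc_simps mult.assoc sc_left[of "Eop a i j"])
  have rel: "Eop a i j * Eop a k l - Eop a k l * Eop a i j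
      = (if j = k then Eop a i l else 0) - (if l = i then Eop a k j else 0)" for i j k l
    by (simp add: eop_eop)
  have "(Lop \<mu> a i j (Suc r) * Lop \<mu> a k l s - Lop \<mu> a k l s * Lop \<mu> a i j (Suc r))
     - (Lop \<mu> a i j r * Lop \<mu> a k l (Suc s) - Lop \<mu> a k l (Suc s) * Lop \<mu> a i j r)
     = Lop \<mu> a k j r * Lop \<mu> a i l s - Lop \<mu> a k j s * Lop \<mu> a i l r" for i j k l r s
  \<comment> \<open>If r and s are both positive, the products depend on the exponents only through
    r + s and cancel in pairs; if both are 0, everything is scalar. The relations of matrix units
    enter when exactly one of them is 0.\<close>
  proof (cases r; cases s)
    fix r' s' assume rs: "r = Suc r'" "s = Suc s'"
    show ?thesis unfolding rs by (simp add: Lop_def m mult.assoc mult.commute mult.left_commute)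
  next
    fix s' assume rs: "r = 0" "s = Suc s'"
    have "sc (\<mu> a ^ s') * (Eop a i j * Eop a k l - Eop a k l * Eop a i j)
       = sc (\<mu> a ^ s') * ((if j = k then Eop a i l else 0) - (if l = i then Eop a k j else 0))"
      unfolding rel ..
    then show ?thesis unfolding rs
      by (simp add: Lop_def sc_left[of "Eop a i j"] right_diff_distrib mult.assoc sc_simps)
  next
    fix r' assume rs: "r = Suc r'" "s = 0"
    have "sc (\<mu> a ^ r') * (Eop a i j * Eop a k l - Eop a k l * Eop a i j)
       = sc (\<mu> a ^ r') * ((if j = k then Eop a i l else 0) - (if l = i then Eop a k j else 0))"
      unfolding rel ..
    then show ?thesis unfolding rs
      by (simp add: Lop_def sc_left[of "Eop a k l"] right_diff_distrib mult.assoc sc_simps)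
  qed (simp add: Lop_def sc_simps)
  then show "\<forall>i\<in>{1..n}. \<forall>j\<in>{1..n}. \<forall>k\<in>{1..n}. \<forall>l\<in>{1..n}. \<forall>r s.
     (fps_nth (Abs_fps (Lop \<mu> a i j)) (Suc r) * fps_nth (Abs_fps (Lop \<mu> a k l)) s
       - fps_nth (Abs_fps (Lop \<mu> a k l)) s * fps_nth (Abs_fps (Lop \<mu> a i j)) (Suc r))
     - (fps_nth (Abs_fps (Lop \<mu> a i j)) r * fps_nth (Abs_fps (Lop \<mu> a k l)) (Suc s)
       - fps_nth (Abs_fps (Lop \<mu> a k l)) (Suc s) * fps_nth (Abs_fps (Lop \<mu> a i j)) r)
     = fps_nth (Abs_fps (Lop \<mu> a k j)) r * fps_nth (Abs_fps (Lop \<mu> a i l)) s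
       - fps_nth (Abs_fps (Lop \<mu> a k j)) s * fps_nth (Abs_fps (Lop \<mu> a i l)) r"
    by simp
qed

lemma RTT_Top: "distinct c \<Longrightarrow> RTT n (\<lambda>i j. Abs_fps (Top n \<mu> c i j))"
proof (induction c)
  case Nil
  have "RTT n (\<lambda>i j. if i = j then 1 else 0 :: xvar set linop fps)"
    by (subst RTT_iff) (auto simp: fps_one_nth)
  moreover have "Abs_fps (Top n \<mu> [] i j) = (if i = j then 1 else 0)" for i j
    by (rule fps_ext) simp
  ultimately show ?case by (simp only:)
next
  case (Cons a c)
  have "Abs_fps (Top n \<mu> (a # c) i j) = (\<Sum>k\<in>{1..n}. Abs_fps (Lop \<mu> a i k) * Abs_fps (Top n \<mu> c k j))" for i j
    by (rule fps_ext) (simp add: fps_sum_nth fps_mult_nth atLeast0AtMost)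
  moreover have "RTT n (\<lambda>i j. \<Sum>k\<in>{1..n}. Abs_fps (Lop \<mu> a i k) * Abs_fps (Top n \<mu> c k j))"
  proof (rule RTT_mult[OF RTT_Lop])
    show "RTT n (\<lambda>i j. Abs_fps (Top n \<mu> c i j))" using Cons by simp
    fix i j k l r s
    have "Lop \<mu> a i j r * Top n \<mu> c k l s = Top n \<mu> c k l s * Lop \<mu> a i j r"
    proof (rule Top_commute)
      fix b x y assume "b \<in> set c"
      then have "Eop a i j * Eop b x y = Eop b x y * Eop a i j"
        using Cons.prems by (intro Eop_commute) auto
      then show "Lop \<mu> a i j r * Eop b x y = Eop b x y * Lop \<mu> a i j r"
        by (simp add: Lop_def mult.assoc sc_left[of "Eop b x y"])
    qed
    then show "fps_nth (Abs_fps (Lop \<mu> a i j)) r * fps_nth (Abs_fps (Top n \<mu> c k l)) s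
      = fps_nth (Abs_fps (Top n \<mu> c k l)) s * fps_nth (Abs_fps (Lop \<mu> a i j)) r" by simp
  qed
  ultimately show ?case by (simp only:)
qed

lemma Top_relation:
  assumes "distinct c" "i \<in> {1..n}" "j \<in> {1..n}" "k \<in> {1..n}" "l \<in> {1..n}"
  shows "(Top n \<mu> c i j (Suc r) * Top n \<mu> c k l s - Top n \<mu> c k l s * Top n \<mu> c i j (Suc r))
     - (Top n \<mu> c i j r * Top n \<mu> c k l (Suc s) - Top n \<mu> c k l (Suc s) * Top n \<mu> c i j r)
     = Top n \<mu> c k j r * Top n \<mu> c i l s - Top n \<mu> c k j s * Top n \<mu> c i l r"
proof -
  have 0: "fps_nth (Abs_fps (Top n \<mu> c i j)) 0 = (if i = j then 1 else 0)" if "i \<in> {1..n}" for i j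
    using Top_0[OF that] by simp
  show ?thesis
    using RTT_Top[OF assms(1), of n \<mu>] assms(2-5) by (subst (asm) RTT_iff[OF 0]) auto
qed

section \<open>Modules over the Yangian\<close>

definition wact :: "'b yops \<Rightarrow> ygen list \<Rightarrow> ('b \<Rightarrow>\<^sub>0 complex) \<Rightarrow> ('b \<Rightarrow>\<^sub>0 complex)" where
  "wact T ls v = foldr (\<lambda>(i, j, r). T i j r) ls v"

lemma wact_simps [simp]: "wact T [] v = v" "wact T ((i, j, r) # ls) v = T i j r (wact T ls v)"
  by (simp_all add: wact_def)

lemma wact_append: "wact T (ls @ ls') v = wact T ls (wact T ls' v)"
  by (simp add: wact_def)

lemma free_act_eq: "free_act T f v = lin_ext (\<lambda>w. wact T (letters w) v) f"
  by (simp add: free_act_def wact_def)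

lemma free_act_add: "free_act T (f + g) v = free_act T f v + free_act T g v"
  and free_act_zero: "free_act T 0 v = 0"
  and free_act_single: "free_act T (Poly_Mapping.single w c) v = cscale c (wact T (letters w) v)"
  by (simp_all add: free_act_eq lin_ext_add)

lemma free_act_minus: "free_act T (- f) v = - free_act T f v"
  and free_act_diff: "free_act T (f - g) v = free_act T f v - free_act T g v"
  by (simp_all add: free_act_eq clinear_minus[OF clinear_lin_ext] clinear_diff[OF clinear_lin_ext])

lemma free_act_sum: "free_act T (sum g S) v = (\<Sum>x\<in>S. free_act T (g x) v)"
  by (simp add: free_act_eq clinear_sum[OF clinear_lin_ext])

lemma clinear_wact:
  assumes "\<And>i j r. (i, j, r) \<in> ygens n \<Longrightarrow> clinear (T i j r)" "set ls \<subseteq> ygens n"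
  shows "clinear (wact T ls)"
  using assms(2)
proof (induction ls)
  case (Cons x ls)
  obtain i j r where x: "x = (i, j, r)" by (cases x)
  have "clinear (T i j r)" by (rule assms(1)) (use Cons.prems x in auto)
  moreover have "clinear (wact T ls)" using Cons by simp
  ultimately show ?case unfolding x by (simp add: clinear_def)
qed (simp add: clinear_def)

lemma poly_mapping_sum_single: "f = (\<Sum>w\<in>Poly_Mapping.keys f. Poly_Mapping.single w (Poly_Mapping.lookup f w))"
  for f :: "'a \<Rightarrow>\<^sub>0 complex"
  using lin_ext_bvec[of f] by (simp add: lin_ext_def)

text \<open>The words of \<open>f\<close> are applied to the linear combination
  \<open>free_act T g v\<close>; membership of \<open>f\<close> in the carrier ensures that their
  letters act linearly.\<close>

lemma free_act_mult:
  assumes "\<And>i j r. (i, j, r) \<in> ygens n \<Longrightarrow> clinear (T i j r)" "f \<in> carrier (yfree n)"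
  shows "free_act T (f * g) v = free_act T f (free_act T g v)"
proof -
  have "f * g = (\<Sum>w\<in>Poly_Mapping.keys f. Poly_Mapping.single w (Poly_Mapping.lookup f w)) *
      (\<Sum>w\<in>Poly_Mapping.keys g. Poly_Mapping.single w (Poly_Mapping.lookup g w))"
    by (simp only: poly_mapping_sum_single[symmetric])
  also have "\<dots> = (\<Sum>w\<in>Poly_Mapping.keys f. \<Sum>w'\<in>Poly_Mapping.keys g.
      Poly_Mapping.single (w + w') (Poly_Mapping.lookup f w * Poly_Mapping.lookup g w'))"
    by (simp only: sum_product mult_single)
  finally have "free_act T (f * g) v = (\<Sum>w\<in>Poly_Mapping.keys f. \<Sum>w'\<in>Poly_Mapping.keys g.
      cscale (Poly_Mapping.lookup f w * Poly_Mapping.lookup g w') (wact T (letters w) (wact T (letters w') v)))"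
    by (simp add: free_act_sum free_act_single plus_fword_def wact_append)
  also have "\<dots> = (\<Sum>w\<in>Poly_Mapping.keys f. cscale (Poly_Mapping.lookup f w) (wact T (letters w) (free_act T g v)))"
  proof (rule sum.cong[OF refl])
    fix w assume "w \<in> Poly_Mapping.keys f"
    then have "clinear (wact T (letters w))"
      using assms by (intro clinear_wact) (auto simp: yfree_def)
    then have "wact T (letters w) (free_act T g v)
       = (\<Sum>w'\<in>Poly_Mapping.keys g. cscale (Poly_Mapping.lookup g w') (wact T (letters w) (wact T (letters w') v)))"
      by (simp add: free_act_eq lin_ext_def clinear_sum clinear_cscale)
    then show "(\<Sum>w'\<in>Poly_Mapping.keys g.
      cscale (Poly_Mapping.lookup f w * Poly_Mapping.lookup g w') (wact T (letters w) (wact T (letters w') v)))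
      = cscale (Poly_Mapping.lookup f w) (wact T (letters w) (free_act T g v))"
      by (simp add: cvec.scale_sum_right)
  qed
  also have "\<dots> = free_act T f (free_act T g v)"
    by (simp add: free_act_eq[of T f] lin_ext_def)
  finally show ?thesis .
qed

lemma yfree_simps:
  "f \<in> carrier (yfree n) \<longleftrightarrow> (\<forall>w\<in>Poly_Mapping.keys f. set (letters w) \<subseteq> ygens n)"
  "f \<otimes>\<^bsub>yfree n\<^esub> g = f * g" "\<one>\<^bsub>yfree n\<^esub> = 1" "\<zero>\<^bsub>yfree n\<^esub> = 0" "f \<oplus>\<^bsub>yfree n\<^esub> g = f + g"
  by (simp_all add: yfree_def)

lemma yfree_add_closed: "f \<in> carrier (yfree n) \<Longrightarrow> g \<in> carrier (yfree n) \<Longrightarrow> f + g \<in> carrier (yfree n)"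
  using keys_add[of f g] unfolding yfree_simps by blast

lemma yfree_minus_closed: "f \<in> carrier (yfree n) \<Longrightarrow> - f \<in> carrier (yfree n)"
  unfolding yfree_simps by simp

lemma yfree_diff_closed: "f \<in> carrier (yfree n) \<Longrightarrow> g \<in> carrier (yfree n) \<Longrightarrow> f - g \<in> carrier (yfree n)"
  using yfree_add_closed[of f n "- g"] yfree_minus_closed by simp

lemma yfree_mult_closed:
  assumes "f \<in> carrier (yfree n)" "g \<in> carrier (yfree n)"
  shows "f * g \<in> carrier (yfree n)"
  unfolding yfree_simps
proof
  fix w assume "w \<in> Poly_Mapping.keys (f * g)"
  then obtain a b where "w = a + b" "a \<in> Poly_Mapping.keys f" "b \<in> Poly_Mapping.keys g"
    using keys_mult[of f g] by blast
  then show "set (letters w) \<subseteq> ygens n"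
    using assms by (auto simp: yfree_simps plus_fword_def)
qed

lemma ring_yfree: "ring (yfree n)"
proof (rule ringI)
  show "abelian_group (yfree n)"
  proof (rule abelian_groupI)
    fix x assume "x \<in> carrier (yfree n)"
    then show "\<exists>y\<in>carrier (yfree n). y \<oplus>\<^bsub>yfree n\<^esub> x = \<zero>\<^bsub>yfree n\<^esub>"
      using yfree_minus_closed[of x n] by (intro bexI[of _ "- x"]) (simp_all add: yfree_simps(4,5))
  qed (simp_all add: yfree_simps(4,5) yfree_add_closed add_ac, simp add: yfree_simps(1))
  show "Group.monoid (yfree n)"
    by (rule Group.monoidI) (simp_all add: yfree_simps(2,3) yfree_mult_closed mult.assoc, simp add: yfree_simps(1) zero_fword_def)
qed (simp_all add: yfree_simps(2,5) algebra_simps)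

lemma ycoeff_carrier: "i \<in> {1..n} \<Longrightarrow> j \<in> {1..n} \<Longrightarrow> ycoeff i j r \<in> carrier (yfree n)"
  by (auto simp: ycoeff_def yfree_simps ygens_def zero_fword_def)

lemma yrels_carrier: "yrels n \<subseteq> carrier (yfree n)"
  unfolding yrels_def
  by (auto intro!: yfree_diff_closed yfree_mult_closed ycoeff_carrier simp del: atLeastAtMost_iff)

lemma yangian_carrierE:
  assumes "y \<in> carrier (yangian n)"
  obtains f where "f \<in> carrier (yfree n)" "y = Idl\<^bsub>yfree n\<^esub> (yrels n) +>\<^bsub>yfree n\<^esub> f"
  using assms by (auto simp: yangian_def FactRing_def A_RCOSETS_def')

lemma yangian_carrierI:
  "f \<in> carrier (yfree n) \<Longrightarrow> Idl\<^bsub>yfree n\<^esub> (yrels n) +>\<^bsub>yfree n\<^esub> f \<in> carrier (yangian n)"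
  by (auto simp: yangian_def FactRing_def A_RCOSETS_def')

text \<open>The index r = 0 belongs to no generator, but the relations involve T^(0) = \<delta>;
  inserting it here lets them be written uniformly.\<close>

definition coeff_act :: "'b yops \<Rightarrow> 'b yops" where
  "coeff_act T i j r v = (if r = 0 then (if i = j then v else 0) else T i j r v)"

lemma free_act_ycoeff: "free_act T (ycoeff i j r) v = coeff_act T i j r v"
proof -
  have one: "(1 :: ygen fword \<Rightarrow>\<^sub>0 complex) = Poly_Mapping.single (FWord []) 1"
    by (simp add: single_one flip: zero_fword_def)
  show ?thesis
    by (auto simp: ycoeff_def coeff_act_def one free_act_single free_act_zero)
qed

text \<open>The relations are demanded on \<open>V\<close> only, since the basis type also has
  labels without meaning, such as infinite sets or lists of the wrong length.\<close>

locale yangian_module =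
  fixes n :: nat and T :: "'b yops" and V :: "('b \<Rightarrow>\<^sub>0 complex) set"
  assumes linear: "\<And>i j r. (i, j, r) \<in> ygens n \<Longrightarrow> clinear (T i j r)"
    and subspace: "cvec.subspace V"
    and closed: "\<And>i j r v. (i, j, r) \<in> ygens n \<Longrightarrow> v \<in> V \<Longrightarrow> T i j r v \<in> V"
    and relation: "\<And>i j k l r s v. i \<in> {1..n} \<Longrightarrow> j \<in> {1..n} \<Longrightarrow> k \<in> {1..n} \<Longrightarrow> l \<in> {1..n} \<Longrightarrow> v \<in> V \<Longrightarrow>
      (coeff_act T i j (Suc r) (coeff_act T k l s v) - coeff_act T k l s (coeff_act T i j (Suc r) v))
      - (coeff_act T i j r (coeff_act T k l (Suc s) v) - coeff_act T k l (Suc s) (coeff_act T i j r v))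
      = coeff_act T k j r (coeff_act T i l s v) - coeff_act T k j s (coeff_act T i l r v)"
begin

lemma wact_closed:
  assumes "cvec.subspace W" "W \<subseteq> V" "\<And>i j r w. (i, j, r) \<in> ygens n \<Longrightarrow> w \<in> W \<Longrightarrow> T i j r w \<in> W"
    "set ls \<subseteq> ygens n" "w \<in> W"
  shows "wact T ls w \<in> W"
  using assms(4)
proof (induction ls)
  case (Cons x ls)
  obtain i j r where "x = (i, j, r)" by (cases x)
  then show ?case using Cons assms(3)[of i j r "wact T ls w"] by simp
qed (use assms in simp)

lemma free_act_closed:
  assumes "cvec.subspace W" "W \<subseteq> V" "\<And>i j r w. (i, j, r) \<in> ygens n \<Longrightarrow> w \<in> W \<Longrightarrow> T i j r w \<in> W"
    "f \<in> carrier (yfree n)" "w \<in> W"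
  shows "free_act T f w \<in> W"
  unfolding free_act_eq lin_ext_def
  using assms(4) wact_closed[OF assms(1-3) _ assms(5)]
  by (intro cvec.subspace_sum[OF assms(1)] cvec.subspace_scale[OF assms(1)]) (auto simp: yfree_simps)

text \<open>The elements acting by zero on \<open>V\<close> form a two-sided ideal containing the
  relations; for multiplication on the right this uses that \<open>V\<close> is stable.\<close>

lemma ideal_acts_zero:
  assumes "f \<in> Idl\<^bsub>yfree n\<^esub> (yrels n)" "v \<in> V"
  shows "free_act T f v = 0"
proof -
  let ?K = "{f \<in> carrier (yfree n). \<forall>v\<in>V. free_act T f v = 0}"
  have fm: "free_act T (f * g) v = free_act T f (free_act T g v)" if "f \<in> carrier (yfree n)" for f g v
    by (rule free_act_mult[OF _ that]) (rule linear)
  have V: "free_act T f w \<in> V" if "f \<in> carrier (yfree n)" "w \<in> V" for f w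
    by (rule free_act_closed[OF subspace order_refl _ that]) (rule closed)
  have z: "free_act T f 0 = 0" if "f \<in> carrier (yfree n)" for f
  proof -
    have "wact T (letters w) 0 = 0" if "w \<in> Poly_Mapping.keys f" for w
      using that \<open>f \<in> carrier (yfree n)\<close> by (intro clinear_zero clinear_wact[OF linear]) (auto simp: yfree_simps)
    then show ?thesis by (simp add: free_act_eq lin_ext_def)
  qed
  have "ideal ?K (yfree n)"
  proof (rule idealI[OF ring_yfree])
    interpret ring "yfree n" by (rule ring_yfree)
    show "subgroup ?K (add_monoid (yfree n))"
    proof (rule group.subgroupI)
      show "group (add_monoid (yfree n))" by (rule a_group)
      show "?K \<noteq> {}" using zero_closed by (auto simp: yfree_simps(4) free_act_zero)
      fix a assume a: "a \<in> ?K"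
      have "- a \<oplus>\<^bsub>yfree n\<^esub> a = \<zero>\<^bsub>yfree n\<^esub>" by (simp add: yfree_simps(4,5))
      then have "inv\<^bsub>add_monoid (yfree n)\<^esub> a = - a"
        using a yfree_minus_closed[of a n]
        by (metis (no_types, lifting) a_inv_def minus_equality mem_Collect_eq)
      then show "inv\<^bsub>add_monoid (yfree n)\<^esub> a \<in> ?K"
        using a yfree_minus_closed[of a n] by (simp add: free_act_minus)
      fix b assume "b \<in> ?K"
      then show "a \<otimes>\<^bsub>add_monoid (yfree n)\<^esub> b \<in> ?K"
        using a by (simp add: yfree_simps(5) yfree_add_closed free_act_add)
    qed auto
    fix a x assume a: "a \<in> ?K" and x: "x \<in> carrier (yfree n)"
    from a have ac: "a \<in> carrier (yfree n)" and a0: "\<And>v. v \<in> V \<Longrightarrow> free_act T a v = 0" by auto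
    have xa: "free_act T (x * a) v = 0" if "v \<in> V" for v
      using fm[OF x] a0[OF that] z[OF x] by simp
    show "x \<otimes>\<^bsub>yfree n\<^esub> a \<in> ?K"
      unfolding yfree_simps(2) by (intro CollectI conjI ballI xa yfree_mult_closed[OF x ac])
    have ax: "free_act T (a * x) v = 0" if "v \<in> V" for v
      using fm[OF ac] a0[OF V[OF x that]] by simp
    show "a \<otimes>\<^bsub>yfree n\<^esub> x \<in> ?K"
      unfolding yfree_simps(2) by (intro CollectI conjI ballI ax yfree_mult_closed[OF ac x])
  qed
  moreover have "yrels n \<subseteq> ?K"
  proof
    fix f assume f: "f \<in> yrels n"
    then obtain i j k l r s where ijkl: "i \<in> {1..n}" "j \<in> {1..n}" "k \<in> {1..n}" "l \<in> {1..n}"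
      and eq: "f = (ycoeff i j (r+1) * ycoeff k l s - ycoeff k l s * ycoeff i j (r+1))
      - (ycoeff i j r * ycoeff k l (s+1) - ycoeff k l (s+1) * ycoeff i j r)
      - (ycoeff k j r * ycoeff i l s - ycoeff k j s * ycoeff i l r)"
      unfolding yrels_def by blast
    have "free_act T f v = 0" if "v \<in> V" for v
    proof -
      have m: "free_act T (ycoeff a b p * g) v = coeff_act T a b p (free_act T g v)"
        if "a \<in> {1..n}" "b \<in> {1..n}" for a b p g
        using fm[OF ycoeff_carrier[OF that]] by (simp only: free_act_ycoeff)
      show ?thesis
        using relation[OF ijkl that, of r s]
        unfolding eq free_act_diff by (simp only: m ijkl free_act_ycoeff Suc_eq_plus1 right_minus_eq)
    qed
    then show "f \<in> ?K" using f yrels_carrier by blast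
  qed
  ultimately have "Idl\<^bsub>yfree n\<^esub> (yrels n) \<subseteq> ?K"
    by (rule ring.genideal_minimal[OF ring_yfree])
  then show ?thesis using assms by blast
qed

text \<open>By \<open>ideal_acts_zero\<close> the image in the definition of
  \<open>yangian_act\<close> is a singleton, so \<open>the_elem\<close> has a definite
  value.\<close>

lemma yangian_act_coset:
  assumes "f \<in> carrier (yfree n)" "v \<in> V"
  shows "yangian_act T (Idl\<^bsub>yfree n\<^esub> (yrels n) +>\<^bsub>yfree n\<^esub> f) v = free_act T f v"
proof -
  let ?y = "Idl\<^bsub>yfree n\<^esub> (yrels n) +>\<^bsub>yfree n\<^esub> f"
  interpret I: ideal "Idl\<^bsub>yfree n\<^esub> (yrels n)" "yfree n"
    by (rule ring.genideal_ideal[OF ring_yfree yrels_carrier])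
  have "f \<in> ?y" by (rule I.a_rcos_self[OF assms(1)])
  moreover have "free_act T g v = free_act T f v" if "g \<in> ?y" for g
    using that ideal_acts_zero[OF _ assms(2)]
    by (auto simp: a_r_coset_def' yfree_simps(5) free_act_add)
  ultimately have "(\<lambda>g. free_act T g v) ` ?y = {free_act T f v}"
    by (intro subset_antisym subsetI) (blast, metis image_eqI singletonD)
  then show ?thesis by (simp only: yangian_act_def the_elem_eq)
qed

lemma yangian_stable_iff:
  assumes "cvec.subspace W" "W \<subseteq> V"
  shows "yangian_stable n T W \<longleftrightarrow> (\<forall>i j r. (i, j, r) \<in> ygens n \<longrightarrow> (\<forall>w\<in>W. T i j r w \<in> W))"
proof
  assume W: "yangian_stable n T W"
  show "\<forall>i j r. (i, j, r) \<in> ygens n \<longrightarrow> (\<forall>w\<in>W. T i j r w \<in> W)"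
  proof (intro allI impI ballI)
    fix i j r w assume g: "(i, j, r) \<in> ygens n" and w: "w \<in> W"
    let ?f = "ycoeff i j r"
    have f: "?f \<in> carrier (yfree n)" using g by (intro ycoeff_carrier) (auto simp: ygens_def)
    have "r \<noteq> 0" using g by (auto simp: ygens_def)
    then have "T i j r w = yangian_act T (Idl\<^bsub>yfree n\<^esub> (yrels n) +>\<^bsub>yfree n\<^esub> ?f) w"
      using w assms by (subst yangian_act_coset[OF f]) (auto simp: free_act_ycoeff coeff_act_def)
    also have "\<dots> \<in> W"
      using W w yangian_carrierI[OF f] by (auto simp: yangian_stable_def)
    finally show "T i j r w \<in> W" .
  qed
next
  assume W: "\<forall>i j r. (i, j, r) \<in> ygens n \<longrightarrow> (\<forall>w\<in>W. T i j r w \<in> W)"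
  show "yangian_stable n T W"
    unfolding yangian_stable_def
  proof (intro ballI)
    fix y w assume y: "y \<in> carrier (yangian n)" and w: "w \<in> W"
    obtain f where f: "f \<in> carrier (yfree n)" "y = Idl\<^bsub>yfree n\<^esub> (yrels n) +>\<^bsub>yfree n\<^esub> f"
      using y by (rule yangian_carrierE)
    have "free_act T f w \<in> W"
      by (rule free_act_closed[OF assms _ f(1) w]) (use W in blast)
    then show "yangian_act T y w \<in> W"
      using w assms unfolding f(2) by (subst yangian_act_coset[OF f(1)]) auto
  qed
qed

end

text \<open>A coset acts on both sides by the same linear combination of words, so generators
  suffice. Linearity of \<open>I\<close> is known on V only, which is why the partial sums are kept
  in V.\<close>

lemma yangian_act_intertwine:
  assumes "yangian_module n T V" "yangian_module n T' V'" "linear_between V V' I"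
    and I: "\<And>i j r v. (i, j, r) \<in> ygens n \<Longrightarrow> v \<in> V \<Longrightarrow> I (T i j r v) = T' i j r (I v)"
    and y: "y \<in> carrier (yangian n)" and v: "v \<in> V"
  shows "I (yangian_act T y v) = yangian_act T' y (I v)"
proof -
  interpret M: yangian_module n T V by fact
  interpret M': yangian_module n T' V' by fact
  obtain f where f: "f \<in> carrier (yfree n)" "y = Idl\<^bsub>yfree n\<^esub> (yrels n) +>\<^bsub>yfree n\<^esub> f"
    using y by (rule yangian_carrierE)
  have wV: "wact T ls v \<in> V" if "set ls \<subseteq> ygens n" for ls
    by (rule M.wact_closed[OF M.subspace order_refl _ that v]) (rule M.closed)
  have w: "I (wact T ls v) = wact T' ls (I v)" if "set ls \<subseteq> ygens n" for ls
    using that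
  proof (induction ls)
    case (Cons x ls)
    obtain i j r where "x = (i, j, r)" by (cases x)
    then show ?case using Cons I[of i j r "wact T ls v"] wV[of ls] by simp
  qed simp
  have sum: "I (\<Sum>w\<in>S. cscale (c w) (g w)) = (\<Sum>w\<in>S. cscale (c w) (I (g w)))"
    if "finite S" "\<And>w. w \<in> S \<Longrightarrow> g w \<in> V" for c g and S :: "ygen fword set"
    using that
  proof (induction S)
    case empty
    have "I (cscale 0 v) = cscale 0 (I v)" using assms(3) v unfolding linear_between_def by blast
    then show ?case by simp
  next
    case (insert x S)
    have "(\<Sum>w\<in>S. cscale (c w) (g w)) \<in> V"
      using insert.prems by (intro cvec.subspace_sum[OF M.subspace] cvec.subspace_scale[OF M.subspace]) auto
    moreover have "cscale (c x) (g x) \<in> V" "g x \<in> V"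
      using insert.prems by (auto intro: cvec.subspace_scale[OF M.subspace])
    ultimately show ?case
      using insert assms(3) unfolding linear_between_def by simp
  qed
  have "I (free_act T f v) = free_act T' f (I v)"
    unfolding free_act_eq lin_ext_def
    using f(1) by (subst sum) (auto intro!: wV sum.cong simp: w yfree_simps)
  moreover have "I v \<in> V'" using assms(3) v by (auto simp: linear_between_def)
  ultimately show ?thesis
    unfolding f(2) by (simp add: M.yangian_act_coset[OF f(1) v] M'.yangian_act_coset[OF f(1)])
qed

section \<open>Products of Grassmann variables\<close>

text \<open>Both claims are proved in one induction: multiplication by a variable is identified with
  \<open>cre\<close> on finite monomials, and finiteness comes from the second claim.\<close>

lemma gprod_Cons: "gprod (p # ps) = app (cre p) (gprod ps)"
  and finite_keys_gprod: "A \<in> Poly_Mapping.keys (gprod ps) \<Longrightarrow> A = set ps"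
proof -
  have "(\<forall>A\<in>Poly_Mapping.keys (gprod ps). A = set ps) \<and> (\<forall>p. gprod (p # ps) = app (cre p) (gprod ps))" for ps :: "'p::linorder list"
  proof (induction ps)
    case Nil
    have "gprod [p] = app (cre p) (gprod [])" for p :: 'p
      unfolding gprod_def foldr.simps comp_def id_def by (rule gvar_gmult) simp
    then show ?case by (simp add: gprod_def)
  next
    case (Cons q ps)
    have 1: "A = set (q # ps)" if A: "A \<in> Poly_Mapping.keys (gprod (q # ps))" for A
    proof -
      have "A \<in> Poly_Mapping.keys (app (cre q) (gprod ps))" using A Cons by simp
      then obtain B where "B \<in> Poly_Mapping.keys (gprod ps)" "A \<in> Poly_Mapping.keys (app (cre q) (bvec B))"
        by (rule clinear_keys[OF clinear_app])
      then show ?thesis using Cons by (auto simp: cre_single split: if_splits)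
    qed
    have "gprod (p # q # ps) = gmult (gvar p) (gprod (q # ps))" for p by (simp add: gprod_def)
    also have "\<dots> p = app (cre p) (gprod (q # ps))" for p
      by (rule gvar_gmult) (use 1 in auto)
    finally show ?case using 1 by blast
  qed
  then show "gprod (p # ps) = app (cre p) (gprod ps)" "A \<in> Poly_Mapping.keys (gprod ps) \<Longrightarrow> A = set ps"
    by blast+
qed

lemma gprod_Nil: "gprod [] = bvec {}"
  by (simp add: gprod_def)

lemma gprod_sorted: "sorted_wrt (<) ps \<Longrightarrow> gprod ps = bvec (set ps)"
proof (induction ps)
  case (Cons p ps)
  then have e: "{q \<in> set ps. q < p} = {}" by force
  have "psign p (set ps) = 1" unfolding psign_def e by simp
  moreover have "p \<notin> set ps" using Cons.prems by auto
  ultimately show ?case using Cons by (simp add: gprod_Cons cre_single)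
qed (simp add: gprod_Nil)

lemma gprod_sorted_list_of_set: "finite A \<Longrightarrow> gprod (sorted_list_of_set A) = bvec A"
  by (simp add: gprod_sorted)

text \<open>\<open>eop i j\<close> is a derivation, replacing j by i at one position at a time. This
  is the formula defining \<open>gl_act\<close>, so the two actions of matrix units agree.\<close>

lemma eop_gprod: "app (eop i j) (gprod ps) = (\<Sum>k<length ps. if ps ! k = j then gprod (ps[k := i]) else 0)"
proof (induction ps)
  case (Cons p ps)
  have "app (eop i j) (gprod (p # ps)) = app (cre p) (app (eop i j) (gprod ps)) + (if j = p then gprod (i # ps) else 0)"
    using arg_cong[OF eop_cre[of i j p], of "\<lambda>A. app A (gprod ps)"] by (simp add: gprod_Cons)
  also have "app (cre p) (app (eop i j) (gprod ps)) = (\<Sum>k<length ps. if ps ! k = j then gprod (p # ps[k := i]) else 0)"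
    unfolding Cons app_sum by (intro sum.cong) (auto simp: gprod_Cons)
  finally show ?case
    by (simp add: sum.lessThan_Suc_shift add.commute eq_commute[of j p] cong: if_cong del: sum.lessThan_Suc)
qed (simp add: gprod_Nil eop_single)

lemma gl_act_bvec:
  assumes "finite S"
  shows "gl_act i j (bvec S) = app (eop i j) (bvec S)"
  using eop_gprod[of i j "sorted_list_of_set S"] assms
  by (simp add: gl_act_def Let_def gprod_sorted_list_of_set)

lemma cre_gprod_eq_0: "p \<in> set ps \<Longrightarrow> app (cre p) (gprod ps) = 0"
proof (induction ps)
  case (Cons q ps)
  have "app (cre p) (gprod (q # ps)) = - app (cre q) (app (cre p) (gprod ps))"
    using arg_cong[OF cre_cre[of p q], of "\<lambda>A. app A (gprod ps)"] by (simp add: gprod_Cons)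
  moreover have "app (cre q) (app (cre q) (gprod ps)) = 0"
    by (metis app_simps(1,6) cre_cre_self(1))
  ultimately show ?case using Cons by auto
qed simp

section \<open>Renaming of variables\<close>

definition ren :: "('p::linorder \<Rightarrow> 'p) \<Rightarrow> 'p set linop" where
  "ren \<phi> = lop (\<lambda>A. if finite A then gprod (map \<phi> (sorted_list_of_set A)) else 0)"

lemma gsubst_eq_ren:
  assumes "\<And>A. A \<in> Poly_Mapping.keys v \<Longrightarrow> finite A"
  shows "gsubst \<phi> v = app (ren \<phi>) v"
  unfolding gsubst_def ren_def app_lop
  by (rule clinear_eqI_keys) (use assms in auto)

lemma gprod_map_insort:
  assumes "sorted_wrt (<) ps" "p \<notin> set ps"
  shows "gprod (map \<phi> (insort p ps)) = cscale (psign p (set ps)) (gprod (\<phi> p # map \<phi> ps))"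
  using assms
proof (induction ps)
  case (Cons q ps)
  show ?case
  proof (cases "p < q")
    case True
    then have e: "{r \<in> set (q # ps). r < p} = {}" using Cons.prems by force
    have "psign p (set (q # ps)) = 1" unfolding psign_def e by simp
    then show ?thesis using True less_imp_le[OF True] by simp
  next
    case False
    then have "q < p" using Cons.prems by auto
    have "q \<notin> set ps" using Cons.prems by auto
    then have s: "psign p (set (q # ps)) = - psign p (set ps)"
      using \<open>q < p\<close> by (simp add: psign_insert)
    have "gprod (map \<phi> (insort p (q # ps))) = app (cre (\<phi> q)) (cscale (psign p (set ps)) (app (cre (\<phi> p)) (gprod (map \<phi> ps))))"
      using Cons False \<open>q < p\<close> by (simp add: gprod_Cons)
    also have "\<dots> = cscale (psign p (set ps)) (app (cre (\<phi> q) * cre (\<phi> p)) (gprod (map \<phi> ps)))"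
      by (simp add: app_cscale)
    also have "cre (\<phi> q) * cre (\<phi> p) = - (cre (\<phi> p) * cre (\<phi> q))" by (rule cre_cre)
    finally show ?thesis unfolding s by (simp add: gprod_Cons cscale_minus)
  qed
qed (simp add: psign_def)

text \<open>Sorting p into the list costs the sign that \<open>cre p\<close> carries as well, and
  the two cancel. If p is already present, both sides vanish, the right one because of a repeated
  factor.\<close>

lemma ren_cre: "ren \<phi> * cre p = cre (\<phi> p) * ren \<phi>"
proof (rule linop_eqI_bvec)
  fix A :: "'a set"
  let ?l = "sorted_list_of_set A"
  show "app (ren \<phi> * cre p) (bvec A) = app (cre (\<phi> p) * ren \<phi>) (bvec A)"
  proof (cases "finite A")
    case fin: True
    have R: "app (cre (\<phi> p) * ren \<phi>) (bvec A) = app (cre (\<phi> p)) (gprod (map \<phi> ?l))"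
      using fin by (simp add: ren_def)
    show ?thesis
    proof (cases "p \<in> A")
      case True
      then have "app (cre (\<phi> p)) (gprod (map \<phi> ?l)) = 0" using fin by (intro cre_gprod_eq_0) auto
      then show ?thesis unfolding R using True by (simp add: cre_single)
    next
      case False
      have "sorted_list_of_set (insert p A) = insort p ?l"
        using sorted_list_of_set_insert[OF fin False] .
      moreover have "gprod (map \<phi> (insort p ?l)) = cscale (psign p A) (gprod (\<phi> p # map \<phi> ?l))"
        using gprod_map_insort[of ?l p \<phi>] False fin by simp
      ultimately have "app (ren \<phi> * cre p) (bvec A) = cscale (psign p A * psign p A) (app (cre (\<phi> p)) (gprod (map \<phi> ?l)))"
        using False fin by (simp add: cre_single ren_def gprod_Cons del: psign_square)
      then show ?thesis unfolding R by simp
    qed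
  qed (simp add: cre_single ren_def)
qed

lemma ren_gprod: "app (ren \<phi>) (gprod ps) = gprod (map \<phi> ps)"
proof (induction ps)
  case (Cons p ps)
  then show ?case
    using arg_cong[OF ren_cre[of \<phi> p], of "\<lambda>A. app A (gprod ps)"] by (simp add: gprod_Cons)
qed (simp add: ren_def gprod_Nil)

lemma finpart_gprod: "app finpart (gprod ps) = gprod ps"
  by (rule finpart_finite) (use finite_keys_gprod in auto)

text \<open>Checked on products of arbitrary lists, to which a factor can be added on the left
  without sorting. Injectivity ensures that the derivation by the image of p contracts only with the
  image of p.\<close>

lemma ren_ann:
  assumes "inj \<phi>"
  shows "ren \<phi> * ann p = ann (\<phi> p) * ren \<phi>"
proof (rule linop_eqI_bvec)
  have *: "app (ren \<phi> * ann p) (gprod ps) = app (ann (\<phi> p) * ren \<phi>) (gprod ps)" for ps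
  proof (induction ps)
    case (Cons q ps)
    have l: "app (ann p) (gprod (q # ps)) = (if p = q then gprod ps else 0) - app (cre q) (app (ann p) (gprod ps))" for p q ps
      using arg_cong[OF ann_cre[of p q], of "\<lambda>A. app A (gprod ps)"] by (simp add: gprod_Cons finpart_gprod)
    have r: "app (ren \<phi>) (app (cre q) v) = app (cre (\<phi> q)) (app (ren \<phi>) v)" for v
      by (metis ren_cre app_simps(6))
    show ?case
      using Cons inj_eq[OF assms, of p q] by (simp add: l app_diff r ren_gprod)
  qed (simp add: ren_def gprod_Nil ann_single)
  fix A
  show "app (ren \<phi> * ann p) (bvec A) = app (ann (\<phi> p) * ren \<phi>) (bvec A)"
  proof (cases "finite A")
    case True
    then show ?thesis using *[of "sorted_list_of_set A"] by (simp add: gprod_sorted_list_of_set)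
  qed (simp add: ann_single ren_def)
qed

lemma ren_eop: "inj \<phi> \<Longrightarrow> ren \<phi> * eop p q = eop (\<phi> p) (\<phi> q) * ren \<phi>"
  unfolding eop_def by (metis mult.assoc ren_cre ren_ann)

lemma ren_ren:
  assumes "\<And>p. \<phi> (\<phi> p) = p"
  shows "ren \<phi> * ren \<phi> = finpart"
proof (rule linop_eqI_bvec)
  fix A
  show "app (ren \<phi> * ren \<phi>) (bvec A) = app finpart (bvec A)"
  proof (cases "finite A")
    case True
    have "app (ren \<phi> * ren \<phi>) (gprod (sorted_list_of_set A)) = gprod (sorted_list_of_set A)"
      by (simp add: ren_gprod assms map_idI comp_def)
    then show ?thesis using True by (simp add: gprod_sorted_list_of_set finpart_single)
  qed (simp add: ren_def finpart_single)
qed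

section \<open>The identification of tensor products with weight spaces\<close>

fun mono_of :: "nat list \<Rightarrow> nat set list \<Rightarrow> xvar set" where
  "mono_of (a # c) (S # Ss) = XV a ` S \<union> mono_of c Ss"
| "mono_of _ _ = {}"

lemma mono_of_finite: "\<forall>S\<in>set Ss. finite S \<Longrightarrow> finite (mono_of c Ss)"
  by (induction c Ss rule: mono_of.induct) auto

lemma mono_of_row: "p \<in> mono_of c Ss \<Longrightarrow> xrow p \<in> set c"
  by (induction c Ss rule: mono_of.induct) auto

lemma gprod_mono_of:
  assumes "sorted_wrt (<) c" "\<forall>S\<in>set Ss. finite S"
  shows "gprod (concat (map2 (\<lambda>a S. map (XV a) (sorted_list_of_set S)) c Ss)) = bvec (mono_of c Ss)"
proof -
  let ?l = "\<lambda>c Ss. concat (map2 (\<lambda>a S. map (XV a) (sorted_list_of_set S)) c Ss)"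
  have "sorted_wrt (<) (?l c Ss) \<and> set (?l c Ss) = mono_of c Ss"
    using assms
  proof (induction c Ss rule: mono_of.induct)
    case (1 a c S Ss)
    have "sorted_wrt (<) (map (XV a) (sorted_list_of_set S))"
      by (simp add: sorted_wrt_map less_xvar_def)
    moreover have "p < q" if "p \<in> XV a ` S" "q \<in> mono_of c Ss" for p q
      using that mono_of_row[of q c Ss] 1(2) by (auto simp: less_xvar_def)
    ultimately show ?case using 1 by (auto simp: sorted_wrt_append)
  qed auto
  then show ?thesis using gprod_sorted by metis
qed

text \<open>Not multiplication by a Grassmann monomial but the union of labels without sign: in a
  tensor product the label of the first factor is simply put in front.\<close>

definition kap :: "xvar set \<Rightarrow> xvar set linop" where
  "kap C = lop (\<lambda>B. bvec (C \<union> B))"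

lemma psign_Un: "finite A \<Longrightarrow> finite B \<Longrightarrow> A \<inter> B = {} \<Longrightarrow> psign p (A \<union> B) = psign p A * psign p B"
proof -
  assume *: "finite A" "finite B" "A \<inter> B = {}"
  have "{q \<in> A \<union> B. q < p} = {q \<in> A. q < p} \<union> {q \<in> B. q < p}" by auto
  then have "card {q \<in> A \<union> B. q < p} = card {q \<in> A. q < p} + card {q \<in> B. q < p}"
    using * by (simp add: card_Un_disjoint disjoint_iff)
  then show ?thesis by (simp add: psign_def power_add)
qed

lemma psign_other_row:
  assumes "\<And>p. p \<in> C \<Longrightarrow> xrow p \<noteq> b"
  shows "psign (XV b i) C = psign (XV b j) C"
proof -
  have "{q \<in> C. q < XV b i} = {q \<in> C. q < XV b j}" using assms by (auto simp: less_xvar_def)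
  then show ?thesis by (simp add: psign_def)
qed

text \<open>The operator removes and inserts a variable of the same row b, and a variable of another
  row lies on the same side of both. So the two signs caused by C are equal and cancel.\<close>

lemma kap_Eop:
  assumes "finite C" "\<And>p. p \<in> C \<Longrightarrow> xrow p \<noteq> b"
  shows "kap C * Eop b i j = Eop b i j * kap C"
proof (rule linop_eqI_bvec)
  fix B
  have nC: "XV b i \<notin> C" "XV b j \<notin> C" using assms(2) by force+
  show "app (kap C * Eop b i j) (bvec B) = app (Eop b i j * kap C) (bvec B)"
  proof (cases "finite B \<and> XV b j \<in> B \<and> XV b i \<notin> B - {XV b j}")
    case True
    have 1: "psign (XV b j) (C \<union> B) = psign (XV b j) (C - B) * psign (XV b j) B"
    proof -
      have "(C - B) \<inter> B = {}" by auto
      then show ?thesis using psign_Un[of "C - B" B "XV b j"] True assms(1) by simp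
    qed
    have 2: "(C \<union> B) - {XV b j} = (C - B) \<union> (B - {XV b j})" using nC by auto
    have 3: "psign (XV b i) ((C \<union> B) - {XV b j}) = psign (XV b i) (C - B) * psign (XV b i) (B - {XV b j})"
      unfolding 2 using True assms(1) by (intro psign_Un) auto
    have 4: "psign (XV b i) (C - B) = psign (XV b j) (C - B)"
      by (rule psign_other_row) (use assms(2) in auto)
    have 5: "insert (XV b i) ((C \<union> B) - {XV b j}) = C \<union> insert (XV b i) (B - {XV b j})" using nC by auto
    have 6: "psign (XV b j) (C \<union> B) * psign (XV b i) ((C \<union> B) - {XV b j}) = psign (XV b j) B * psign (XV b i) (B - {XV b j})"
      unfolding 1 3 4 by (simp add: mult.left_commute mult.assoc)
    have 7: "finite (C \<union> B)" "XV b j \<in> C \<union> B" "XV b i \<notin> (C \<union> B) - {XV b j}" using True assms(1) nC by auto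
    have "app (kap C * Eop b i j) (bvec B) = Poly_Mapping.single (C \<union> insert (XV b i) (B - {XV b j}))
        (psign (XV b j) B * psign (XV b i) (B - {XV b j}))"
      using True by (simp add: eop_single kap_def)
    also have "\<dots> = app (Eop b i j) (bvec (C \<union> B))"
      unfolding eop_single using 7 by (simp only: 5 6 if_True simp_thms mult_1)
    also have "\<dots> = app (Eop b i j * kap C) (bvec B)" by (simp add: kap_def)
    finally show ?thesis .
  next
    case False
    then have "\<not> (finite (C \<union> B) \<and> XV b j \<in> C \<union> B \<and> XV b i \<notin> (C \<union> B) - {XV b j})"
      using nC by auto
    then have "app (Eop b i j) (bvec (C \<union> B)) = 0" unfolding eop_single by (simp only: if_False)
    moreover have "app (Eop b i j) (bvec B) = 0" unfolding eop_single using False by (simp only: if_False)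
    ultimately show ?thesis by (simp add: kap_def)
  qed
qed

definition tau :: "nat \<Rightarrow> xvar set \<Rightarrow> (nat set \<Rightarrow>\<^sub>0 complex) \<Rightarrow> grass" where
  "tau a B = lin_ext (\<lambda>S. bvec (XV a ` S \<union> B))"

lemma psign_image_row: "finite S \<Longrightarrow> psign (XV a k) (XV a ` S) = psign k S"
proof -
  have "{q \<in> XV a ` S. q < XV a k} = XV a ` {s \<in> S. s < k}" by (auto simp: less_xvar_def)
  then have "card {q \<in> XV a ` S. q < XV a k} = card {s \<in> S. s < k}"
    by (simp add: card_image inj_on_def)
  then show ?thesis by (simp add: psign_def)
qed

lemma tau_eop:
  assumes "finite S" "finite B" "\<And>p. p \<in> B \<Longrightarrow> xrow p \<noteq> a"
  shows "tau a B (app (eop i j) (bvec S)) = app (Eop a i j) (bvec (XV a ` S \<union> B))"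
proof -
  have nB: "XV a x \<notin> B" for x using assms(3) by force
  have disj: "XV a ` X \<inter> B = {}" for X using nB by auto
  have mem: "XV a x \<in> XV a ` S \<union> B \<longleftrightarrow> x \<in> S" for x using nB by auto
  have rem: "XV a ` S \<union> B - {XV a j} = XV a ` (S - {j}) \<union> B" using nB by auto
  have "psign (XV a j) (XV a ` S \<union> B) = psign j S * psign (XV a j) B"
    using psign_Un[OF _ _ disj, of S] assms(1,2) by (simp add: psign_image_row)
  moreover have "psign (XV a i) (XV a ` (S - {j}) \<union> B) = psign i (S - {j}) * psign (XV a i) B"
    using psign_Un[OF _ _ disj, of "S - {j}"] assms(1,2) by (simp add: psign_image_row)
  moreover have "psign (XV a i) B = psign (XV a j) B"
    by (rule psign_other_row) (rule assms(3))
  ultimately have sgn: "psign (XV a j) (XV a ` S \<union> B) * psign (XV a i) (XV a ` (S - {j}) \<union> B) = psign j S * psign i (S - {j})"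
    by (simp add: mult.left_commute mult.assoc)
  have mem': "XV a i \<in> XV a ` (S - {j}) \<union> B \<longleftrightarrow> i \<in> S - {j}" using nB by auto
  have ins: "insert (XV a i) (XV a ` (S - {j}) \<union> B) = XV a ` (insert i (S - {j})) \<union> B" by auto
  have fin: "finite (XV a ` S \<union> B)" using assms by simp
  show ?thesis
    unfolding eop_single mem rem mem' ins tau_def mult_1 sgn using fin assms(1) by auto
qed

definition Gm :: "nat list \<Rightarrow> (nat set list \<Rightarrow>\<^sub>0 complex) \<Rightarrow> grass" where
  "Gm c = lin_ext (\<lambda>Ss. bvec (mono_of c Ss))"

lemma clinear_tensor_op: "clinear (tensor_op A B)"
  unfolding tensor_op_def by (rule clinear_lin_ext)

lemma clinear_sum_fun: "(\<And>x. x \<in> S \<Longrightarrow> clinear (f x)) \<Longrightarrow> clinear (\<lambda>v. \<Sum>x\<in>S. f x v)"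
  by (simp add: clinear_def sum.distrib cvec.scale_sum_right)

lemma clinear_tensor_yops: "clinear (tensor_yops n Ts i j r)"
proof (cases Ts)
  case Nil
  then show ?thesis by (auto simp: clinear_def id_def)
next
  case (Cons T Ts')
  then show ?thesis by (auto intro!: clinear_sum_fun clinear_tensor_op)
qed

lemma clinear_Gm: "clinear (Gm c)"
  unfolding Gm_def by (rule clinear_lin_ext)

lemma Gm_bvec: "Gm c (bvec Ss) = bvec (mono_of c Ss)"
  by (simp add: Gm_def)

lemma Gm_tensor: "Gm (a # c) (tensor x y) = lin_ext (\<lambda>S. app (kap (XV a ` S)) (Gm c y)) x"
proof -
  have 1: "Gm (a # c) (lin_ext (\<lambda>t. bvec (S # t)) y) = app (kap (XV a ` S)) (Gm c y)" for S
  proof (rule clinear_eqI_keys[where f = "\<lambda>y. Gm (a # c) (lin_ext (\<lambda>t. bvec (S # t)) y)"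
        and g = "\<lambda>y. app (kap (XV a ` S)) (Gm c y)"])
    show "clinear (\<lambda>y. Gm (a # c) (lin_ext (\<lambda>t. bvec (S # t)) y))"
      by (rule clinear_compose[OF clinear_Gm clinear_lin_ext])
    show "clinear (\<lambda>y. app (kap (XV a ` S)) (Gm c y))"
      by (rule clinear_compose[OF clinear_app clinear_Gm])
  qed (simp add: Gm_bvec kap_def)
  show ?thesis
  proof (rule clinear_eqI_keys[where f = "\<lambda>x. Gm (a # c) (tensor x y)"])
    show "clinear (\<lambda>x. Gm (a # c) (tensor x y))"
      unfolding tensor_def by (rule clinear_compose[OF clinear_Gm clinear_lin_ext])
  qed (simp_all add: tensor_def 1)
qed

lemma finite_gl_act:
  assumes "finite S" "S' \<in> Poly_Mapping.keys (std_yops z i k s (bvec S))"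
  shows "finite S'"
proof -
  have "S' \<in> Poly_Mapping.keys (app (eop i k) (bvec S)) \<or> S' = S"
    using assms keys_cscale_subset[of "z ^ (s - 1)" "gl_act i k (bvec S)"]
    by (auto simp: std_yops_def gl_act_bvec split: if_splits)
  then show ?thesis using assms(1) by (auto simp: eop_single split: if_splits)
qed

text \<open>The first tensor factor acts through \<open>tau_eop\<close>, and the others pass the
  first label by \<open>kap_Eop\<close>; the signs cancel in both because each operator stays in one
  row. The factor of the first row is applied first, hence \<open>Top_Cons_right\<close>.\<close>

lemma Gm_tensor_yops:
  assumes "distinct c" "length Ss = length c" "\<forall>S\<in>set Ss. finite S"
  shows "Gm c (tensor_yops n (map (\<lambda>a. std_yops (\<mu> a)) c) i j r (bvec Ss)) = app (Top n \<mu> c i j r) (bvec (mono_of c Ss))"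
  using assms
proof (induction c arbitrary: Ss i r)
  case Nil
  then show ?case by (simp add: Gm_def)
next
  case (Cons a c)
  then obtain S Ss' where Ss: "Ss = S # Ss'" by (cases Ss) auto
  let ?B = "mono_of c Ss'"
  have fin: "finite S" "finite ?B" using Cons.prems(3) Ss mono_of_finite[of Ss' c] by auto
  have row: "xrow p \<noteq> a" if "p \<in> ?B" for p using mono_of_row[OF that] Cons.prems(1) by auto
  have t: "Gm (a # c) (tensor (std_yops (\<mu> a) i k s (bvec S)) (tensor_yops n (map (\<lambda>a. std_yops (\<mu> a)) c) k j t (bvec Ss')))
     = app (Top n \<mu> c k j t) (app (Lop \<mu> a i k s) (bvec (XV a ` S \<union> ?B)))" for k s t
  proof -
    let ?x = "std_yops (\<mu> a) i k s (bvec S)"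
    have IH: "Gm c (tensor_yops n (map (\<lambda>a. std_yops (\<mu> a)) c) k j t (bvec Ss')) = app (Top n \<mu> c k j t) (bvec ?B)"
      using Cons Ss by simp
    have "Gm (a # c) (tensor ?x (tensor_yops n (map (\<lambda>a. std_yops (\<mu> a)) c) k j t (bvec Ss')))
      = lin_ext (\<lambda>S. app (kap (XV a ` S)) (app (Top n \<mu> c k j t) (bvec ?B))) ?x"
      unfolding Gm_tensor IH ..
    also have "\<dots> = app (Top n \<mu> c k j t) (tau a ?B ?x)"
    proof (rule clinear_eqI_keys[where g = "\<lambda>x. app (Top n \<mu> c k j t) (tau a ?B x)"])
      show "clinear (\<lambda>x. app (Top n \<mu> c k j t) (tau a ?B x))"
        unfolding tau_def by (rule clinear_compose[OF clinear_app clinear_lin_ext])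
      fix S' assume "S' \<in> Poly_Mapping.keys ?x"
      then have "finite S'" by (rule finite_gl_act[OF fin(1)])
      then have "kap (XV a ` S') * Top n \<mu> c k j t = Top n \<mu> c k j t * kap (XV a ` S')"
        using Cons.prems(1) by (intro Top_commute kap_Eop) auto
      then have "app (kap (XV a ` S')) (app (Top n \<mu> c k j t) (bvec ?B)) = app (Top n \<mu> c k j t) (app (kap (XV a ` S')) (bvec ?B))"
        by (metis app_simps(6))
      then show "lin_ext (\<lambda>S. app (kap (XV a ` S)) (app (Top n \<mu> c k j t) (bvec ?B))) (bvec S') = app (Top n \<mu> c k j t) (tau a ?B (bvec S'))"
        by (simp add: kap_def tau_def del: Top.simps)
    qed simp
    also have "tau a ?B ?x = app (Lop \<mu> a i k s) (bvec (XV a ` S \<union> ?B))"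
    proof (cases "s = 0")
      case True
      then show ?thesis by (simp add: std_yops_def Lop_def tau_def)
    next
      case False
      then have "tau a ?B ?x = cscale (\<mu> a ^ (s - 1)) (tau a ?B (app (eop i k) (bvec S)))"
        using fin by (simp add: std_yops_def gl_act_bvec tau_def lin_ext_cscale)
      then show ?thesis using False tau_eop[OF fin row] by (simp add: Lop_def)
    qed
    finally show ?thesis .
  qed
  have G: "clinear (Gm (a # c))" unfolding Gm_def by (rule clinear_lin_ext)
  have "Gm (a # c) (tensor_yops n (map (\<lambda>a. std_yops (\<mu> a)) (a # c)) i j r (bvec Ss))
     = (\<Sum>k\<in>{1..n}. \<Sum>s\<le>r. Gm (a # c) (tensor (std_yops (\<mu> a) i k s (bvec S)) (tensor_yops n (map (\<lambda>a. std_yops (\<mu> a)) c) k j (r - s) (bvec Ss'))))"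
    unfolding Ss list.map tensor_yops.simps clinear_sum[OF G] by (simp add: tensor_op_def)
  also have "\<dots> = app (Top n \<mu> (a # c) i j r) (bvec (mono_of (a # c) Ss))"
    unfolding t Top_Cons_right[OF Cons.prems(1)] app_sum_left app_simps(6) Ss mono_of.simps ..
  finally show ?case .
qed

lemma clinear_mem:
  assumes "clinear f" "cvec.subspace W" "\<And>a. a \<in> Poly_Mapping.keys v \<Longrightarrow> f (bvec a) \<in> W"
  shows "f v \<in> W"
  using assms by (subst clinear_eq_lin_ext[OF assms(1)])
    (auto simp: lin_ext_def intro!: cvec.subspace_sum cvec.subspace_scale)

lemma mem_mono_of: "p \<in> mono_of c Ss \<longleftrightarrow> (\<exists>(a, S)\<in>set (zip c Ss). xrow p = a \<and> xcol p \<in> S)"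
  by (induction c Ss rule: mono_of.induct) (auto, metis image_eqI xvar.collapse)

lemma mono_of_upt:
  assumes "length Ss = m"
  shows "XV a j \<in> mono_of [1..<Suc m] Ss \<longleftrightarrow> a \<in> {1..m} \<and> j \<in> Ss ! (a - 1)"
proof -
  have "XV a j \<in> mono_of [1..<Suc m] Ss \<longleftrightarrow> (\<exists>i<m. a = Suc i \<and> j \<in> Ss ! i)"
  proof
    assume "XV a j \<in> mono_of [1..<Suc m] Ss"
    then show "\<exists>i<m. a = Suc i \<and> j \<in> Ss ! i"
      unfolding mem_mono_of using assms by (auto simp: set_zip simp del: upt_Suc)
  next
    assume "\<exists>i<m. a = Suc i \<and> j \<in> Ss ! i"
    then obtain i where i: "i < m" "a = Suc i" "j \<in> Ss ! i" by blast
    have "(a, Ss ! i) \<in> set (zip [1..<Suc m] Ss)"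
      unfolding set_zip using assms i by (auto intro!: exI[of _ i] simp del: upt_Suc)
    then show "XV a j \<in> mono_of [1..<Suc m] Ss"
      unfolding mem_mono_of using i(3) by (intro bexI) auto
  qed
  also have "\<dots> \<longleftrightarrow> a \<in> {1..m} \<and> j \<in> Ss ! (a - 1)"
    by (cases a) auto
  finally show ?thesis .
qed

section \<open>The inverse of the identification\<close>

definition rows_of :: "nat \<Rightarrow> xvar set \<Rightarrow> nat set list" where
  "rows_of m A = map (\<lambda>a. {j. XV a j \<in> A}) [1..<Suc m]"

text \<open>An explicit linear inverse, which replaces the \<open>inv_into\<close> in the definition
  of the intertwiner (see \<open>inv_G_map\<close>).\<close>

definition Ginv :: "nat \<Rightarrow> grass \<Rightarrow> (nat set list \<Rightarrow>\<^sub>0 complex)" where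
  "Ginv m = lin_ext (\<lambda>A. bvec (rows_of m A))"

lemma Ginv_bvec: "Ginv m (bvec A) = bvec (rows_of m A)"
  by (simp add: Ginv_def)

lemma rows_of_mono_of:
  assumes "length Ss = m"
  shows "rows_of m (mono_of [1..<Suc m] Ss) = Ss"
proof (rule nth_equalityI)
  fix i assume "i < length (rows_of m (mono_of [1..<Suc m] Ss))"
  then have i: "i < m" by (simp add: rows_of_def del: upt_Suc)
  then have "rows_of m (mono_of [1..<Suc m] Ss) ! i = {j. XV (Suc i) j \<in> mono_of [1..<Suc m] Ss}"
    by (simp add: rows_of_def del: upt_Suc)
  also have "\<dots> = Ss ! i" unfolding mono_of_upt[OF assms] using i by simp
  finally show "rows_of m (mono_of [1..<Suc m] Ss) ! i = Ss ! i" .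
qed (simp add: rows_of_def assms del: upt_Suc)

lemma mono_of_rows_of:
  assumes "\<And>p. p \<in> A \<Longrightarrow> xrow p \<in> {1..m}"
  shows "mono_of [1..<Suc m] (rows_of m A) = A"
proof -
  have "XV a j \<in> mono_of [1..<Suc m] (rows_of m A) \<longleftrightarrow> XV a j \<in> A" for a j
  proof -
    have "XV a j \<in> mono_of [1..<Suc m] (rows_of m A) \<longleftrightarrow> a \<in> {1..m} \<and> j \<in> rows_of m A ! (a - 1)"
      by (rule mono_of_upt) (simp add: rows_of_def del: upt_Suc)
    also have "\<dots> \<longleftrightarrow> a \<in> {1..m} \<and> XV a j \<in> A"
      by (auto simp: rows_of_def simp del: upt_Suc)
    also have "\<dots> \<longleftrightarrow> XV a j \<in> A" using assms[of "XV a j"] by auto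
    finally show ?thesis .
  qed
  then show ?thesis by (metis subsetI subset_antisym xvar.exhaust)
qed

definition Phi_label :: "nat \<Rightarrow> nat \<Rightarrow> (nat \<Rightarrow> nat) \<Rightarrow> nat set list \<Rightarrow> bool" where
  "Phi_label m n \<nu> Ss \<longleftrightarrow> list_all2 (\<lambda>a S. S \<subseteq> {1..n} \<and> card S = \<nu> a) [1..<Suc m] Ss"

lemma Phi_space_eq: "Phi_space m n \<nu> = {v. \<forall>Ss\<in>Poly_Mapping.keys v. Phi_label m n \<nu> Ss}"
  by (simp add: Phi_space_def Phi_label_def)

lemma subspace_Phi_space: "cvec.subspace (Phi_space m n \<nu>)"
proof (rule cvec.subspaceI)
  show "v + w \<in> Phi_space m n \<nu>" if "v \<in> Phi_space m n \<nu>" "w \<in> Phi_space m n \<nu>" for v w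
    using that keys_add[of v w] unfolding Phi_space_eq by blast
  show "cscale c v \<in> Phi_space m n \<nu>" if "v \<in> Phi_space m n \<nu>" for c v
    using that keys_cscale_subset[of c v] unfolding Phi_space_eq by blast
qed (simp add: Phi_space_eq)

lemma Phi_label_iff:
  "Phi_label m n \<nu> Ss \<longleftrightarrow> length Ss = m \<and> (\<forall>i<m. Ss ! i \<subseteq> {1..n} \<and> card (Ss ! i) = \<nu> (Suc i))"
  unfolding Phi_label_def list_all2_conv_all_nth by (auto simp del: upt_Suc)

lemma Phi_label_finite:
  assumes "Phi_label m n \<nu> Ss"
  shows "length Ss = m" "\<forall>S\<in>set Ss. finite S"
  using assms finite_subset[of _ "{1..n}"] by (auto simp: Phi_label_iff in_set_conv_nth)

lemma bvec_mono_of_Gw: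
  assumes "Phi_label m n \<nu> Ss"
  shows "bvec (mono_of [1..<Suc m] Ss) \<in> Gw n (wt m \<nu>)"
proof -
  let ?A = "mono_of [1..<Suc m] Ss"
  note mem = mono_of_upt[OF Phi_label_finite(1)[OF assms]]
  have "finite ?A" by (rule mono_of_finite[OF Phi_label_finite(2)[OF assms]])
  moreover have "xcol p \<in> {1..n}" if "p \<in> ?A" for p
  proof -
    have "xrow p \<in> {1..m}" "xcol p \<in> Ss ! (xrow p - 1)"
      using that mem[of "xrow p" "xcol p"] by simp_all
    moreover from this(1) have "Ss ! (xrow p - 1) \<subseteq> {1..n}"
      using assms unfolding Phi_label_iff by (cases "xrow p") auto
    ultimately show ?thesis by blast
  qed
  moreover have "int (card {p \<in> ?A. xrow p = a}) = wt m \<nu> a" for a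
  proof (cases "a \<in> {1..m}")
    case True
    then have "{j. XV a j \<in> ?A} = Ss ! (a - 1)" using mem by auto
    moreover have "card (Ss ! (a - 1)) = \<nu> a" using True assms unfolding Phi_label_iff by (cases a) auto
    ultimately show ?thesis unfolding card_row using True by (simp add: wt_def)
  next
    case False
    then have "{j. XV a j \<in> ?A} = {}" using mem by auto
    then show ?thesis unfolding card_row using False by (simp only: card.empty wt_def if_False of_nat_0)
  qed
  ultimately show ?thesis by (simp add: Gw_def)
qed

lemma Gw_label:
  assumes "w \<in> Gw n (wt m \<nu>)" "A \<in> Poly_Mapping.keys w"
  shows "Phi_label m n \<nu> (rows_of m A)" "mono_of [1..<Suc m] (rows_of m A) = A"
proof -
  have A: "finite A" "\<forall>p\<in>A. xcol p \<in> {1..n}" "\<And>a. int (card {p \<in> A. xrow p = a}) = wt m \<nu> a"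
    using assms by (auto simp: Gw_def)
  have row: "xrow p \<in> {1..m}" if "p \<in> A" for p
  proof (rule ccontr)
    assume "xrow p \<notin> {1..m}"
    then have "card {q \<in> A. xrow q = xrow p} = 0" using A(3)[of "xrow p"]
      unfolding wt_def by (simp only: if_False of_nat_eq_0_iff)
    then show False using A(1) that by auto
  qed
  then show "mono_of [1..<Suc m] (rows_of m A) = A" by (rule mono_of_rows_of)
  have "card {j. XV (Suc i) j \<in> A} = \<nu> (Suc i)" if "i < m" for i
    using A(3)[of "Suc i"] that unfolding card_row by (simp add: wt_def)
  moreover have "{j. XV (Suc i) j \<in> A} \<subseteq> {1..n}" for i
  proof
    fix j assume "j \<in> {j. XV (Suc i) j \<in> A}"
    then show "j \<in> {1..n}" using bspec[OF A(2), of "XV (Suc i) j"] by simp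
  qed
  ultimately show "Phi_label m n \<nu> (rows_of m A)"
    unfolding Phi_label_iff by (simp add: rows_of_def del: upt_Suc)
qed

lemma clinear_Ginv: "clinear (Ginv m)"
  unfolding Ginv_def by (rule clinear_lin_ext)

lemma Gm_Gw:
  assumes "v \<in> Phi_space m n \<nu>"
  shows "Gm [1..<Suc m] v \<in> Gw n (wt m \<nu>)"
  by (rule clinear_mem[OF clinear_Gm subspace_Gw], unfold Gm_bvec, rule bvec_mono_of_Gw)
    (use assms in \<open>simp add: Phi_space_eq\<close>)

lemma Ginv_Phi_space:
  assumes "w \<in> Gw n (wt m \<nu>)"
  shows "Ginv m w \<in> Phi_space m n \<nu>"
  by (rule clinear_mem[OF clinear_Ginv subspace_Phi_space])
    (use Gw_label(1)[OF assms] in \<open>simp add: Ginv_def Phi_space_eq\<close>)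

lemma Ginv_Gm:
  assumes "v \<in> Phi_space m n \<nu>"
  shows "Ginv m (Gm [1..<Suc m] v) = v"
proof (rule clinear_eqI_keys[where f = "\<lambda>v. Ginv m (Gm [1..<Suc m] v)" and g = "\<lambda>v. v"])
  show "clinear (\<lambda>v. Ginv m (Gm [1..<Suc m] v))" by (rule clinear_compose[OF clinear_Ginv clinear_Gm])
  show "clinear (\<lambda>v. v :: nat set list \<Rightarrow>\<^sub>0 complex)" by (simp add: clinear_def)
  fix Ss assume "Ss \<in> Poly_Mapping.keys v"
  then have "length Ss = m" using assms Phi_label_finite(1) by (auto simp: Phi_space_eq)
  then show "Ginv m (Gm [1..<Suc m] (bvec Ss)) = bvec Ss"
    by (simp only: Gm_bvec Ginv_bvec rows_of_mono_of)
qed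

lemma Gm_Ginv:
  assumes "w \<in> Gw n (wt m \<nu>)"
  shows "Gm [1..<Suc m] (Ginv m w) = w"
proof (rule clinear_eqI_keys[where f = "\<lambda>w. Gm [1..<Suc m] (Ginv m w)" and g = "\<lambda>w. w"])
  show "clinear (\<lambda>w. Gm [1..<Suc m] (Ginv m w))" by (rule clinear_compose[OF clinear_Gm clinear_Ginv])
  show "clinear (\<lambda>w. w :: grass)" by (simp add: clinear_def)
  fix A assume "A \<in> Poly_Mapping.keys w"
  then show "Gm [1..<Suc m] (Ginv m (bvec A)) = bvec A"
    using Gw_label(2)[OF assms] by (simp add: Ginv_def Gm_bvec del: upt_Suc)
qed

lemma Gm_inj:
  "v \<in> Phi_space m n \<nu> \<Longrightarrow> w \<in> Phi_space m n \<nu> \<Longrightarrow> Gm [1..<Suc m] v = Gm [1..<Suc m] w \<Longrightarrow> v = w"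
  by (metis Ginv_Gm)

lemma G_map_eq:
  assumes "v \<in> Phi_space m n \<nu>"
  shows "G_map v = Gm [1..<Suc m] v"
  unfolding G_map_def
proof (rule clinear_eqI_keys[OF clinear_lin_ext clinear_Gm])
  fix Ss assume "Ss \<in> Poly_Mapping.keys v"
  then have "Phi_label m n \<nu> Ss" using assms by (simp add: Phi_space_eq)
  note Ss = Phi_label_finite[OF this]
  have "gprod (concat (map2 (\<lambda>a S. map (XV a) (sorted_list_of_set S)) [1..<Suc m] Ss)) = bvec (mono_of [1..<Suc m] Ss)"
    by (rule gprod_mono_of) (simp_all add: Ss(2) strict_sorted_iff del: upt_Suc)
  then show "lin_ext (\<lambda>Ss. gprod (concat (map2 (\<lambda>a S. map (XV a) (sorted_list_of_set S)) [1..<Suc (length Ss)] Ss))) (bvec Ss)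
    = Gm [1..<Suc m] (bvec Ss)"
    by (simp add: Gm_bvec Ss(1) del: upt_Suc)
qed

lemma inv_G_map:
  assumes "w \<in> Gw n (wt m \<nu>)"
  shows "inv_into (Phi_space m n \<nu>) G_map w = Ginv m w"
proof (rule inv_into_f_eq)
  show "inj_on G_map (Phi_space m n \<nu>)"
    by (rule inj_onI) (metis G_map_eq Ginv_Gm)
  show "Ginv m w \<in> Phi_space m n \<nu>" by (rule Ginv_Phi_space[OF assms])
  then show "G_map (Ginv m w) = w" using Gm_Ginv[OF assms] G_map_eq by metis
qed

lemma Gm_Phi_yops:
  assumes "v \<in> Phi_space m n \<nu>"
  shows "Gm [1..<Suc m] (Phi_yops m n \<mu> i j r v) = app (Top n \<mu> [1..<Suc m] i j r) (Gm [1..<Suc m] v)"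
proof (rule clinear_eqI_keys[where f = "\<lambda>v. Gm [1..<Suc m] (Phi_yops m n \<mu> i j r v)"
      and g = "\<lambda>v. app (Top n \<mu> [1..<Suc m] i j r) (Gm [1..<Suc m] v)"])
  show "clinear (\<lambda>v. Gm [1..<Suc m] (Phi_yops m n \<mu> i j r v))"
    unfolding Phi_yops_def by (rule clinear_compose[OF clinear_Gm clinear_tensor_yops])
  show "clinear (\<lambda>v. app (Top n \<mu> [1..<Suc m] i j r) (Gm [1..<Suc m] v))"
    by (rule clinear_compose[OF clinear_app clinear_Gm])
  fix Ss assume "Ss \<in> Poly_Mapping.keys v"
  then have "Phi_label m n \<nu> Ss" using assms by (simp add: Phi_space_eq)
  note Ss = Phi_label_finite[OF this]
  show "Gm [1..<Suc m] (Phi_yops m n \<mu> i j r (bvec Ss)) = app (Top n \<mu> [1..<Suc m] i j r) (Gm [1..<Suc m] (bvec Ss))"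
    unfolding Phi_yops_def Gm_bvec by (rule Gm_tensor_yops) (simp_all add: Ss del: upt_Suc)
qed

section \<open>The tensor products as modules over the Yangian\<close>

lemma keys_sumE:
  assumes "b \<in> Poly_Mapping.keys (sum f S)"
  obtains x where "x \<in> S" "b \<in> Poly_Mapping.keys (f x)"
  using subsetD[OF keys_sum assms] by (elim UN_E)

lemma keys_tensor:
  assumes "u \<in> Poly_Mapping.keys (tensor x y)"
  obtains s t where "u = s # t" "s \<in> Poly_Mapping.keys x" "t \<in> Poly_Mapping.keys y"
proof -
  obtain s where s: "s \<in> Poly_Mapping.keys x" "u \<in> Poly_Mapping.keys (lin_ext (\<lambda>s. lin_ext (\<lambda>t. bvec (s # t)) y) (bvec s))"
    using assms unfolding tensor_def by (rule clinear_keys[OF clinear_lin_ext])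
  then have "u \<in> Poly_Mapping.keys (lin_ext (\<lambda>t. bvec (s # t)) y)" by simp
  then obtain t where "t \<in> Poly_Mapping.keys y" "u \<in> Poly_Mapping.keys (lin_ext (\<lambda>t. bvec (s # t)) (bvec t))"
    by (rule clinear_keys[OF clinear_lin_ext])
  then show thesis using that s by (auto split: if_splits)
qed

lemma keys_std_yops:
  assumes "S' \<in> Poly_Mapping.keys (std_yops z i k s (bvec S))" "S \<subseteq> {1..n}" "i \<in> {1..n}"
  shows "S' \<subseteq> {1..n} \<and> card S' = card S"
proof -
  have fin: "finite S" using assms(2) by (rule finite_subset) simp
  have "S' \<in> Poly_Mapping.keys (app (eop i k) (bvec S)) \<or> S' = S"
    using assms fin keys_cscale_subset[of "z ^ (s - 1)" "gl_act i k (bvec S)"]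
    by (auto simp: std_yops_def gl_act_bvec split: if_splits)
  then show ?thesis
  proof
    assume "S' \<in> Poly_Mapping.keys (app (eop i k) (bvec S))"
    then have S': "k \<in> S" "i \<notin> S - {k}" "S' = insert i (S - {k})"
      by (auto simp: eop_single split: if_splits)
    have "card S' = Suc (card (S - {k}))"
      unfolding S'(3) using fin S'(2) by (intro card_insert_disjoint) auto
    also have "\<dots> = card S" by (rule card_Suc_Diff1[OF fin S'(1)])
    finally show ?thesis using S'(3) assms(2,3) by blast
  qed (use assms in simp)
qed

lemma keys_tensor_yops:
  assumes "list_all2 (\<lambda>a S. S \<subseteq> {1..n} \<and> card S = \<nu> a) c Ss" "i \<in> {1..n}"
    "Ss' \<in> Poly_Mapping.keys (tensor_yops n (map (\<lambda>a. std_yops (\<mu> a)) c) i j r (bvec Ss))"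
  shows "list_all2 (\<lambda>a S. S \<subseteq> {1..n} \<and> card S = \<nu> a) c Ss'"
  using assms
proof (induction c arbitrary: Ss Ss' i r)
  case Nil
  then show ?case by (auto split: if_splits)
next
  case (Cons a c)
  obtain S Ss0 where Ss: "Ss = S # Ss0" "S \<subseteq> {1..n}" "card S = \<nu> a"
    "list_all2 (\<lambda>a S. S \<subseteq> {1..n} \<and> card S = \<nu> a) c Ss0"
    using Cons.prems(1) by (auto simp: list_all2_Cons1)
  have "Ss' \<in> Poly_Mapping.keys (\<Sum>k\<in>{1..n}. \<Sum>s\<le>r. tensor (std_yops (\<mu> a) i k s (bvec S))
      (tensor_yops n (map (\<lambda>a. std_yops (\<mu> a)) c) k j (r - s) (bvec Ss0)))"
    using Cons.prems(3) unfolding Ss(1) by (simp add: tensor_op_def)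
  then obtain k where k: "k \<in> {1..n}"
    and "Ss' \<in> Poly_Mapping.keys (\<Sum>s\<le>r. tensor (std_yops (\<mu> a) i k s (bvec S))
      (tensor_yops n (map (\<lambda>a. std_yops (\<mu> a)) c) k j (r - s) (bvec Ss0)))"
    by (rule keys_sumE)
  from this(2) obtain s where
    "Ss' \<in> Poly_Mapping.keys (tensor (std_yops (\<mu> a) i k s (bvec S))
      (tensor_yops n (map (\<lambda>a. std_yops (\<mu> a)) c) k j (r - s) (bvec Ss0)))"
    by (rule keys_sumE)
  then obtain S' Ss1 where "Ss' = S' # Ss1" "S' \<in> Poly_Mapping.keys (std_yops (\<mu> a) i k s (bvec S))"
    "Ss1 \<in> Poly_Mapping.keys (tensor_yops n (map (\<lambda>a. std_yops (\<mu> a)) c) k j (r - s) (bvec Ss0))"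
    by (rule keys_tensor)
  then show ?case
    using keys_std_yops[of S' "\<mu> a" i k s S n] Cons.IH[OF Ss(4) k, of Ss1 "r - s"] Ss Cons.prems(2) by simp
qed

lemma Phi_yops_closed:
  assumes "v \<in> Phi_space m n \<nu>" "i \<in> {1..n}"
  shows "Phi_yops m n \<mu> i j r v \<in> Phi_space m n \<nu>"
proof (rule clinear_mem[where f = "Phi_yops m n \<mu> i j r" and v = v])
  show "clinear (Phi_yops m n \<mu> i j r)" unfolding Phi_yops_def by (rule clinear_tensor_yops)
  show "cvec.subspace (Phi_space m n \<nu>)" by (rule subspace_Phi_space)
  fix Ss assume "Ss \<in> Poly_Mapping.keys v"
  then have "Phi_label m n \<nu> Ss" using assms by (simp add: Phi_space_eq)
  then show "Phi_yops m n \<mu> i j r (bvec Ss) \<in> Phi_space m n \<nu>"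
    using keys_tensor_yops[OF _ assms(2)] unfolding Phi_space_eq Phi_label_def Phi_yops_def by blast
qed

text \<open>The relations are known for \<open>Top\<close> on the Grassmann algebra
  (\<open>Top_relation\<close>) and are carried back by the injectivity of
  \<open>Gm\<close>.\<close>

lemma yangian_module_Phi: "yangian_module n (Phi_yops m n \<mu>) (Phi_space m n \<nu>)"
proof (rule yangian_module.intro)
  let ?c = "[1..<Suc m]"
  let ?C = "coeff_act (Phi_yops m n \<mu>)"
  let ?V = "Phi_space m n \<nu>"
  show "clinear (Phi_yops m n \<mu> i j r)" for i j r
    unfolding Phi_yops_def by (rule clinear_tensor_yops)
  show "cvec.subspace ?V" by (rule subspace_Phi_space)
  show "Phi_yops m n \<mu> i j r v \<in> ?V" if "(i, j, r) \<in> ygens n" "v \<in> ?V" for i j r v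
    using that by (intro Phi_yops_closed) (auto simp: ygens_def)
  have C: "?C i j r v \<in> ?V \<and> Gm ?c (?C i j r v) = app (Top n \<mu> ?c i j r) (Gm ?c v)"
    if "i \<in> {1..n}" "v \<in> ?V" for i j r v
  proof (cases "r = 0")
    case True
    have "Top n \<mu> ?c i j 0 = (if i = j then 1 else 0)" by (rule Top_0[OF that(1)])
    then show ?thesis
      using that True cvec.subspace_0[OF subspace_Phi_space]
      by (simp add: coeff_act_def clinear_zero[OF clinear_Gm] del: upt_Suc)
  next
    case False
    then show ?thesis
      using Phi_yops_closed[OF that(2,1)] Gm_Phi_yops[OF that(2)] by (simp add: coeff_act_def del: upt_Suc)
  qed
  fix i j k l r s v
  assume ijkl: "i \<in> {1..n}" "j \<in> {1..n}" "k \<in> {1..n}" "l \<in> {1..n}" and v: "v \<in> ?V"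
  note CV = C[THEN conjunct1] and CG = C[THEN conjunct2]
  note d = cvec.subspace_diff[OF subspace_Phi_space]
  show "?C i j (Suc r) (?C k l s v) - ?C k l s (?C i j (Suc r) v) - (?C i j r (?C k l (Suc s) v) - ?C k l (Suc s) (?C i j r v))
      = ?C k j r (?C i l s v) - ?C k j s (?C i l r v)"
  proof (rule Gm_inj)
    show "?C i j (Suc r) (?C k l s v) - ?C k l s (?C i j (Suc r) v) - (?C i j r (?C k l (Suc s) v) - ?C k l (Suc s) (?C i j r v)) \<in> ?V"
      by (intro d CV ijkl v)
    show "?C k j r (?C i l s v) - ?C k j s (?C i l r v) \<in> ?V"
      by (intro d CV ijkl v)
    show "Gm ?c (?C i j (Suc r) (?C k l s v) - ?C k l s (?C i j (Suc r) v) - (?C i j r (?C k l (Suc s) v) - ?C k l (Suc s) (?C i j r v)))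
      = Gm ?c (?C k j r (?C i l s v) - ?C k j s (?C i l r v))"
      unfolding clinear_diff[OF clinear_Gm]
      using arg_cong[OF Top_relation[OF distinct_upt[of 1 "Suc m"] ijkl, of \<mu> r s], of "\<lambda>A. app A (Gm ?c v)"]
      by (simp only: CG CV ijkl v app_simps)
  qed
qed

section \<open>Reversal of the rows by the longest permutation\<close>

lemma sigma0_involution: "sigma0 m (sigma0 m a) = a"
  by (auto simp: sigma0_def)

lemma perm_act_sigma0: "perm_act (sigma0 m) w a = w (sigma0 m a)"
proof -
  have "inv_into UNIV (sigma0 m) a = sigma0 m a"
    by (rule inv_f_eq[OF inj_on_inverseI[of _ "sigma0 m"]]) (rule sigma0_involution)+
  then show ?thesis by (simp add: perm_act_def)
qed

abbreviation flip :: "nat \<Rightarrow> xvar \<Rightarrow> xvar" where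
  "flip m p \<equiv> XV (sigma0 m (xrow p)) (xcol p)"

lemma flip_flip: "flip m (flip m p) = p"
  by (simp add: sigma0_involution)

lemma inj_flip: "inj (\<lambda>p. flip m p)"
  by (rule inj_on_inverseI[of _ "\<lambda>p. flip m p"]) (rule flip_flip)

text \<open>For the decreasing list of rows the renamed list is the increasing one
  (\<open>map_sigma0_rev\<close>), so the reversed product becomes the action with permuted
  parameters on the target module.\<close>

lemma ren_flip_Top:
  "ren (\<lambda>p. flip m p) * Top n \<mu> c i j r
   = Top n (perm_act (sigma0 m) \<mu>) (map (sigma0 m) c) i j r * ren (\<lambda>p. flip m p)"
proof (induction c arbitrary: i r)
  case (Cons a c)
  have "ren (\<lambda>p. flip m p) * Eop a i k = Eop (sigma0 m a) i k * ren (\<lambda>p. flip m p)" for k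
    using ren_eop[OF inj_flip, of m "XV a i" "XV a k"] by simp
  then have L: "ren (\<lambda>p. flip m p) * Lop \<mu> a i k s = Lop (perm_act (sigma0 m) \<mu>) (sigma0 m a) i k s * ren (\<lambda>p. flip m p)" for k s
    by (simp add: Lop_def perm_act_sigma0 sigma0_involution sc_left[of "ren (\<lambda>p. flip m p)"] mult.assoc)
  have "ren (\<lambda>p. flip m p) * (Lop \<mu> a i k s * Top n \<mu> c k j t)
     = Lop (perm_act (sigma0 m) \<mu>) (sigma0 m a) i k s * Top n (perm_act (sigma0 m) \<mu>) (map (sigma0 m) c) k j t * ren (\<lambda>p. flip m p)" for k s t
    by (metis L Cons mult.assoc)
  then show ?case by (simp only: list.map Top.simps sum_distrib_left sum_distrib_right)
qed simp

lemma map_sigma0_rev: "map (sigma0 m) (rev [1..<Suc m]) = [1..<Suc m]"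
  by (rule nth_equalityI) (auto simp: sigma0_def rev_nth simp del: upt_Suc)

lemma ren_flip_Gw:
  assumes "w \<in> Gw n (wt m \<nu>)"
  shows "app (ren (\<lambda>p. flip m p)) w \<in> Gw n (wt m (perm_act (sigma0 m) \<nu>))"
proof (rule clinear_mem[OF clinear_app subspace_Gw, where v = w])
  fix A assume "A \<in> Poly_Mapping.keys w"
  then have A: "finite A" "\<forall>p\<in>A. xcol p \<in> {1..n}" "\<And>a. int (card {p \<in> A. xrow p = a}) = wt m \<nu> a"
    using assms by (auto simp: Gw_def)
  have ren: "app (ren (\<lambda>p. flip m p)) (bvec A) = gprod (map (\<lambda>p. flip m p) (sorted_list_of_set A))"
    using A(1) by (simp add: ren_def)
  have wt: "wt m \<nu> (sigma0 m a) = wt m (perm_act (sigma0 m) \<nu>) a" for a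
    by (auto simp: wt_def perm_act_sigma0 sigma0_def)
  have card: "card {p \<in> (\<lambda>p. flip m p) ` A. xrow p = a} = card {p \<in> A. xrow p = sigma0 m a}" for a
  proof -
    have "{p \<in> (\<lambda>p. flip m p) ` A. xrow p = a} = (\<lambda>p. flip m p) ` {p \<in> A. xrow p = sigma0 m a}"
    proof (intro subset_antisym subsetI)
      fix q assume "q \<in> {p \<in> (\<lambda>p. flip m p) ` A. xrow p = a}"
      then obtain p where "p \<in> A" "q = flip m p" "sigma0 m (xrow p) = a" by auto
      then show "q \<in> (\<lambda>p. flip m p) ` {p \<in> A. xrow p = sigma0 m a}"
        by (intro image_eqI[of _ _ p]) (auto simp: sigma0_involution)
    next
      fix q assume "q \<in> (\<lambda>p. flip m p) ` {p \<in> A. xrow p = sigma0 m a}"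
      then obtain p where "p \<in> A" "q = flip m p" "xrow p = sigma0 m a" by auto
      moreover from this have "xrow q = a" by (simp add: sigma0_involution)
      ultimately show "q \<in> {p \<in> (\<lambda>p. flip m p) ` A. xrow p = a}" by blast
    qed
    then show ?thesis by (simp only: card_image[OF inj_on_subset[OF inj_flip subset_UNIV]])
  qed
  have "(\<forall>p\<in>(\<lambda>p. flip m p) ` A. xcol p \<in> {1..n}) \<and>
      (\<forall>a. int (card {p \<in> (\<lambda>p. flip m p) ` A. xrow p = a}) = wt m (perm_act (sigma0 m) \<nu>) a)"
    using A(2,3) by (simp only: card wt ball_simps xvar.sel) blast
  moreover have "B = (\<lambda>p. flip m p) ` A" if "B \<in> Poly_Mapping.keys (app (ren (\<lambda>p. flip m p)) (bvec A))" for B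
    using finite_keys_gprod[OF that[unfolded ren]] A(1) by simp
  ultimately show "app (ren (\<lambda>p. flip m p)) (bvec A) \<in> Gw n (wt m (perm_act (sigma0 m) \<nu>))"
    using A(1) unfolding Gw_def by blast
qed

lemma ren_flip_ren_flip:
  assumes "w \<in> Gw n (wt m \<nu>)"
  shows "app (ren (\<lambda>p. flip m p)) (app (ren (\<lambda>p. flip m p)) w) = w"
proof -
  have "app (ren (\<lambda>p. flip m p) * ren (\<lambda>p. flip m p)) w = app finpart w"
    by (subst ren_ren) (simp_all only: flip_flip)
  also have "\<dots> = w" by (rule finpart_finite) (rule Gw_finite[OF assms])
  finally show ?thesis by simp
qed

text \<open>The part of the intertwiner that follows Z: renaming by the longest permutation, then
  the inverse identification, with the sign as a parameter \<open>s\<close>.\<close>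

definition unG :: "nat \<Rightarrow> complex \<Rightarrow> grass \<Rightarrow> (nat set list \<Rightarrow>\<^sub>0 complex)" where
  "unG m s w = cscale s (Ginv m (app (ren (\<lambda>p. flip m p)) w))"

lemma clinear_unG: "clinear (unG m s)"
  by (rule clinearI) (simp_all add: unG_def app_add app_cscale clinear_add[OF clinear_Ginv]
      clinear_cscale[OF clinear_Ginv] cvec.scale_right_distrib mult.commute)

lemma unG_Phi_space:
  assumes "w \<in> Gw n (wt m \<nu>)"
  shows "unG m s w \<in> Phi_space m n (perm_act (sigma0 m) \<nu>)"
  unfolding unG_def
  by (intro cvec.subspace_scale[OF subspace_Phi_space] Ginv_Phi_space ren_flip_Gw assms)

lemma Gm_unG:
  assumes "w \<in> Gw n (wt m \<nu>)"
  shows "Gm [1..<Suc m] (unG m s w) = cscale s (app (ren (\<lambda>p. flip m p)) w)"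
  unfolding unG_def clinear_cscale[OF clinear_Gm] Gm_Ginv[OF ren_flip_Gw[OF assms]] ..

lemma unG_eq_0:
  assumes "w \<in> Gw n (wt m \<nu>)" "unG m s w = 0" "s \<noteq> 0"
  shows "w = 0"
proof -
  have "cscale s (app (ren (\<lambda>p. flip m p)) w) = 0"
    using Gm_unG[OF assms(1), of s] assms(2) by (simp only: clinear_zero[OF clinear_Gm])
  then have "app (ren (\<lambda>p. flip m p)) w = 0" using assms(3) by (simp only: cvec.scale_eq_0_iff) simp
  then show ?thesis using ren_flip_ren_flip[OF assms(1)] by (simp only: clinear_zero[OF clinear_app])
qed

lemma unG_yops:
  assumes "w \<in> Gw n (wt m \<nu>)" "i \<in> {1..n}"
  shows "Phi_yops m n (perm_act (sigma0 m) \<mu>) i j r (unG m s w)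
    = unG m s (app (Top n \<mu> (rev [1..<Suc m]) i j r) w)"
proof (rule Gm_inj)
  let ?c = "[1..<Suc m]" and ?ren = "ren (\<lambda>p. flip m p)"
  note V = unG_Phi_space[OF assms(1), of s]
  have T: "app (Top n \<mu> (rev ?c) i j r) w \<in> Gw n (wt m \<nu>)" by (rule Top_Gw[OF assms])
  show "Phi_yops m n (perm_act (sigma0 m) \<mu>) i j r (unG m s w) \<in> Phi_space m n (perm_act (sigma0 m) \<nu>)"
    by (rule Phi_yops_closed[OF V assms(2)])
  show "unG m s (app (Top n \<mu> (rev ?c) i j r) w) \<in> Phi_space m n (perm_act (sigma0 m) \<nu>)"
    by (rule unG_Phi_space[OF T])
  have "app (Top n (perm_act (sigma0 m) \<mu>) ?c i j r) (app ?ren w)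
      = app ?ren (app (Top n \<mu> (rev ?c) i j r) w)"
    using arg_cong[OF ren_flip_Top[of m n \<mu> "rev ?c" i j r], of "\<lambda>A. app A w"]
    by (simp only: app_simps map_sigma0_rev)
  then show "Gm ?c (Phi_yops m n (perm_act (sigma0 m) \<mu>) i j r (unG m s w))
      = Gm ?c (unG m s (app (Top n \<mu> (rev ?c) i j r) w))"
    by (simp only: Gm_Phi_yops[OF V] Gm_unG[OF T] Gm_unG[OF assms(1)] app_cscale)
qed

section \<open>Transfer of the results to the tensor products\<close>

context dominant_weights
begin

text \<open>Passes from the given operators, with \<open>Sum_any\<close>, \<open>gsubst\<close> and
  \<open>inv_into\<close>, to elements of the operator ring. Each replacement is justified by
  membership in a weight space.\<close>

lemma I_op_eq:
  assumes "normal_ordering m ps" "v \<in> Phi_space m n \<nu>"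
  shows "I_op m n lam \<mu> \<nu> ps v
    = unG m ((-1) ^ (\<Sum>(a, b)\<in>pos_pairs m. \<nu> a * \<nu> b)) (app (Zlin n lam \<mu> \<nu> ps) (Gm [1..<Suc m] v))"
proof -
  let ?w = "app (Zlin n lam \<mu> \<nu> ps) (Gm [1..<Suc m] v)"
  note G = Gm_Gw[OF assms(2)]
  note Z = Zlin_Gw[OF G, of lam \<mu> \<nu> ps]
  have "(a, b) \<in> set ps \<Longrightarrow> a \<noteq> b" for a b
    using assms(1) by (auto simp: normal_ordering_def pos_pairs_def)
  then have "Z_op n lam \<mu> \<nu> ps (G_map v) = ?w"
    unfolding G_map_eq[OF assms(2)] by (intro Z_op_eq[OF G wt_le])
  moreover have "perm_grass (sigma0 m) ?w = app (ren (\<lambda>p. flip m p)) ?w"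
    unfolding perm_grass_def by (rule gsubst_eq_ren) (rule Gw_finite[OF Z])
  ultimately show ?thesis
    by (simp only: I_op_def unG_def inv_G_map[OF ren_flip_Gw[OF Z]])
qed

lemma I_op_linear_between:
  assumes "normal_ordering m ps"
  shows "linear_between (Phi_space m n \<nu>) (Phi_space m n (perm_act (sigma0 m) \<nu>)) (I_op m n lam \<mu> \<nu> ps)"
proof -
  note V = cvec.subspace_add[OF subspace_Phi_space[of m n \<nu>]] cvec.subspace_scale[OF subspace_Phi_space[of m n \<nu>]]
  note lin = clinear_add[OF clinear_Gm] clinear_cscale[OF clinear_Gm] app_add app_cscale
    clinear_add[OF clinear_unG] clinear_cscale[OF clinear_unG]
  show ?thesis
    unfolding linear_between_def
  proof (intro conjI ballI allI)
    show "I_op m n lam \<mu> \<nu> ps ` Phi_space m n \<nu> \<subseteq> Phi_space m n (perm_act (sigma0 m) \<nu>)"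
    proof
      fix u assume "u \<in> I_op m n lam \<mu> \<nu> ps ` Phi_space m n \<nu>"
      then obtain v where "v \<in> Phi_space m n \<nu>" "u = I_op m n lam \<mu> \<nu> ps v" by blast
      then show "u \<in> Phi_space m n (perm_act (sigma0 m) \<nu>)"
        by (simp only: I_op_eq[OF assms]) (intro unG_Phi_space Zlin_Gw Gm_Gw)
    qed
  qed (simp_all only: I_op_eq[OF assms] V lin)
qed

lemma I_op_nonzero:
  assumes "normal_ordering m ps"
  shows "\<exists>v\<in>Phi_space m n \<nu>. I_op m n lam \<mu> \<nu> ps v \<noteq> 0"
proof
  let ?v = "Ginv m (bvec (xi_set m \<nu>))"
  show v: "?v \<in> Phi_space m n \<nu>" by (rule Ginv_Phi_space[OF xi_Gw])
  have "app (Zlin n lam \<mu> \<nu> ps) (Gm [1..<Suc m] ?v) = bvec (xi_set m \<nu>)"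
    unfolding Gm_Ginv[OF xi_Gw] using assms by (intro Zlin_xi) (simp add: normal_ordering_def)
  moreover have "bvec (xi_set m \<nu>) \<noteq> 0"
    using lookup_single_eq[of "xi_set m \<nu>" "1 :: complex"] by (metis lookup_zero zero_neq_one)
  ultimately show "I_op m n lam \<mu> \<nu> ps ?v \<noteq> 0"
    unfolding I_op_eq[OF assms v] using unG_eq_0[OF xi_Gw] by fastforce
qed

lemma I_op_yops:
  assumes "normal_ordering m ps" "v \<in> Phi_space m n \<nu>" "i \<in> {1..n}" "j \<in> {1..n}"
  shows "I_op m n lam \<mu> \<nu> ps (Phi_yops m n \<mu> i j r v)
    = Phi_yops m n (perm_act (sigma0 m) \<mu>) i j r (I_op m n lam \<mu> \<nu> ps v)"
  unfolding I_op_eq[OF assms(1,2)] I_op_eq[OF assms(1) Phi_yops_closed[OF assms(2,3)]]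
    Gm_Phi_yops[OF assms(2)] Zlin_Top[OF assms(1) Gm_Gw[OF assms(2)] assms(3,4)]
  by (rule unG_yops[symmetric, OF Zlin_Gw[OF Gm_Gw[OF assms(2)]] assms(3)])

lemma I_op_image_irreducible:
  assumes "normal_ordering m ps"
  shows "yangian_irreducible n (Phi_yops m n (perm_act (sigma0 m) \<mu>)) (I_op m n lam \<mu> \<nu> ps ` Phi_space m n \<nu>)"
proof -
  let ?V = "Phi_space m n \<nu>" and ?V' = "Phi_space m n (perm_act (sigma0 m) \<nu>)"
  let ?T' = "Phi_yops m n (perm_act (sigma0 m) \<mu>)"
  let ?I = "I_op m n lam \<mu> \<nu> ps" and ?Z = "app (Zlin n lam \<mu> \<nu> ps)"
  let ?J = "unG m ((-1) ^ (\<Sum>(a, b)\<in>pos_pairs m. \<nu> a * \<nu> b))"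
  let ?ZG = "?Z ` Gw n (wt m \<nu>)"
  interpret V': yangian_module n ?T' ?V' by (rule yangian_module_Phi)
  note lin = I_op_linear_between[OF assms, unfolded linear_between_def]
  have IV: "?I ` ?V = ?J ` ?ZG"
  proof (intro subset_antisym subsetI)
    fix u assume "u \<in> ?I ` ?V"
    then obtain v where v: "v \<in> ?V" "u = ?I v" by blast
    then show "u \<in> ?J ` ?ZG"
      unfolding v(2) I_op_eq[OF assms v(1)] by (intro imageI Gm_Gw)
  next
    fix u assume "u \<in> ?J ` ?ZG"
    then obtain w where w: "w \<in> Gw n (wt m \<nu>)" "u = ?J (?Z w)" by blast
    have "u = ?I (Ginv m w)"
      unfolding w(2) I_op_eq[OF assms Ginv_Phi_space[OF w(1)]] Gm_Ginv[OF w(1)] ..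
    then show "u \<in> ?I ` ?V" using Ginv_Phi_space[OF w(1)] by blast
  qed
  have sub: "?I ` ?V \<subseteq> ?V'" using lin by blast
  have subsp: "cvec.subspace (?I ` ?V)"
  proof (rule cvec.subspaceI)
    have "?I (cscale 0 0) = cscale 0 (?I 0)"
      using lin cvec.subspace_0[OF subspace_Phi_space[of m n \<nu>]] by blast
    then show "0 \<in> ?I ` ?V"
      using cvec.subspace_0[OF subspace_Phi_space[of m n \<nu>]] by (auto intro!: image_eqI[of _ _ 0])
    fix x y assume x: "x \<in> ?I ` ?V" and y: "y \<in> ?I ` ?V"
    obtain v w where "v \<in> ?V" "w \<in> ?V" "x = ?I v" "y = ?I w" using x y by blast
    then show "x + y \<in> ?I ` ?V"
      using lin cvec.subspace_add[OF subspace_Phi_space[of m n \<nu>], of v w] by (intro image_eqI[of _ _ "v + w"]) simp_all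
  next
    fix c x assume "x \<in> ?I ` ?V"
    then obtain v where "v \<in> ?V" "x = ?I v" by blast
    then show "cscale c x \<in> ?I ` ?V"
      using lin cvec.subspace_scale[OF subspace_Phi_space[of m n \<nu>], of v c] by (intro image_eqI[of _ _ "cscale c v"]) simp_all
  qed
  have stab: "yangian_stable n ?T' (?I ` ?V)"
    unfolding V'.yangian_stable_iff[OF subsp sub]
  proof (intro allI impI ballI)
    fix i j r u assume g: "(i, j, r) \<in> ygens n" and "u \<in> ?I ` ?V"
    then obtain v where v: "v \<in> ?V" "u = ?I v" by blast
    have ij: "i \<in> {1..n}" "j \<in> {1..n}" using g by (auto simp: ygens_def)
    show "?T' i j r u \<in> ?I ` ?V"
      unfolding v(2) I_op_yops[OF assms v(1) ij, symmetric] by (intro imageI Phi_yops_closed v ij)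
  qed
  have irr: "W = ?I ` ?V" if W: "cvec.subspace W" "W \<subseteq> ?I ` ?V" "yangian_stable n ?T' W" "W \<noteq> {0}" for W
  proof -
    \<comment> \<open>A submodule of the image is pulled back along \<open>?J\<close> to the image
      of Z, where \<open>Zlin_image_irreducible\<close> applies.\<close>
    let ?W0 = "{w \<in> ?ZG. ?J w \<in> W}"
    have ZG: "w \<in> Gw n (wt m \<nu>)" if "w \<in> ?ZG" for w using that by (auto intro: Zlin_Gw)
    have Wstab: "?T' i j r w \<in> W" if "(i, j, r) \<in> ygens n" "w \<in> W" for i j r w
      using that W(2,3) sub V'.yangian_stable_iff[OF W(1)] by blast
    have W0: "cvec.subspace ?W0"
      proof (rule cvec.subspaceI)
        have "0 \<in> ?ZG" by (rule image_eqI[of _ _ 0]) (simp_all add: clinear_zero[OF clinear_app])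
        then show "0 \<in> ?W0" using cvec.subspace_0[OF W(1)] by (simp add: clinear_zero[OF clinear_unG])
        fix x y assume x: "x \<in> ?W0" and y: "y \<in> ?W0"
        obtain v w where "v \<in> Gw n (wt m \<nu>)" "w \<in> Gw n (wt m \<nu>)" "x = ?Z v" "y = ?Z w" using x y by blast
        then have "x + y \<in> ?ZG" by (intro image_eqI[of _ _ "v + w"]) (simp_all add: app_add add_Gw)
        then show "x + y \<in> ?W0"
          using x y cvec.subspace_add[OF W(1)] by (simp add: clinear_add[OF clinear_unG])
      next
        fix c x assume x: "x \<in> ?W0"
        then obtain v where "v \<in> Gw n (wt m \<nu>)" "x = ?Z v" by blast
        then have "cscale c x \<in> ?ZG" by (intro image_eqI[of _ _ "cscale c v"]) (simp_all add: app_cscale cscale_Gw)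
        then show "cscale c x \<in> ?W0"
          using x cvec.subspace_scale[OF W(1)] by (simp add: clinear_cscale[OF clinear_unG])
      qed
    have "?W0 = ?ZG"
    proof (rule Zlin_image_irreducible[OF assms W0])
      show "?W0 \<subseteq> ?ZG" by blast
      obtain u where u: "u \<in> W" "u \<noteq> 0" using W(4) cvec.subspace_0[OF W(1)] by blast
      then obtain w where w: "w \<in> ?ZG" "u = ?J w" using W(2) unfolding IV by blast
      then have "w \<noteq> 0" using u(2) by (auto simp: clinear_zero[OF clinear_unG])
      moreover have "w \<in> ?W0" using w u(1) by blast
      ultimately show "?W0 \<noteq> {0}" by blast
      fix i j r w assume ij: "i \<in> {1..n}" "j \<in> {1..n}" and w: "w \<in> ?W0"
      let ?T = "app (Top n \<mu> (rev [1..<Suc m]) i j r)"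
      show "?T w \<in> ?W0"
      \<comment> \<open>Stability under the Yangian speaks of generators, hence of r \<ge> 1; for r
        = 0 the operator is a scalar.\<close>
      proof (cases "r = 0")
        case True
        have "Top n \<mu> (rev [1..<Suc m]) i j 0 = (if i = j then 1 else 0)" by (rule Top_0[OF ij(1)])
        moreover have "0 \<in> ?W0" by (rule cvec.subspace_0[OF W0])
        ultimately show ?thesis using True w by (simp del: upt_Suc)
      next
        case False
        then have g: "(i, j, r) \<in> ygens n" using ij by (simp add: ygens_def)
        obtain v where v: "v \<in> Gw n (wt m \<nu>)" "w = ?Z v" using w by blast
        have "?T w = ?Z (app (Top n \<mu> [1..<Suc m] i j r) v)"
          unfolding v(2) by (rule Zlin_Top[OF assms v(1) ij, symmetric])
        then have "?T w \<in> ?ZG" using Top_Gw[OF v(1) ij(1)] by blast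
        moreover have "?J (?T w) \<in> W"
          using Wstab[OF g] w unG_yops[OF ZG ij(1), of w \<mu> j r] by (metis (no_types, lifting) mem_Collect_eq)
        ultimately show ?thesis by blast
      qed
    qed
    then show ?thesis using W(2) unfolding IV by blast
  qed
  have "?I ` ?V \<noteq> {0}" using I_op_nonzero[OF assms] by blast
  then show ?thesis
    unfolding yangian_irreducible_def using subsp stab irr by blast
qed

end

theorem proposition2p1:
  fixes m n :: nat and lam mu :: "nat \<Rightarrow> complex" and nu :: "nat \<Rightarrow> nat"
  assumes "m \<ge> 1" and "n \<ge> 1"
    and nu: "\<forall>a\<in>{1..m}. lam a - mu a = of_nat (nu a) \<and> nu a \<le> n"
    and dominant: "\<forall>a b. 1 \<le> a \<and> a < b \<and> b \<le> m \<longrightarrow>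
          (\<forall>k::nat. k \<ge> 1 \<longrightarrow> lam a - lam b \<noteq> - of_nat k)"
  shows
   "let I = I_op m n lam mu nu;
        V = Phi_space m n nu; T = Phi_yops m n mu;
        V' = Phi_space m n (perm_act (sigma0 m) nu); T' = Phi_yops m n (perm_act (sigma0 m) mu)
    in (\<forall>ps. normal_ordering m ps \<longrightarrow>
          linear_between V V' (I ps) \<and>
          (\<exists>v\<in>V. I ps v \<noteq> 0) \<and>
          (\<forall>qs. normal_ordering m qs \<longrightarrow> (\<forall>v\<in>V. I ps v = I qs v)) \<and>
          (\<forall>y\<in>carrier (yangian n). \<forall>v\<in>V. I ps (yangian_act T y v) = yangian_act T' y (I ps v)) \<and>
          yangian_irreducible n T' (I ps ` V))"
proof -
  interpret dominant_weights m n lam mu nu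
    by unfold_locales (use nu dominant in blast)+
  show ?thesis
    unfolding Let_def
  proof (intro allI impI conjI ballI)
    fix ps assume ps: "normal_ordering m ps"
    show "linear_between (Phi_space m n nu) (Phi_space m n (perm_act (sigma0 m) nu)) (I_op m n lam mu nu ps)"
      by (rule I_op_linear_between[OF ps])
    show "\<exists>v\<in>Phi_space m n nu. I_op m n lam mu nu ps v \<noteq> 0" by (rule I_op_nonzero[OF ps])
    show "I_op m n lam mu nu ps v = I_op m n lam mu nu qs v"
      if "normal_ordering m qs" "v \<in> Phi_space m n nu" for qs v
      unfolding I_op_eq[OF ps that(2)] I_op_eq[OF that] Zlin_unique[OF ps that(1) Gm_Gw[OF that(2)]] ..
    show "yangian_irreducible n (Phi_yops m n (perm_act (sigma0 m) mu)) (I_op m n lam mu nu ps ` Phi_space m n nu)"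
      by (rule I_op_image_irreducible[OF ps])
    show "I_op m n lam mu nu ps (yangian_act (Phi_yops m n mu) y v)
        = yangian_act (Phi_yops m n (perm_act (sigma0 m) mu)) y (I_op m n lam mu nu ps v)"
      if "y \<in> carrier (yangian n)" "v \<in> Phi_space m n nu" for y v
    proof (rule yangian_act_intertwine[OF yangian_module_Phi yangian_module_Phi I_op_linear_between[OF ps] _ that])
      show "I_op m n lam mu nu ps (Phi_yops m n mu i j r v)
          = Phi_yops m n (perm_act (sigma0 m) mu) i j r (I_op m n lam mu nu ps v)"
        if "(i, j, r) \<in> ygens n" "v \<in> Phi_space m n nu" for i j r v
        using that by (intro I_op_yops[OF ps]) (auto simp: ygens_def)
    qed
  qed
qed

end
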